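(* Let $D=(G,\mathcal{O},w)$ be a weighted oriented graph where $G$ is a perfect graph. Then $G$ has a $\tau$-reduction $H_1,\dots,H_s$ in which every $H_i$ is a complete graph. Furthermore, for such a $\tau$-reduction, $I(D)$ is unmixed if and only if no $H_i$ (regarded as the induced weighted oriented subgraph of $D$ on $V(H_i)$) has a generating $\star$-semi-forest.
   Context: A weighted oriented graph is a triple $D=(G,\mathcal{O},w)$ with $G$ a finite simple graph with vertex set $\{x_1,\dots,x_n\}$, $\mathcal{O}$ an orientation of the edges of $G$, and $w:V(G)\to\mathbb{N}$ (positive integers); $E(D)$ is the set of oriented edges $(x,y)$. $V^{+}=\{x\mid w(x)>1\}$. The edge ideal is $I(D)=(x_ix_j^{w(x_j)}\mid (x_i,x_j)\in E(D))\subseteq K[x_1,\dots,x_n]$, $K$ a field; an ideal is unmixed if all its associated primes have the same height. $N_D^{+}(x)=\{y\mid (x,y)\in E(D)\}$, $N_D^{-}(x)=\{y\mid (y,x)\in E(D)\}$, $N_D(x)=N_D^+(x)\cup N_D^-(x)$; for a set $A$, $N_D(A),N_D^+(A)$ are unions over $a\in A$. A source is a vertex $x$ with $N_D^-(x)=\emptyset$. Standing convention: every source has weight $1$. $\tau(G)$ is the minimum size of a vertex cover of $G$. A $\tau$-reduction of $G$ is a collection of pairwise disjoint induced subgraphs $H_1,\dots,H_s$ of $G$ with $V(G)=\bigcup_i V(H_i)$ and $\tau(G)=\sum_i\tau(H_i)$. Perfect graph is in the usual sense ($\chi(H)=\omega(H)$ for every induced subgraph $H$). A weighted oriented subgraph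 of $D$ is an oriented subgraph of $(G,\mathcal{O})$ with weights restricted from $w$; $\deg_H(x)$ is the number of neighbours of $x$ in $H$. An oriented path is a sequence of distinct vertices $(y_1,\dots,y_m)$ with each $(y_i,y_{i+1})\in E(D)$; an oriented cycle closes such a path with $(y_m,y_1)\in E(D)$. A unicycle oriented subgraph is a weighted oriented subgraph $B$ with exactly one cycle $C$ such that (i) $C$ is an oriented cycle and every $y\in V(B)\setminus V(C)$ is reached by an oriented path in $B$ starting in $C$; (ii) $w(x)=1$, $x\in V(B)$ implies $\deg_B(x)=1$. A ROT with parent $v$ is an acyclic weighted oriented subgraph $T$ with $v\in V(T)$ such that (i) every $x\in V(T)\setminus\{v\}$ is reached by an oriented path in $T$ from $v$; (ii) if $x\in V(T)$, $w(x)=1$, then ($\deg_T(x)=1$ and $x\ne v$) or ($V(T)=\{v\}$ and $x=v$). A $\star$-semi-forest is a weighted oriented subgraph $H=(\bigcup_{i=1}^r T_i)\cup(\bigcup_{j=1}^s B_j)$, $T_i$ ROTs with parents $v_i$, $B_j$ unicycle oriented subgraphs, such that (i) their vertex sets partition $V(H)$; (ii) there is $W=\{w_1,\dots,w_r\}\subseteq V(D)\setminus V(H)$ with $w_i\in N_D(v_i)$ (repetitions allowed); (iii) there is a partition $W_1,W_2$ of $W$ with $W_1$ stable in $G$, $W_2\subseteq V^+$, $(w_i,v_i)\in E(D)$ whenever $w_i\in W_2$, and $N_D^+(W_2\cup\tilde H)\cap W_1=\emptyset$ where $\tilde H=\{x\in V(H)\mid\deg_H(x)\ge2\}\cup\{v_i\mid\deg_H(v_i)=1\}$.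 A generating $\star$-semi-forest of a weighted oriented subgraph $K$ is a $\star$-semi-forest $H$ of $D$ with $V(H)=V(K)$. *)

theory Defs
  imports
    "HOL-Algebra.Algebraic_Closure_Type"
    "HOL-Library.Poly_Mapping"
    "HOL-Library.Extended_Nat"
    "HOL-Library.Disjoint_Sets"
begin

section \<open>Simple graphs\<close>

record 'v sgraph =
  verts :: "'v set"
  edges :: "'v set set"

definition induced_subgraph :: "'v sgraph \<Rightarrow> 'v set \<Rightarrow> 'v sgraph" where
  "induced_subgraph G S = \<lparr>verts = S, edges = {e \<in> edges G. e \<subseteq> S}\<rparr>"

definition complete_graph :: "'v sgraph \<Rightarrow> bool" where
  "complete_graph G \<longleftrightarrow> (\<forall>x\<in>verts G. \<forall>y\<in>verts G. x \<noteq> y \<longrightarrow> {x, y} \<in> edges G)"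

definition stable_set :: "'v sgraph \<Rightarrow> 'v set \<Rightarrow> bool" where
  "stable_set G S \<longleftrightarrow> S \<subseteq> verts G \<and> (\<forall>x\<in>S. \<forall>y\<in>S. {x, y} \<notin> edges G)"

definition vertex_cover :: "'v sgraph \<Rightarrow> 'v set \<Rightarrow> bool" where
  "vertex_cover G C \<longleftrightarrow> C \<subseteq> verts G \<and> (\<forall>e\<in>edges G. e \<inter> C \<noteq> {})"

definition cover_number :: "'v sgraph \<Rightarrow> nat" where
  "cover_number G = Min {card C | C. vertex_cover G C}"

definition clique_number :: "'v sgraph \<Rightarrow> nat" where
  "clique_number G = Max {card S | S. S \<subseteq> verts G \<and> complete_graph (induced_subgraph G S)}"

definition proper_coloring :: "'v sgraph \<Rightarrow> nat \<Rightarrow> ('v \<Rightarrow> nat) \<Rightarrow> bool" where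
  "proper_coloring G k c \<longleftrightarrow> (\<forall>x\<in>verts G. c x < k) \<and>
     (\<forall>x\<in>verts G. \<forall>y\<in>verts G. {x, y} \<in> edges G \<longrightarrow> c x \<noteq> c y)"

definition chromatic_number :: "'v sgraph \<Rightarrow> nat" where
  "chromatic_number G = (LEAST k. \<exists>c. proper_coloring G k c)"

definition perfect_graph :: "'v sgraph \<Rightarrow> bool" where
  "perfect_graph G \<longleftrightarrow> (\<forall>S\<subseteq>verts G.
     chromatic_number (induced_subgraph G S) = clique_number (induced_subgraph G S))"

text \<open>The induced subgraphs of a \<open>\<tau>\<close>-reduction are given by their vertex sets, which are
  nonempty by \<^const>\<open>partition_on\<close>.\<close>

definition tau_reduction :: "'v sgraph \<Rightarrow> 'v set set \<Rightarrow> bool" where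
  "tau_reduction G \<H> \<longleftrightarrow> partition_on (verts G) \<H> \<and>
     cover_number G = (\<Sum>S\<in>\<H>. cover_number (induced_subgraph G S))"

definition cycle_graph :: "'v list \<Rightarrow> 'v sgraph" where
  "cycle_graph ys = \<lparr>verts = set ys,
     edges = {{ys ! i, ys ! (Suc i mod length ys)} | i. i < length ys}\<rparr>"

definition cycles :: "'v sgraph \<Rightarrow> 'v sgraph set" where
  "cycles G = {cycle_graph ys | ys. 3 \<le> length ys \<and> distinct ys \<and>
     verts (cycle_graph ys) \<subseteq> verts G \<and> edges (cycle_graph ys) \<subseteq> edges G}"

section \<open>Weighted oriented graphs\<close>

record 'v digraph =
  dverts :: "'v set"
  arcs :: "('v \<times> 'v) set"

record 'v wograph = "'v digraph" +
  weight :: "'v \<Rightarrow> nat"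

definition underlying_graph :: "('v, 'z) digraph_scheme \<Rightarrow> 'v sgraph" where
  "underlying_graph D = \<lparr>verts = dverts D, edges = {{x, y} | x y. (x, y) \<in> arcs D}\<rparr>"

text \<open>A pair \<open>(G, \<O>)\<close> of a simple graph and an orientation is encoded by the set of arcs: the
  absence of loops and of opposite arcs says exactly that the underlying graph is simple and
  each of its edges is oriented in one direction only. The vertices are all elements of a
  finite type, which also serves as the type of indeterminates of the polynomial ring.\<close>

definition weighted_oriented_graph :: "'v::finite wograph \<Rightarrow> bool" where
  "weighted_oriented_graph D \<longleftrightarrow> dverts D = UNIV \<and> asym (arcs D) \<and> (\<forall>x. 1 \<le> weight D x)"

definition Vplus :: "'v wograph \<Rightarrow> 'v set" where
  "Vplus D = {x \<in> dverts D. 1 < weight D x}"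

definition out_nbrs :: "('v, 'z) digraph_scheme \<Rightarrow> 'v \<Rightarrow> 'v set" where
  "out_nbrs D x = {y. (x, y) \<in> arcs D}"

definition in_nbrs :: "('v, 'z) digraph_scheme \<Rightarrow> 'v \<Rightarrow> 'v set" where
  "in_nbrs D x = {y. (y, x) \<in> arcs D}"

definition nbrs :: "('v, 'z) digraph_scheme \<Rightarrow> 'v \<Rightarrow> 'v set" where
  "nbrs D x = out_nbrs D x \<union> in_nbrs D x"

definition graph_deg :: "('v, 'z) digraph_scheme \<Rightarrow> 'v \<Rightarrow> nat" where
  "graph_deg D x = card (nbrs D x)"

definition source :: "('v, 'z) digraph_scheme \<Rightarrow> 'v \<Rightarrow> bool" where
  "source D x \<longleftrightarrow> x \<in> dverts D \<and> in_nbrs D x = {}"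

text \<open>Subgraphs carry no weight function of their own: weights are always those of the
  ambient graph.\<close>

definition oriented_subgraph :: "'v digraph \<Rightarrow> 'v wograph \<Rightarrow> bool" where
  "oriented_subgraph H D \<longleftrightarrow>
     dverts H \<subseteq> dverts D \<and> arcs H \<subseteq> arcs D \<and> arcs H \<subseteq> dverts H \<times> dverts H"

definition induced_oriented_subgraph :: "'v wograph \<Rightarrow> 'v set \<Rightarrow> 'v digraph" where
  "induced_oriented_subgraph D S = \<lparr>dverts = S, arcs = arcs D \<inter> S \<times> S\<rparr>"

definition oriented_path :: "'v digraph \<Rightarrow> 'v list \<Rightarrow> bool" where
  "oriented_path H ys \<longleftrightarrow> ys \<noteq> [] \<and> distinct ys \<and> set ys \<subseteq> dverts H \<and>
     successively (\<lambda>x y. (x, y) \<in> arcs H) ys"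

definition oriented_cycle :: "'v digraph \<Rightarrow> 'v list \<Rightarrow> bool" where
  "oriented_cycle H ys \<longleftrightarrow> oriented_path H ys \<and> (last ys, hd ys) \<in> arcs H"

section \<open>Semi-forests\<close>

definition unicycle_oriented_subgraph :: "'v wograph \<Rightarrow> 'v digraph \<Rightarrow> bool" where
  "unicycle_oriented_subgraph D B \<longleftrightarrow> oriented_subgraph B D \<and>
     (\<exists>C. cycles (underlying_graph B) = {C} \<and>
        (\<exists>ys. oriented_cycle B ys \<and> C = cycle_graph ys) \<and>
        (\<forall>y \<in> dverts B - verts C.
           \<exists>p. oriented_path B p \<and> hd p \<in> verts C \<and> last p = y)) \<and>
     (\<forall>x \<in> dverts B. weight D x = 1 \<longrightarrow> graph_deg B x = 1)"

definition ROT :: "'v wograph \<Rightarrow> 'v digraph \<Rightarrow> 'v \<Rightarrow> bool" where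
  "ROT D T v \<longleftrightarrow> oriented_subgraph T D \<and> cycles (underlying_graph T) = {} \<and> v \<in> dverts T \<and>
     (\<forall>x \<in> dverts T - {v}. \<exists>p. oriented_path T p \<and> hd p = v \<and> last p = x) \<and>
     (\<forall>x \<in> dverts T. weight D x = 1 \<longrightarrow>
        (graph_deg T x = 1 \<and> x \<noteq> v) \<or> (dverts T = {v} \<and> x = v))"

text \<open>In the following definition \<open>r\<close>, \<open>s\<close>, \<open>W\<^sub>1\<close> and \<open>W\<^sub>2\<close> may be \<open>0\<close> resp. empty.\<close>

definition star_semi_forest :: "'v wograph \<Rightarrow> 'v digraph \<Rightarrow> bool" where
  "star_semi_forest D H \<longleftrightarrow> oriented_subgraph H D \<and>
    (\<exists>(r::nat) (s::nat) T v B w W\<^sub>1 W\<^sub>2.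
      (\<forall>i<r. ROT D (T i) (v i)) \<and>
      (\<forall>j<s. unicycle_oriented_subgraph D (B j)) \<and>
      dverts H = (\<Union>i<r. dverts (T i)) \<union> (\<Union>j<s. dverts (B j)) \<and>
      arcs H = (\<Union>i<r. arcs (T i)) \<union> (\<Union>j<s. arcs (B j)) \<and>
      disjoint_family_on (\<lambda>i. dverts (T i)) {..<r} \<and>
      disjoint_family_on (\<lambda>j. dverts (B j)) {..<s} \<and>
      (\<forall>i<r. \<forall>j<s. dverts (T i) \<inter> dverts (B j) = {}) \<and>
      (\<forall>i<r. w i \<in> dverts D - dverts H \<and> w i \<in> nbrs D (v i)) \<and>
      W\<^sub>1 \<union> W\<^sub>2 = w ` {..<r} \<and> W\<^sub>1 \<inter> W\<^sub>2 = {} \<and>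
      stable_set (underlying_graph D) W\<^sub>1 \<and>
      W\<^sub>2 \<subseteq> Vplus D \<and>
      (\<forall>i<r. w i \<in> W\<^sub>2 \<longrightarrow> (w i, v i) \<in> arcs D) \<and>
      (let H' = {x \<in> dverts H. 2 \<le> graph_deg H x} \<union> {v i | i. i < r \<and> graph_deg H (v i) = 1}
       in (\<Union>x \<in> W\<^sub>2 \<union> H'. out_nbrs D x) \<inter> W\<^sub>1 = {}))"

definition generating_star_semi_forest ::
    "'v wograph \<Rightarrow> 'v digraph \<Rightarrow> 'v digraph \<Rightarrow> bool" where
  "generating_star_semi_forest D K H \<longleftrightarrow> star_semi_forest D H \<and> dverts H = dverts K"

section \<open>Unmixed ideals and the edge ideal\<close>

definition associated_primes :: "('a, 'b) ring_scheme \<Rightarrow> 'a set \<Rightarrow> 'a set set" where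
  "associated_primes R I =
     {P. primeideal P R \<and> (\<exists>f \<in> carrier R. P = {g \<in> carrier R. g \<otimes>\<^bsub>R\<^esub> f \<in> I})}"

definition prime_height :: "('a, 'b) ring_scheme \<Rightarrow> 'a set \<Rightarrow> enat" where
  "prime_height R P = Sup {enat n | n. \<exists>Q :: nat \<Rightarrow> 'a set.
     (\<forall>i\<le>n. primeideal (Q i) R) \<and> (\<forall>i<n. Q i \<subset> Q (Suc i)) \<and> Q n = P}"

definition unmixed :: "('a, 'b) ring_scheme \<Rightarrow> 'a set \<Rightarrow> bool" where
  "unmixed R I \<longleftrightarrow> (\<forall>P \<in> associated_primes R I. \<forall>Q \<in> associated_primes R I.
     prime_height R P = prime_height R Q)"

type_synonym ('v, 'k) mpoly = "('v \<Rightarrow>\<^sub>0 nat) \<Rightarrow>\<^sub>0 'k"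

definition mpoly_ring :: "('v, 'k::field) mpoly ring" where
  "mpoly_ring = ring_of_type_algebra"

definition mvar :: "'v \<Rightarrow> ('v, 'k::field) mpoly" where
  "mvar x = Poly_Mapping.single (Poly_Mapping.single x 1) 1"

definition edge_ideal :: "'v wograph \<Rightarrow> ('v, 'k::field) mpoly set" where
  "edge_ideal D = Idl\<^bsub>mpoly_ring\<^esub> {mvar x * mvar y ^ weight D y | x y. (x, y) \<in> arcs D}"

end

theory Submission
  imports Defs "HOL-Library.Cardinality"
begin

text \<open>
  The associated primes of \<open>I(D)\<close> are the ideals generated by the strong vertex covers, and the
  height of such a prime is the size of the cover, so \<open>I(D)\<close> is unmixed iff all strong vertex
  covers have size \<open>\<tau>(G)\<close> (minimum covers are strong). A vertex cover misses at most one vertex of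
  each clique, so in a \<open>\<tau>\<close>-reduction into cliques a cover has more than \<open>\<tau>(G)\<close> elements iff it
  contains one of the cliques. Finally, a vertex set \<open>S\<close> lies in a strong vertex cover iff it carries
  a \<open>\<star>\<close>-semi-forest: choosing for each vertex of \<open>S\<close> an in-neighbour that witnesses strength gives
  a functional graph on \<open>S\<close>, whose components are the ROTs and the unicycle graphs. The
  \<open>\<tau>\<close>-reduction itself exists by Lovasz's theorem that the complement of a perfect graph is perfect.
\<close>


section \<open>Clique partitions of perfect graphs\<close>

text \<open>\<open>prime_height\<close> ranges over chains of arbitrary primes, so the algebra
  cannot stay within monomial ideals. Two elementary devices carry it: an additive weight that
  separates finitely many monomials supplies leading terms, and a count of products of bounded
  powers bounds the length of prime chains. On the graph side, Lovasz's theorem is used in a form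
  that produces a clique partition together with a stable set of the same size, because the
  complement of that set is a cover attaining the bound forced by the cliques. In
  \<open>strong_vertex_cover\<close>, the condition \<open>out_nbrs D y \<subseteq> C\<close> keeps
  \<open>y\<close> out of \<open>L\<^sub>1\<close>, hence in
  \<open>L\<^sub>2 \<union> L\<^sub>3\<close>. In both directions of the correspondence with
  semi-forests, \<open>W\<^sub>1\<close> lies outside the cover, so this condition on witnesses is
  what becomes the requirement that their out-neighbours avoid \<open>W\<^sub>1\<close>.\<close>

definition clique :: "'v sgraph \<Rightarrow> 'v set \<Rightarrow> bool" where
  "clique G K \<longleftrightarrow> K \<subseteq> verts G \<and> (\<forall>x\<in>K. \<forall>y\<in>K. x \<noteq> y \<longrightarrow> {x, y} \<in> edges G)"

lemma verts_induced_subgraph [simp]: "verts (induced_subgraph G S) = S"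
  by (simp add: induced_subgraph_def)

lemma complete_induced_subgraph_iff_clique:
  "S \<subseteq> verts G \<Longrightarrow> complete_graph (induced_subgraph G S) \<longleftrightarrow> clique G S"
  by (auto simp: complete_graph_def induced_subgraph_def clique_def)

lemma clique_subset: "clique G K \<Longrightarrow> L \<subseteq> K \<Longrightarrow> clique G L"
  by (auto simp: clique_def)

lemma finite_clique: "finite (verts G) \<Longrightarrow> clique G K \<Longrightarrow> finite K"
  using finite_subset unfolding clique_def by blast

lemma sum_card_swap:
  assumes "finite A" "finite B"
  shows "(\<Sum>a\<in>A. card {b \<in> B. R a b}) = (\<Sum>b\<in>B. card {a \<in> A. R a b})"
  using assms sum.swap[of "\<lambda>a b. if R a b then 1 else 0 :: nat" B A]
  by (simp add: card_eq_sum sum.inter_filter del: sum_constant One_nat_def)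

lemma card_clique_inter_stable_le_1:
  assumes "clique G K" "stable_set G S"
  shows "card (S \<inter> K) \<le> 1"
proof (cases "finite (S \<inter> K)")
  case True
  then show ?thesis
    using assms unfolding One_nat_def card_le_Suc0_iff_eq[OF True] clique_def stable_set_def by blast
qed simp

text \<open>The stable sets are the colour classes of an optimal colouring of the subgraph on
  \<open>U\<close>, whose number of colours is its clique number by perfection. If fewer than
  \<open>m\<close> colours occur, the remaining sets are empty.\<close>

lemma perfect_graph_stable_cover:
  assumes fin: "finite (verts G)" and loopless: "\<And>x. {x} \<notin> edges G" and "perfect_graph G"
    and U: "U \<subseteq> verts G" and m: "\<And>K. clique G K \<Longrightarrow> K \<subseteq> U \<Longrightarrow> card K \<le> m"
  shows "\<exists>S. (\<forall>i<m. stable_set G (S i)) \<and> (\<forall>v\<in>U. \<exists>i<m. v \<in> S i)"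
proof -
  let ?H = "induced_subgraph G U"
  have finX: "finite U" using fin U finite_subset by blast
  obtain h :: "_ \<Rightarrow> nat" where h: "bij_betw h U {..<card U}"
    using ex_bij_betw_finite_nat[OF finX] by (auto simp: atLeast0LessThan)
  \<comment> \<open>Some colouring must exist before the \<open>LEAST\<close> in
    \<open>chromatic_number\<close> can be used; numbering the vertices gives one.\<close>
  have "proper_coloring ?H (card U) h"
    unfolding proper_coloring_def verts_induced_subgraph
  proof (intro conjI ballI impI)
    fix x y assume xy: "x \<in> U" "y \<in> U" "{x, y} \<in> edges ?H"
    then have "x \<noteq> y" using loopless[of x] by (auto simp: induced_subgraph_def)
    then show "h x \<noteq> h y" using h xy by (auto simp: bij_betw_def inj_on_def)
  qed (use bij_betwE[OF h] in simp)
  then have "\<exists>c. proper_coloring ?H (chromatic_number ?H) c"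
    using LeastI[of "\<lambda>k. \<exists>c. proper_coloring ?H k c"] unfolding chromatic_number_def by blast
  then obtain c where c: "proper_coloring ?H (clique_number ?H) c"
    using \<open>perfect_graph G\<close> U by (auto simp: perfect_graph_def)
  have cl: "complete_graph (induced_subgraph ?H S) \<longleftrightarrow> clique G S" if "S \<subseteq> U" for S
    using that U by (auto simp: complete_graph_def induced_subgraph_def clique_def)
  have "clique_number ?H \<le> m"
    unfolding clique_number_def
  proof (rule Max.boundedI)
    show "finite {card S |S. S \<subseteq> verts ?H \<and> complete_graph (induced_subgraph ?H S)}"
      using finX by (auto intro!: finite_subset[of _ "card ` Pow U"])
    have "complete_graph (induced_subgraph ?H {})"
      by (simp add: complete_graph_def)
    then show "{card S |S. S \<subseteq> verts ?H \<and> complete_graph (induced_subgraph ?H S)} \<noteq> {}"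
      by blast
  qed (use cl m in auto)
  moreover have "stable_set G {v \<in> U. c v = i}" for i
    using U c by (auto simp: stable_set_def proper_coloring_def induced_subgraph_def) metis
  moreover have "c v < clique_number ?H" if "v \<in> U" for v
    using c that by (simp add: proper_coloring_def)
  ultimately show ?thesis
    by (intro exI[of _ "\<lambda>i. {v \<in> U. c v = i}"]) fastforce
qed

text \<open>The replication lemma in weighted form: instead of duplicating vertices, one covers each
  vertex \<open>v\<close> by \<open>f v\<close> of the stable sets. If \<open>f v \<ge> 2\<close>, a stable set containing \<open>v\<close> in a
  cover for \<open>f\<close> lowered by one at \<open>v\<close> meets every clique of full weight.\<close>

lemma perfect_graph_weighted_stable_cover:
  assumes fin: "finite (verts G)" and loopless: "\<And>x. {x} \<notin> edges G" and perf: "perfect_graph G"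
    and "\<And>K. clique G K \<Longrightarrow> sum f K \<le> m"
  shows "\<exists>S. (\<forall>i<m. stable_set G (S i)) \<and> (\<forall>v\<in>verts G. f v \<le> card {i. i < m \<and> v \<in> S i})"
  using assms(4)
proof (induction "sum f (verts G)" arbitrary: f m rule: less_induct)
  case less
  show ?case
  proof (cases "\<forall>v\<in>verts G. f v \<le> 1")
    case True
    define U where "U = {v \<in> verts G. f v = 1}"
    have "card K \<le> m" if "clique G K" "K \<subseteq> U" for K
    proof -
      have "sum f K = (\<Sum>v\<in>K. 1)"
        using that by (intro sum.cong) (auto simp: U_def)
      then show ?thesis using less.prems[OF that(1)] by simp
    qed
    then obtain S where S: "\<forall>i<m. stable_set G (S i)" "\<forall>v\<in>U. \<exists>i<m. v \<in> S i"
      using perfect_graph_stable_cover[OF fin loopless perf, of U m] by (auto simp: U_def)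
    have "f v \<le> card {i. i < m \<and> v \<in> S i}" if v: "v \<in> verts G" for v
    proof (cases "v \<in> U")
      case True
      then obtain i where "i < m" "v \<in> S i" using S by blast
      then have "{i} \<subseteq> {i. i < m \<and> v \<in> S i}" by auto
      then have "card {i} \<le> card {i. i < m \<and> v \<in> S i}" by (intro card_mono) auto
      with True show ?thesis by (simp add: U_def)
    next
      case False
      then have "f v = 0" using v \<open>\<forall>v\<in>verts G. f v \<le> 1\<close> by (force simp: U_def)
      then show ?thesis by simp
    qed
    with S show ?thesis by blast
  next
    case False
    then obtain v where v: "v \<in> verts G" "2 \<le> f v" by fastforce
    define f' where "f' = f(v := f v - 1)"
    have f'le: "f' u \<le> f u" for u by (simp add: f'_def)
    have "sum f' (verts G) < sum f (verts G)"
      using v f'le by (intro sum_strict_mono_ex1 fin) (auto simp: f'_def intro!: bexI[of _ v])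
    moreover have "sum f' K \<le> m" if "clique G K" for K
      using less.prems[OF that] sum_mono[of K f' f, OF f'le] by linarith
    ultimately obtain S where S: "\<forall>i<m. stable_set G (S i)"
      and cov: "\<forall>u\<in>verts G. f' u \<le> card {i. i < m \<and> u \<in> S i}"
      using less.hyps[of f' m] by blast
    have "card {i. i < m \<and> v \<in> S i} \<noteq> 0"
      using cov v by (fastforce simp: f'_def)
    then obtain j where j: "j < m" "v \<in> S j"
      by (metis (mono_tags, lifting) card.empty empty_Collect_eq)
    \<comment> \<open>Subtraction is truncated, so a vertex of weight 0 in \<open>S j\<close> keeps
      its weight. Hence \<open>L\<close> below retains only vertices of positive weight, where equal
      sums of \<open>f\<close> and \<open>g\<close> exclude \<open>S j\<close>.\<close>
    define g where "g u = f u - (if u \<in> S j then 1 else 0)" for u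
    have gle: "g u \<le> f u" for u by (simp add: g_def)
    have "sum g (verts G) < sum f (verts G)"
      using v j gle by (intro sum_strict_mono_ex1 fin) (auto simp: g_def intro!: bexI[of _ v])
    moreover have "sum g K \<le> m - 1" if K: "clique G K" for K
    proof (rule ccontr)
      assume "\<not> ?thesis"
      then have gK: "m \<le> sum g K" by simp
      define L where "L = {u \<in> K. 0 < f u}"
      have finK: "finite K" using finite_clique[OF fin K] .
      have L: "clique G L" "finite L" using K finK by (auto simp: L_def intro: clique_subset)
      have "sum g K = sum g L"
        using finK by (intro sum.mono_neutral_right) (auto simp: L_def g_def)
      then have gL: "m \<le> sum g L" using gK by simp
      have "sum f L \<le> m" using less.prems[OF L(1)] .
      then have gfL: "sum g L = sum f L" using gL sum_mono[of L g f, OF gle] by linarith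
      have disj: "S j \<inter> L = {}"
      proof (rule ccontr)
        assume "S j \<inter> L \<noteq> {}"
        then obtain u where "u \<in> S j" "u \<in> L" by blast
        then have "\<exists>a\<in>L. g a < f a" by (auto simp: g_def L_def intro!: bexI[of _ u])
        then have "sum g L < sum f L" using gle L by (intro sum_strict_mono_ex1) auto
        with gfL show False by simp
      qed
      \<comment> \<open>As \<open>v\<close> lies in \<open>S j\<close>, it is not in
        \<open>L\<close>, so lowering \<open>f\<close> at \<open>v\<close> changes nothing on
        \<open>L\<close>. But \<open>m\<close> stable sets, one of which misses \<open>L\<close>,
        carry weight at most \<open>m - 1\<close> there.\<close>
      then have "sum f' L = sum f L" using j by (intro sum.cong) (auto simp: f'_def)
      then have "m \<le> sum f' L" using gL gfL by simp
      also have "\<dots> \<le> (\<Sum>u\<in>L. card {i \<in> {..<m}. u \<in> S i})"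
        using cov L by (intro sum_mono) (auto simp: clique_def)
      also have "\<dots> = (\<Sum>i<m. card (S i \<inter> L))"
        using L(2) by (subst sum_card_swap) (auto simp: Int_def conj_commute)
      also have "\<dots> \<le> (\<Sum>i<m. if i = j then 0 else 1)"
      proof (rule sum_mono)
        fix i assume "i \<in> {..<m}"
        then show "card (S i \<inter> L) \<le> (if i = j then 0 else 1)"
          using S disj card_clique_inter_stable_le_1[OF L(1), of "S i"] by simp
      qed
      also have "\<dots> = m - 1"
        using j by (simp add: sum.remove[of "{..<m}" j])
      also have "\<dots> < m" using j by simp
      finally show False by simp
    qed
    ultimately obtain S' where S': "\<forall>i<m-1. stable_set G (S' i)"
      and cov': "\<forall>u\<in>verts G. g u \<le> card {i. i < m - 1 \<and> u \<in> S' i}"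
      using less.hyps[of g "m - 1"] by blast
    define S'' where "S'' = S'(m - 1 := S j)"
    have "stable_set G (S'' i)" if "i < m" for i
      using S S' that j by (auto simp: S''_def)
    moreover have "f u \<le> card {i. i < m \<and> u \<in> S'' i}" if u: "u \<in> verts G" for u
    proof -
      have "{i. i < m \<and> u \<in> S'' i} =
          {i. i < m - 1 \<and> u \<in> S' i} \<union> (if u \<in> S j then {m - 1} else {})"
        using j by (auto simp: S''_def)
      then have "card {i. i < m \<and> u \<in> S'' i} =
          card {i. i < m - 1 \<and> u \<in> S' i} + (if u \<in> S j then 1 else 0)"
        by simp
      moreover have "g u \<le> card {i. i < m - 1 \<and> u \<in> S' i}" using cov' u by blast
      ultimately show ?thesis by (simp add: g_def split: if_splits)
    qed
    ultimately show ?thesis by blast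
  qed
qed

text \<open>Lovasz's counting argument. If every clique \<open>K\<close> in \<open>U\<close> were
  missed by a maximum stable set \<open>A K\<close>, weight each vertex by the number of sets
  \<open>A K\<close> containing it. Every clique then has weight at most
  \<open>card \<K> - 1\<close>, so that many stable sets carry the weight; but the total weight on
  \<open>U\<close> is \<open>card \<K>\<close> times the stability number.\<close>

lemma perfect_graph_clique_meeting_maximum_stable_sets:
  assumes fin: "finite (verts G)" and loopless: "\<And>x. {x} \<notin> edges G" and perf: "perfect_graph G"
    and U: "U \<subseteq> verts G" "U \<noteq> {}"
  shows "\<exists>K\<subseteq>U. clique G K \<and> (\<forall>A. stable_set G A \<and> A \<subseteq> U \<and>
    (\<forall>B. stable_set G B \<and> B \<subseteq> U \<longrightarrow> card B \<le> card A) \<longrightarrow> A \<inter> K \<noteq> {})"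
proof (rule ccontr)
  assume neg: "\<not> ?thesis"
  define \<K> where "\<K> = {K. clique G K \<and> K \<subseteq> U}"
  have finU: "finite U" using fin U finite_subset by blast
  have fin\<K>: "finite \<K>" using finU by (simp add: \<K>_def)
  have "\<exists>A. stable_set G A \<and> A \<subseteq> U \<and>
    (\<forall>B. stable_set G B \<and> B \<subseteq> U \<longrightarrow> card B \<le> card A) \<and> A \<inter> K = {}" if "K \<in> \<K>" for K
    using neg that by (auto simp: \<K>_def)
  then obtain A where A: "\<And>K. K \<in> \<K> \<Longrightarrow> stable_set G (A K)" "\<And>K. K \<in> \<K> \<Longrightarrow> A K \<subseteq> U"
    and Amax: "\<And>K B. K \<in> \<K> \<Longrightarrow> stable_set G B \<Longrightarrow> B \<subseteq> U \<Longrightarrow> card B \<le> card (A K)"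
    and disj: "\<And>K. K \<in> \<K> \<Longrightarrow> A K \<inter> K = {}"
    by metis
  define \<alpha> where "\<alpha> = card (A {})"
  \<comment> \<open>The empty clique makes the family nonempty and supplies the set
    \<open>A {}\<close> whose size is \<alpha>.\<close>
  have empty: "{} \<in> \<K>" by (simp add: \<K>_def clique_def)
  have cardA: "card (A K) = \<alpha>" if "K \<in> \<K>" for K
    using Amax A that empty by (simp add: \<alpha>_def le_antisym)
  have "0 < \<alpha>"
  proof -
    obtain u where "u \<in> U" using U by blast
    then have "stable_set G {u}" using loopless U by (auto simp: stable_set_def)
    from Amax[OF empty this] \<open>u \<in> U\<close> show ?thesis by (simp add: \<alpha>_def)
  qed
  define f where "f v = card {K \<in> \<K>. v \<in> A K}" for v
  have sumf: "sum f U = (\<Sum>K\<in>\<K>. card (A K \<inter> U))" if "finite U" for U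
  proof -
    have "sum f U = (\<Sum>K\<in>\<K>. card {v \<in> U. v \<in> A K})"
      unfolding f_def by (rule sum_card_swap[OF that fin\<K>])
    also have "\<dots> = (\<Sum>K\<in>\<K>. card (A K \<inter> U))"
      by (simp add: Int_def conj_commute)
    finally show ?thesis .
  qed
  define m where "m = card \<K> - 1"
  have "sum f K \<le> m" if K: "clique G K" for K
  proof -
    have finK: "finite K" using finite_clique[OF fin K] .
    \<comment> \<open>\<open>K\<close> need not lie in \<open>U\<close>, but the sets
      \<open>A L\<close> can meet only its part in \<open>U\<close>, and the set chosen for that
      part misses \<open>K\<close>.\<close>
    have KU: "K \<inter> U \<in> \<K>" using K by (auto simp: \<K>_def intro: clique_subset)
    have "sum f K = (\<Sum>L\<in>\<K>. card (A L \<inter> K))" by (rule sumf[OF finK])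
    also have "\<dots> \<le> (\<Sum>L\<in>\<K>. if L = K \<inter> U then 0 else 1)"
    proof (rule sum_mono)
      fix L assume "L \<in> \<K>"
      moreover have "A (K \<inter> U) \<inter> K = {}" using disj[OF KU] A(2)[OF KU] by blast
      ultimately show "card (A L \<inter> K) \<le> (if L = K \<inter> U then 0 else 1)"
        using card_clique_inter_stable_le_1[OF K A(1)] by simp
    qed
    also have "\<dots> = m"
      using KU fin\<K> by (simp add: m_def sum.remove[of \<K> "K \<inter> U"])
    finally show ?thesis .
  qed
  then obtain S where S: "\<forall>i<m. stable_set G (S i)"
    and cov: "\<forall>v\<in>verts G. f v \<le> card {i. i < m \<and> v \<in> S i}"
    using perfect_graph_weighted_stable_cover[OF fin loopless perf, of f m] by blast
  have "card \<K> * \<alpha> = (\<Sum>K\<in>\<K>. card (A K \<inter> U))"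
    using cardA A(2) by (simp add: Int_absorb2)
  also have "\<dots> = sum f U" using sumf[OF finU] by simp
  also have "\<dots> \<le> (\<Sum>v\<in>U. card {i \<in> {..<m}. v \<in> S i})"
    using cov U by (intro sum_mono) auto
  also have "\<dots> = (\<Sum>i<m. card (S i \<inter> U))"
    using finU by (subst sum_card_swap) (auto simp: Int_def conj_commute)
  also have "\<dots> \<le> (\<Sum>i<m. \<alpha>)"
  proof (rule sum_mono)
    fix i assume "i \<in> {..<m}"
    then have "stable_set G (S i \<inter> U)" using S by (auto simp: stable_set_def)
    then show "card (S i \<inter> U) \<le> \<alpha>" using Amax[OF empty] by (simp add: \<alpha>_def)
  qed
  also have "\<dots> = m * \<alpha>" by simp
  finally have "card \<K> \<le> m" using \<open>0 < \<alpha>\<close> by simp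
  moreover have "0 < card \<K>" using empty fin\<K> card_gt_0_iff by blast
  ultimately show False by (simp add: m_def)
qed

text \<open>The stable set travels with the partition through the induction: removing a clique that
  meets all maximum stable sets lowers the stability number, which leaves room for one more stable
  vertex to match the added clique.\<close>

theorem perfect_graph_clique_partition:
  assumes fin: "finite (verts G)" and loopless: "\<And>x. {x} \<notin> edges G" and perf: "perfect_graph G"
    and "U \<subseteq> verts G"
  shows "\<exists>P A. partition_on U P \<and> (\<forall>K\<in>P. clique G K) \<and> stable_set G A \<and> A \<subseteq> U \<and> card A = card P"
  using assms(4)
proof (induction "card U" arbitrary: U rule: less_induct)
  case less
  have finU: "finite U" using fin less.prems finite_subset by blast
  show ?case
  proof (cases "U = {}")
    case True
    then show ?thesis
      by (intro exI[of _ "{}"]) (auto simp: partition_on_def stable_set_def)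
  next
    case False
    from perfect_graph_clique_meeting_maximum_stable_sets[OF fin loopless perf less.prems False]
    obtain K where K: "K \<subseteq> U" "clique G K"
      and meet: "\<forall>A. stable_set G A \<and> A \<subseteq> U \<and>
        (\<forall>B. stable_set G B \<and> B \<subseteq> U \<longrightarrow> card B \<le> card A) \<longrightarrow> A \<inter> K \<noteq> {}"
      by (elim exE conjE) (rule that)
    have "\<exists>A. (stable_set G A \<and> A \<subseteq> U) \<and> (\<forall>B. stable_set G B \<and> B \<subseteq> U \<longrightarrow> card B \<le> card A)"
    proof (rule ex_has_greatest_nat[of "\<lambda>B. stable_set G B \<and> B \<subseteq> U" "{}" card "Suc (card U)"])
      show "stable_set G {} \<and> {} \<subseteq> U" by (simp add: stable_set_def)
      show "\<forall>B. stable_set G B \<and> B \<subseteq> U \<longrightarrow> card B < Suc (card U)"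
        using card_mono[OF finU] by (simp add: less_Suc_eq_le)
    qed
    then obtain A where A: "stable_set G A" "A \<subseteq> U"
      and Amax: "\<forall>B. stable_set G B \<and> B \<subseteq> U \<longrightarrow> card B \<le> card A" by blast
    have "K \<noteq> {}" using meet A Amax by blast
    then have "card (U - K) < card U"
      using K finU by (intro psubset_card_mono) auto
    then obtain P A' where P: "partition_on (U - K) P" "\<forall>K\<in>P. clique G K"
      and A': "stable_set G A'" "A' \<subseteq> U - K" "card A' = card P"
      using less.hyps[of "U - K"] less.prems by (metis Diff_subset subset_trans)
    \<comment> \<open>A stable set disjoint from \<open>K\<close> cannot be maximum, so
      \<open>A\<close> is larger than \<open>A'\<close> and can be cut down to
      \<open>Suc (card A')\<close> vertices.\<close>
    have "card A' \<noteq> card A"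
    proof
      assume "card A' = card A"
      then have "A' \<inter> K \<noteq> {}" using A' Amax meet[rule_format, of A'] by auto
      with A'(2) show False by blast
    qed
    then have "card A' < card A" using Amax A' by (meson Diff_subset nat_less_le subset_trans)
    then obtain A'' where A'': "A'' \<subseteq> A" "card A'' = Suc (card A')"
      using obtain_subset_with_card_n[of "Suc (card A')" A] by (metis Suc_leI)
    have finP: "finite P" by (rule finite_elements[OF finite_Diff[OF finU] P(1)])
    have "K \<notin> P" using P(1) \<open>K \<noteq> {}\<close> by (auto simp: partition_on_def)
    then have "card (insert K P) = card A''" using A'' A' finP by simp
    moreover have "partition_on U (insert K P)"
      using P(1) K \<open>K \<noteq> {}\<close> by (auto simp: partition_on_def disjoint_def)
    moreover have "stable_set G A''" using A(1) A''(1) unfolding stable_set_def by blast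
    moreover have "\<forall>L\<in>insert K P. clique G L" "A'' \<subseteq> U" using P K A A'' by auto
    ultimately show ?thesis by (intro exI[of _ "insert K P"] exI[of _ A''] conjI) simp_all
  qed
qed

section \<open>Vertex covers and cover numbers of clique partitions\<close>

lemma finite_vertex_cover_sizes:
  assumes "finite (verts G)"
  shows "finite {card C | C. vertex_cover G C}"
proof (rule finite_subset)
  show "{card C | C. vertex_cover G C} \<subseteq> card ` Pow (verts G)" by (auto simp: vertex_cover_def)
  show "finite (card ` Pow (verts G))" using assms by simp
qed

lemma cover_number_le: "finite (verts G) \<Longrightarrow> vertex_cover G C \<Longrightarrow> cover_number G \<le> card C"
  unfolding cover_number_def by (rule Min_le[OF finite_vertex_cover_sizes]) auto

lemma minimum_vertex_cover_exists:
  assumes fin: "finite (verts G)" and sub: "\<forall>e\<in>edges G. e \<subseteq> verts G \<and> e \<noteq> {}"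
  shows "\<exists>C. vertex_cover G C \<and> card C = cover_number G"
proof -
  let ?A = "{card C |C. vertex_cover G C}"
  have "finite ?A" by (rule finite_vertex_cover_sizes[OF fin])
  moreover have "vertex_cover G (verts G)" using sub by (auto simp: vertex_cover_def)
  then have "?A \<noteq> {}" by blast
  ultimately have "Min ?A \<in> ?A" by (rule Min_in)
  then show ?thesis by (auto simp: cover_number_def)
qed

lemma card_clique_minus_1_le_card_cover_inter:
  assumes fin: "finite (verts G)" and "clique G S" "vertex_cover G C"
  shows "card S - 1 \<le> card (C \<inter> S)"
proof -
  have finS: "finite S" using finite_clique[OF fin assms(2)] .
  have "card (S - C) \<le> 1"
    unfolding One_nat_def card_le_Suc0_iff_eq[OF finite_Diff[OF finS]]
  proof (intro ballI, rule ccontr)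
    fix x y assume xy: "x \<in> S - C" "y \<in> S - C" "x \<noteq> y"
    then have "{x, y} \<in> edges G" using assms(2) by (auto simp: clique_def)
    then have "{x, y} \<inter> C \<noteq> {}" using assms(3) by (auto simp: vertex_cover_def)
    with xy show False by auto
  qed
  moreover have "card S = card (S - C) + card (C \<inter> S)"
    using card_Int_Diff[OF finS, of C] by (simp add: Int_commute)
  ultimately show ?thesis by linarith
qed

lemma cover_number_clique:
  assumes fin: "finite (verts G)" and loopless: "\<And>e x. e \<in> edges G \<Longrightarrow> e \<noteq> {} \<and> e \<noteq> {x}"
    and S: "clique G S" "S \<noteq> {}"
  shows "cover_number (induced_subgraph G S) = card S - 1"
proof -
  let ?H = "induced_subgraph G S"
  have finS: "finite S" using finite_clique[OF fin S(1)] .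
  have cl: "clique ?H S" using S by (auto simp: clique_def induced_subgraph_def)
  obtain x where x: "x \<in> S" using S by blast
  have "vertex_cover ?H (S - {x})"
    using loopless x by (fastforce simp: vertex_cover_def induced_subgraph_def)
  then have "cover_number ?H \<le> card S - 1"
    using cover_number_le[of ?H "S - {x}"] finS x by simp
  moreover obtain C where C: "vertex_cover ?H C" "card C = cover_number ?H"
    using minimum_vertex_cover_exists[of ?H] finS loopless by (auto simp: induced_subgraph_def)
  have "card S - 1 \<le> card (C \<inter> S)"
    using card_clique_minus_1_le_card_cover_inter[OF _ cl C(1)] finS by simp
  then have "card S - 1 \<le> cover_number ?H"
    using C by (simp add: vertex_cover_def Int_absorb2)
  ultimately show ?thesis by simp
qed

lemma card_partition_inter:
  assumes "partition_on V P" "finite V" "C \<subseteq> V"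
  shows "card C = (\<Sum>S\<in>P. card (C \<inter> S))"
proof -
  have fin: "finite P" by (rule finite_elements[OF assms(2,1)])
  have "C = (\<Union>S\<in>P. C \<inter> S)" using assms by (auto simp: partition_on_def)
  then have "card C = card (\<Union>S\<in>P. C \<inter> S)" by simp
  also have "\<dots> = (\<Sum>S\<in>P. card (C \<inter> S))"
  proof (rule card_UN_disjoint[OF fin])
    show "\<forall>S\<in>P. finite (C \<inter> S)" using finite_subset[OF assms(3,2)] by simp
    show "\<forall>S\<in>P. \<forall>T\<in>P. S \<noteq> T \<longrightarrow> (C \<inter> S) \<inter> (C \<inter> T) = {}"
      using assms(1) unfolding partition_on_def disjoint_def by blast
  qed
  finally show ?thesis .
qed

text \<open>The cliques force \<open>card S - 1\<close> vertices of each part \<open>S\<close> into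
  any cover, and the complement of the stable set \<open>A\<close>, which has as many vertices as
  there are cliques, needs no more.\<close>

theorem perfect_graph_tau_reduction:
  assumes fin: "finite (verts G)" and edges: "\<And>e x. e \<in> edges G \<Longrightarrow> e \<noteq> {} \<and> e \<noteq> {x}"
    and sub: "\<And>e. e \<in> edges G \<Longrightarrow> e \<subseteq> verts G"
    and edges2: "\<And>e. e \<in> edges G \<Longrightarrow> \<exists>x y. e = {x, y}"
    and perf: "perfect_graph G"
  shows "\<exists>\<H>. tau_reduction G \<H> \<and> (\<forall>S\<in>\<H>. complete_graph (induced_subgraph G S))"
proof -
  have "{x} \<notin> edges G" for x using edges by blast
  then obtain P A where P: "partition_on (verts G) P" "\<forall>K\<in>P. clique G K"
    and A: "stable_set G A" "A \<subseteq> verts G" "card A = card P"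
    using perfect_graph_clique_partition[OF fin _ perf, of "verts G"] by blast
  have ne: "K \<noteq> {}" if "K \<in> P" for K using P that by (auto simp: partition_on_def)
  have finK: "finite K" if "K \<in> P" for K using P that finite_clique[OF fin] by blast
  have eq: "(\<Sum>S\<in>P. cover_number (induced_subgraph G S)) = (\<Sum>S\<in>P. card S - 1)"
    using cover_number_clique[OF fin edges] P ne by (intro sum.cong) auto
  obtain C where C: "vertex_cover G C" "card C = cover_number G"
    using minimum_vertex_cover_exists[OF fin] sub edges by blast
  have "(\<Sum>S\<in>P. card S - 1) \<le> (\<Sum>S\<in>P. card (C \<inter> S))"
    using card_clique_minus_1_le_card_cover_inter[OF fin _ C(1)] P by (intro sum_mono) auto
  also have "\<dots> = cover_number G"
    using card_partition_inter[OF P(1) fin, of C] C by (simp add: vertex_cover_def)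
  finally have "(\<Sum>S\<in>P. card S - 1) \<le> cover_number G" .
  moreover have "vertex_cover G (verts G - A)"
    unfolding vertex_cover_def
  proof (intro conjI ballI)
    fix e assume e: "e \<in> edges G"
    then obtain x y where "e = {x, y}" using edges2 by blast
    then show "e \<inter> (verts G - A) \<noteq> {}" using e A(1) sub[OF e] by (auto simp: stable_set_def)
  qed auto
  then have "cover_number G \<le> card (verts G - A)" by (rule cover_number_le[OF fin])
  moreover have "card (verts G - A) = card (verts G) - card P"
    using A finite_subset[OF A(2) fin] by (simp add: card_Diff_subset)
  moreover have "card (verts G) = (\<Sum>S\<in>P. card S)"
    using card_partition_inter[OF P(1) fin, of "verts G"] P by (simp add: clique_def Int_absorb1)
  moreover have "(\<Sum>S\<in>P. card S) = (\<Sum>S\<in>P. card S - 1) + card P"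
  proof -
    have "(\<Sum>S\<in>P. card S) = (\<Sum>S\<in>P. (card S - 1) + 1)"
      using ne finK by (intro sum.cong) (auto simp: Suc_leI card_gt_0_iff)
    then show ?thesis by (simp only: sum.distrib card_eq_sum[of P])
  qed
  ultimately have "tau_reduction G P"
    using P eq by (simp add: tau_reduction_def)
  moreover have "complete_graph (induced_subgraph G S)" if "S \<in> P" for S
    using P that by (auto simp: clique_def complete_graph_def induced_subgraph_def)
  ultimately show ?thesis by blast
qed

section \<open>From semi-forests to strong vertex covers\<close>

text \<open>The usual definition splits a vertex cover \<open>C\<close> into \<open>L\<^sub>1\<close> (some out-neighbour outside \<open>C\<close>),
  \<open>L\<^sub>2\<close> (the others with some in-neighbour outside \<open>C\<close>) and \<open>L\<^sub>3\<close> (all neighbours in \<open>C\<close>), and asks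
  that every vertex of \<open>L\<^sub>3\<close> has an in-neighbour in \<open>(L\<^sub>2 \<union> L\<^sub>3) \<inter> V\<^sup>+\<close>.\<close>

definition strong_vertex_cover :: "'v wograph \<Rightarrow> 'v set \<Rightarrow> bool" where
  "strong_vertex_cover D C \<longleftrightarrow> vertex_cover (underlying_graph D) C \<and>
     (\<forall>x\<in>C. (\<exists>y. y \<in> nbrs D x \<and> y \<notin> C) \<or>
        (\<exists>y\<in>C. (y, x) \<in> arcs D \<and> 1 < weight D y \<and> out_nbrs D y \<subseteq> C))"

lemma verts_underlying_graph [simp]: "verts (underlying_graph D) = dverts D"
  by (simp add: underlying_graph_def)

lemma edge_underlying_graph_iff:
  "{x, y} \<in> edges (underlying_graph D) \<longleftrightarrow> (x, y) \<in> arcs D \<or> (y, x) \<in> arcs D"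
  by (auto simp: underlying_graph_def doubleton_eq_iff)

lemma nbrs_iff: "y \<in> nbrs D x \<longleftrightarrow> (x, y) \<in> arcs D \<or> (y, x) \<in> arcs D"
  by (auto simp: nbrs_def out_nbrs_def in_nbrs_def)

lemma stable_set_underlying_graph_iff:
  "stable_set (underlying_graph D) A \<longleftrightarrow>
     A \<subseteq> dverts D \<and> (\<forall>x\<in>A. \<forall>y\<in>A. (x, y) \<notin> arcs D)"
  unfolding stable_set_def edge_underlying_graph_iff verts_underlying_graph by blast

lemma stable_set_insert:
  assumes "stable_set (underlying_graph D) A" "x \<in> dverts D" "(x, x) \<notin> arcs D" "nbrs D x \<inter> A = {}"
  shows "stable_set (underlying_graph D) (insert x A)"
proof -
  have "(x, y) \<notin> arcs D" "(y, x) \<notin> arcs D" if "y \<in> A" for y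
    using assms(4) that by (auto simp: nbrs_iff disjoint_iff)
  then show ?thesis using assms(1-3) unfolding stable_set_underlying_graph_iff by blast
qed

lemma vertex_cover_underlying_graph_iff:
  "vertex_cover (underlying_graph D) C \<longleftrightarrow>
     C \<subseteq> dverts D \<and> (\<forall>(x, y)\<in>arcs D. x \<in> C \<or> y \<in> C)"
proof -
  have "(\<forall>e\<in>edges (underlying_graph D). e \<inter> C \<noteq> {}) \<longleftrightarrow>
      (\<forall>x y. (x, y) \<in> arcs D \<longrightarrow> {x, y} \<inter> C \<noteq> {})"
    unfolding underlying_graph_def by (simp only: sgraph.select_convs) blast
  then show ?thesis by (simp add: vertex_cover_def split_beta Ball_def)
qed

section \<open>Paths, cycles and in-neighbours in the components of a semi-forest\<close>

lemma path_penultimate: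
  assumes p: "oriented_path H p" and last: "last p = x" and ne: "hd p \<noteq> x"
  shows "\<exists>y. (y, x) \<in> arcs H \<and> y \<noteq> x \<and> (y = hd p \<or> (\<exists>u. (u, y) \<in> arcs H \<and> u \<noteq> x))"
proof -
  have p': "p \<noteq> []" "distinct p" "successively (\<lambda>x y. (x, y) \<in> arcs H) p"
    using p by (auto simp: oriented_path_def)
  obtain q where q: "p = q @ [x]" using p'(1) last by (metis append_butlast_last_id)
  have "q \<noteq> []" using q ne by auto
  then obtain r y where r: "q = r @ [y]" by (metis append_butlast_last_id)
  have yx: "(y, x) \<in> arcs H" "y \<noteq> x"
    using p' q r by (auto simp: successively_append_iff)
  show ?thesis
  proof (cases "r = []")
    case True
    then show ?thesis using yx q r by auto
  next
    case False
    then obtain t u where t: "r = t @ [u]" by (metis append_butlast_last_id)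
    have "(u, y) \<in> arcs H" "u \<noteq> x"
      using p' q r t by (auto simp: successively_append_iff)
    then show ?thesis using yx by blast
  qed
qed

lemma oriented_cycle_arc:
  assumes "oriented_cycle H ys" "i < length ys"
  shows "(ys ! i, ys ! (Suc i mod length ys)) \<in> arcs H"
proof (cases "Suc i < length ys")
  case True
  then show ?thesis
    using assms by (auto simp: oriented_cycle_def oriented_path_def successively_conv_nth)
next
  case False
  then have "Suc i = length ys" using assms by simp
  moreover have "ys \<noteq> []" using assms by auto
  ultimately have "last ys = ys ! i" "hd ys = ys ! (Suc i mod length ys)"
    by (simp_all add: last_conv_nth hd_conv_nth flip: \<open>Suc i = length ys\<close>)
  then show ?thesis using assms by (simp add: oriented_cycle_def)
qed

lemma oriented_cycle_nbrs:
  assumes cyc: "oriented_cycle H ys" and len: "3 \<le> length ys" and y: "y \<in> set ys"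
  shows "\<exists>u v. u \<in> set ys \<and> v \<in> set ys \<and> (u, y) \<in> arcs H \<and> (y, v) \<in> arcs H \<and> u \<noteq> v"
proof -
  let ?n = "length ys"
  obtain i where i: "i < ?n" "y = ys ! i" using y by (metis in_set_conv_nth)
  \<comment> \<open>Index of the cyclic predecessor; with at least three entries it differs from
    that of the cyclic successor.\<close>
  define j where "j = (if i = 0 then ?n - 1 else i - 1)"
  have j: "j < ?n" "Suc j mod ?n = i" using i len by (auto simp: j_def)
  have "Suc i mod ?n \<noteq> j"
  proof (cases "Suc i < ?n")
    case True
    then show ?thesis using len by (auto simp: j_def)
  next
    case False
    then have "Suc i = ?n" using i by simp
    then show ?thesis using len by (auto simp: j_def)
  qed
  moreover have "Suc i mod ?n < ?n" by (rule mod_less_divisor) (use len in linarith)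
  moreover have "distinct ys" using cyc by (simp add: oriented_cycle_def oriented_path_def)
  ultimately have "ys ! (Suc i mod ?n) \<noteq> ys ! j" using j by (simp add: nth_eq_iff_index_eq)
  moreover have "(ys ! j, y) \<in> arcs H" using oriented_cycle_arc[OF cyc j(1)] j i by simp
  moreover have "(y, ys ! (Suc i mod ?n)) \<in> arcs H" using oriented_cycle_arc[OF cyc i(1)] i by simp
  ultimately show ?thesis
    using j(1) \<open>Suc i mod ?n < ?n\<close> by (metis nth_mem)
qed

lemma graph_deg_ge_2:
  fixes H :: "('v::finite, 'z) digraph_scheme"
  assumes "u \<in> nbrs H y" "v \<in> nbrs H y" "u \<noteq> v"
  shows "2 \<le> graph_deg H y"
proof -
  have "card {u, v} \<le> card (nbrs H y)" using assms by (intro card_mono) auto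
  then show ?thesis using assms by (simp add: graph_deg_def)
qed

text \<open>The in-arc is the last arc of a path from the parent. The alternatives match the two
  ways of entering \<open>H'\<close> in \<open>star_semi_forest\<close>: degree at least two, or
  being a parent of degree one.\<close>

lemma ROT_in_arc:
  fixes D :: "'v::finite wograph"
  assumes "ROT D T v" "x \<in> dverts T" "x \<noteq> v"
  shows "\<exists>y. (y, x) \<in> arcs T \<and> (2 \<le> graph_deg T y \<or> (y = v \<and> 1 \<le> graph_deg T y))"
proof -
  obtain p where p: "oriented_path T p" "hd p = v" "last p = x"
    using assms unfolding ROT_def by blast
  then obtain y where y: "(y, x) \<in> arcs T" "y \<noteq> x"
    "y = v \<or> (\<exists>u. (u, y) \<in> arcs T \<and> u \<noteq> x)"
    using path_penultimate[of T p x] assms(3) by auto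
  have "nbrs T y \<noteq> {}" using y by (auto simp: nbrs_iff)
  then have "1 \<le> graph_deg T y" by (simp add: graph_deg_def Suc_leI card_gt_0_iff)
  moreover have "2 \<le> graph_deg T y" if "(u, y) \<in> arcs T" "u \<noteq> x" for u
    using that y by (intro graph_deg_ge_2[of u T y x]) (auto simp: nbrs_iff)
  ultimately show ?thesis using y by blast
qed

lemma unicycle_in_arc:
  fixes D :: "'v::finite wograph"
  assumes B: "unicycle_oriented_subgraph D B" and x: "x \<in> dverts B"
  shows "\<exists>y. (y, x) \<in> arcs B \<and> 2 \<le> graph_deg B y"
proof -
  obtain C ys where C: "cycles (underlying_graph B) = {C}" "oriented_cycle B ys" "C = cycle_graph ys"
    and reach: "\<forall>y \<in> dverts B - verts C. \<exists>p. oriented_path B p \<and> hd p \<in> verts C \<and> last p = y"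
    using B unfolding unicycle_oriented_subgraph_def by blast
  have VC: "verts C = set ys" using C by (simp add: cycle_graph_def)
  \<comment> \<open>\<open>oriented_cycle\<close> puts no lower bound on the length of
    \<open>ys\<close>; the bound 3 comes from a second listing \<open>zs\<close> of the same
    cycle.\<close>
  have "C \<in> cycles (underlying_graph B)" using C by simp
  then obtain zs where zs: "C = cycle_graph zs" "3 \<le> length zs" "distinct zs"
    unfolding cycles_def by blast
  have "set ys = set zs" using VC zs by (simp add: cycle_graph_def)
  then have "card (set ys) = length zs" using zs by (simp add: distinct_card)
  then have len: "3 \<le> length ys" using zs card_length[of ys] by linarith
  have deg: "2 \<le> graph_deg B y" if y: "y \<in> set ys" for y
  proof -
    obtain u v where "(u, y) \<in> arcs B" "(y, v) \<in> arcs B" "u \<noteq> v"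
      using oriented_cycle_nbrs[OF C(2) len y] by blast
    then show ?thesis by (intro graph_deg_ge_2[of u B y v]) (auto simp: nbrs_iff)
  qed
  show ?thesis
  proof (cases "x \<in> set ys")
    case True
    then obtain u where "u \<in> set ys" "(u, x) \<in> arcs B"
      using oriented_cycle_nbrs[OF C(2) len] by blast
    then show ?thesis using deg by blast
  next
    case False
    then obtain p where p: "oriented_path B p" "hd p \<in> set ys" "last p = x"
      using reach x VC by blast
    then have "hd p \<noteq> x" using False by auto
    then obtain y where y: "(y, x) \<in> arcs B" "y \<noteq> x"
      "y = hd p \<or> (\<exists>u. (u, y) \<in> arcs B \<and> u \<noteq> x)"
      using path_penultimate[of B p x] p by blast
    moreover have "2 \<le> graph_deg B y" if "(u, y) \<in> arcs B" "u \<noteq> x" for u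
      using that y by (intro graph_deg_ge_2[of u B y x]) (auto simp: nbrs_iff)
    ultimately show ?thesis using deg p(2) by metis
  qed
qed

text \<open>The complement of the cover is a maximal stable set avoiding \<open>S\<close>, \<open>W\<^sub>2\<close> and the
  out-neighbours of the vertices that have to act as witnesses of strength. A vertex of \<open>W\<^sub>2\<close>
  that would not be witnessed itself can be moved to \<open>W\<^sub>1\<close>.\<close>

lemma strong_vertex_cover_of_witnesses:
  fixes D :: "'v::finite wograph"
  assumes V: "dverts D = UNIV" and loopless: "\<And>x. (x, x) \<notin> arcs D"
    and Z: "\<And>z. z \<in> Z \<Longrightarrow> 1 < weight D z" "Z \<subseteq> S"
    and "W\<^sub>2 \<subseteq> Vplus D" "(W\<^sub>1 \<union> W\<^sub>2) \<inter> S = {}" "W\<^sub>1 \<inter> W\<^sub>2 = {}"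
    and "stable_set (underlying_graph D) W\<^sub>1"
    and "(\<Union>x \<in> W\<^sub>2 \<union> Z. out_nbrs D x) \<inter> W\<^sub>1 = {}"
    and "\<And>x. x \<in> S \<Longrightarrow> (\<exists>z\<in>Z. (z, x) \<in> arcs D) \<or> (\<exists>u\<in>W\<^sub>1. u \<in> nbrs D x) \<or>
       (\<exists>u\<in>W\<^sub>2. (u, x) \<in> arcs D)"
  shows "\<exists>C. strong_vertex_cover D C \<and> S \<subseteq> C"
  using assms(5-)
proof (induction "card W\<^sub>2" arbitrary: W\<^sub>1 W\<^sub>2 rule: less_induct)
  case less
  note W2 = less.prems(1) and disj = less.prems(2,3) and stable = less.prems(4)
    and out = less.prems(5) and S = less.prems(6)
  define N where "N = (\<Union>x \<in> W\<^sub>2 \<union> Z. out_nbrs D x)"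
  have N_iff: "y \<in> N \<longleftrightarrow> (\<exists>x\<in>W\<^sub>2 \<union> Z. (x, y) \<in> arcs D)" for y
    by (auto simp: N_def out_nbrs_def)
  show ?case
  proof (cases "\<exists>x\<in>W\<^sub>2. x \<notin> N \<and> nbrs D x \<inter> W\<^sub>1 = {}")
    case True
    then obtain x where x: "x \<in> W\<^sub>2" "x \<notin> N" "nbrs D x \<inter> W\<^sub>1 = {}" by blast
    show ?thesis
    proof (rule less.hyps[of "W\<^sub>2 - {x}" "insert x W\<^sub>1"])
      show "card (W\<^sub>2 - {x}) < card W\<^sub>2" using x by (intro psubset_card_mono) auto
      show "W\<^sub>2 - {x} \<subseteq> Vplus D" using W2 by blast
      show "(insert x W\<^sub>1 \<union> (W\<^sub>2 - {x})) \<inter> S = {}" using disj x by blast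
      show "insert x W\<^sub>1 \<inter> (W\<^sub>2 - {x}) = {}" using disj by blast
      show "stable_set (underlying_graph D) (insert x W\<^sub>1)"
        using stable x loopless V by (intro stable_set_insert) auto
      show "(\<Union>x \<in> W\<^sub>2 - {x} \<union> Z. out_nbrs D x) \<inter> insert x W\<^sub>1 = {}"
        using out x unfolding N_def by blast
      fix y assume "y \<in> S"
      from S[OF this] show "(\<exists>z\<in>Z. (z, y) \<in> arcs D) \<or> (\<exists>u\<in>insert x W\<^sub>1. u \<in> nbrs D y) \<or>
        (\<exists>u\<in>W\<^sub>2 - {x}. (u, y) \<in> arcs D)"
        by (auto simp: nbrs_iff)
    qed
  next
    case False
    define F where "F = S \<union> W\<^sub>2 \<union> N"
    define \<A> where "\<A> = {A. stable_set (underlying_graph D) A \<and> W\<^sub>1 \<subseteq> A \<and> A \<inter> F = {}}"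
    have "W\<^sub>1 \<in> \<A>" using stable disj out by (auto simp: \<A>_def F_def N_def)
    then have "\<A> \<noteq> {}" by blast
    then obtain A where A: "A \<in> \<A>" and Amax: "\<And>B. B \<in> \<A> \<Longrightarrow> A \<subseteq> B \<Longrightarrow> A = B"
      using finite_has_maximal[of \<A>] by (metis finite_code)
    have stA: "stable_set (underlying_graph D) A" and W1A: "W\<^sub>1 \<subseteq> A" and AF: "A \<inter> F = {}"
      using A by (auto simp: \<A>_def)
    have good: "z \<notin> A \<and> 1 < weight D z \<and> out_nbrs D z \<subseteq> - A" if "z \<in> W\<^sub>2 \<union> Z" for z
    proof -
      have "out_nbrs D z \<subseteq> N" using that by (auto simp: N_def)
      then show ?thesis using that Z W2 AF by (auto simp: F_def Vplus_def)
    qed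
    have "strong_vertex_cover D (- A)"
      unfolding strong_vertex_cover_def vertex_cover_underlying_graph_iff
    proof (intro conjI ballI)
      show "- A \<subseteq> dverts D" using V by simp
      show "case e of (x, y) \<Rightarrow> x \<in> - A \<or> y \<in> - A" if "e \<in> arcs D" for e
        using stA that by (auto simp: stable_set_underlying_graph_iff)
      fix x assume x: "x \<in> - A"
      show "(\<exists>y. y \<in> nbrs D x \<and> y \<notin> - A) \<or>
        (\<exists>y\<in>- A. (y, x) \<in> arcs D \<and> 1 < weight D y \<and> out_nbrs D y \<subseteq> - A)"
      proof (cases "\<exists>y. y \<in> nbrs D x \<and> y \<in> A")
        case True
        then show ?thesis by blast
      next
        case no: False
        have "x \<in> F"
        proof (rule ccontr)
          assume "x \<notin> F"
          moreover have "stable_set (underlying_graph D) (insert x A)"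
            using stA no loopless V by (intro stable_set_insert) auto
          ultimately have "insert x A \<in> \<A>" using W1A AF by (auto simp: \<A>_def)
          then show False using Amax x by blast
        qed
        \<comment> \<open>No neighbour of \<open>x\<close> lies in \<open>A\<close>, hence none in
          \<open>W\<^sub>1\<close>. For \<open>x\<close> in \<open>S\<close> this leaves only an arc
          from \<open>W\<^sub>2\<close> or \<open>Z\<close>, and a vertex of
          \<open>W\<^sub>2\<close> outside \<open>N\<close> would have a neighbour in
          \<open>W\<^sub>1\<close> by the case assumption.\<close>
        have "x \<in> N"
        proof (rule ccontr)
          assume "x \<notin> N"
          then have "x \<in> S \<or> x \<in> W\<^sub>2" using \<open>x \<in> F\<close> by (auto simp: F_def)
          then show False
          proof
            assume "x \<in> S"
            with S[of x] show False using no W1A \<open>x \<notin> N\<close> unfolding N_iff by blast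
          next
            assume "x \<in> W\<^sub>2"
            then have "nbrs D x \<inter> W\<^sub>1 \<noteq> {}" using False \<open>x \<notin> N\<close> by blast
            then show False using no W1A by blast
          qed
        qed
        then obtain z where "z \<in> W\<^sub>2 \<union> Z" "(z, x) \<in> arcs D" unfolding N_iff by blast
        with good[of z] show ?thesis by blast
      qed
    qed
    moreover have "S \<subseteq> - A" using AF by (auto simp: F_def)
    ultimately show ?thesis by blast
  qed
qed

theorem strong_vertex_cover_of_star_semi_forest:
  fixes D :: "'v::finite wograph"
  assumes D: "weighted_oriented_graph D" and H: "star_semi_forest D H"
  shows "\<exists>C. strong_vertex_cover D C \<and> dverts H \<subseteq> C"
proof -
  have V: "dverts D = UNIV" and asym: "asym (arcs D)" and pos: "\<And>x. 1 \<le> weight D x"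
    using D by (auto simp: weighted_oriented_graph_def)
  have loopless: "(x, x) \<notin> arcs D" for x using asym by (auto dest: asymD)
  from H obtain r s :: nat and T v B w W\<^sub>1 W\<^sub>2 where
    T: "\<forall>i<r. ROT D (T i) (v i)" and
    B: "\<forall>j<s. unicycle_oriented_subgraph D (B j)" and
    dv: "dverts H = (\<Union>i<r. dverts (T i)) \<union> (\<Union>j<s. dverts (B j))" and
    ar: "arcs H = (\<Union>i<r. arcs (T i)) \<union> (\<Union>j<s. arcs (B j))" and
    dT: "disjoint_family_on (\<lambda>i. dverts (T i)) {..<r}" and
    dB: "disjoint_family_on (\<lambda>j. dverts (B j)) {..<s}" and
    dTB: "\<forall>i<r. \<forall>j<s. dverts (T i) \<inter> dverts (B j) = {}" and
    w: "\<forall>i<r. w i \<in> dverts D - dverts H \<and> w i \<in> nbrs D (v i)" and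
    W: "W\<^sub>1 \<union> W\<^sub>2 = w ` {..<r}" "W\<^sub>1 \<inter> W\<^sub>2 = {}" and
    stable: "stable_set (underlying_graph D) W\<^sub>1" and
    W2: "W\<^sub>2 \<subseteq> Vplus D" "\<forall>i<r. w i \<in> W\<^sub>2 \<longrightarrow> (w i, v i) \<in> arcs D" and
    out: "(\<Union>x \<in> W\<^sub>2 \<union> ({x \<in> dverts H. 2 \<le> graph_deg H x} \<union>
        {v i | i. i < r \<and> graph_deg H (v i) = 1}). out_nbrs D x) \<inter> W\<^sub>1 = {}"
    unfolding star_semi_forest_def Let_def by (elim exE conjE) (rule that)
  define Z where "Z = {x \<in> dverts H. 2 \<le> graph_deg H x} \<union>
    {v i | i. i < r \<and> graph_deg H (v i) = 1}"
  have arcsT: "arcs (T i) \<subseteq> dverts (T i) \<times> dverts (T i)" if "i < r" for i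
    using T that by (auto simp: ROT_def oriented_subgraph_def)
  have arcsB: "arcs (B j) \<subseteq> dverts (B j) \<times> dverts (B j)" if "j < s" for j
    using B that by (auto simp: unicycle_oriented_subgraph_def oriented_subgraph_def)
  \<comment> \<open>The components have disjoint vertex sets, so the arcs of \<open>H\<close> at a
    vertex belong to its own component, and degrees can be computed there.\<close>
  have arT: "e \<in> arcs H \<longleftrightarrow> e \<in> arcs (T i)"
    if "i < r" "x \<in> dverts (T i)" "fst e = x \<or> snd e = x" for i e x
  proof
    assume "e \<in> arcs H"
    then consider i' where "i' < r" "e \<in> arcs (T i')" | j where "j < s" "e \<in> arcs (B j)"
      using ar by auto
    then show "e \<in> arcs (T i)"
    proof cases
      case 1
      then have "x \<in> dverts (T i')" using arcsT[of i'] that by auto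
      then have "i' = i" using dT 1 that unfolding disjoint_family_on_def by blast
      then show ?thesis using 1 by simp
    next
      case 2
      then have "x \<in> dverts (B j)" using arcsB[of j] that by auto
      then show ?thesis using dTB 2 that by blast
    qed
  qed (use ar that in auto)
  have arB: "e \<in> arcs H \<longleftrightarrow> e \<in> arcs (B j)"
    if "j < s" "x \<in> dverts (B j)" "fst e = x \<or> snd e = x" for j e x
  proof
    assume "e \<in> arcs H"
    then consider i where "i < r" "e \<in> arcs (T i)" | j' where "j' < s" "e \<in> arcs (B j')"
      using ar by auto
    then show "e \<in> arcs (B j)"
    proof cases
      case 1
      then have "x \<in> dverts (T i)" using arcsT[of i] that by auto
      then show ?thesis using dTB 1 that by blast
    next
      case 2
      then have "x \<in> dverts (B j')" using arcsB[of j'] that by auto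
      then have "j' = j" using dB 2 that unfolding disjoint_family_on_def by blast
      then show ?thesis using 2 by simp
    qed
  qed (use ar that in auto)
  have degT: "graph_deg H x = graph_deg (T i) x" if "i < r" "x \<in> dverts (T i)" for i x
  proof -
    have "nbrs H x = nbrs (T i) x"
      using arT[OF that] unfolding set_eq_iff nbrs_iff by (metis fst_conv snd_conv)
    then show ?thesis by (simp add: graph_deg_def)
  qed
  have degB: "graph_deg H x = graph_deg (B j) x" if "j < s" "x \<in> dverts (B j)" for j x
  proof -
    have "nbrs H x = nbrs (B j) x"
      using arB[OF that] unfolding set_eq_iff nbrs_iff by (metis fst_conv snd_conv)
    then show ?thesis by (simp add: graph_deg_def)
  qed
  have vT: "v i \<in> dverts (T i)" if "i < r" for i using T that by (auto simp: ROT_def)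
  have arcsD: "arcs H \<subseteq> arcs D" using H by (auto simp: star_semi_forest_def oriented_subgraph_def)
  \<comment> \<open>A vertex of weight 1 in a ROT is a leaf other than the parent or an isolated
    parent; neither kind satisfies the degree conditions defining \<open>Z\<close>.\<close>
  have weight1: "graph_deg (T i) z = 1 \<and> z \<noteq> v i \<or> graph_deg (T i) z = 0"
    if "i < r" "z \<in> dverts (T i)" "weight D z = 1" for i z
  proof (cases "dverts (T i) = {v i} \<and> z = v i")
    case True
    then have "arcs (T i) \<subseteq> {(z, z)}" using arcsT[OF that(1)] by auto
    moreover have "(z, z) \<notin> arcs (T i)" using loopless arcsD ar that(1) by blast
    ultimately have "arcs (T i) = {}" by auto
    then have "nbrs (T i) z = {}" by (auto simp: nbrs_iff)
    then show ?thesis by (simp add: graph_deg_def)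
  next
    case False
    have "ROT D (T i) (v i)" using T that(1) by blast
    then show ?thesis using that(2,3) False unfolding ROT_def by blast
  qed
  show ?thesis
  proof (rule strong_vertex_cover_of_witnesses[OF V loopless, of Z])
    fix z assume z: "z \<in> Z"
    show "1 < weight D z"
    proof (rule ccontr)
      assume "\<not> 1 < weight D z"
      then have w1: "weight D z = 1" using pos[of z] by simp
      from z consider "z \<in> dverts H" "2 \<le> graph_deg H z"
        | i where "z = v i" "i < r" "graph_deg H z = 1" by (auto simp: Z_def)
      then show False
      proof cases
        case 1
        then consider i where "i < r" "z \<in> dverts (T i)" | j where "j < s" "z \<in> dverts (B j)"
          using dv by auto
        then show False
        proof cases
          case i: 1
          then show False using weight1[OF i w1] degT[OF i] 1 by linarith
        next
          case j: 2
          then have "graph_deg (B j) z = 1"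
            using B w1 unfolding unicycle_oriented_subgraph_def by blast
          then show False using degB[OF j] 1 by simp
        qed
      next
        case (2 i)
        then have z: "i < r" "z \<in> dverts (T i)" using vT by simp_all
        show False using weight1[OF z w1] degT[OF z] 2 by simp
      qed
    qed
  next
    show "Z \<subseteq> dverts H" using vT dv by (auto simp: Z_def)
    show "W\<^sub>2 \<subseteq> Vplus D" by fact
    show "(W\<^sub>1 \<union> W\<^sub>2) \<inter> dverts H = {}" unfolding W using w by auto
    show "W\<^sub>1 \<inter> W\<^sub>2 = {}" by fact
    show "stable_set (underlying_graph D) W\<^sub>1" by fact
    show "(\<Union>x \<in> W\<^sub>2 \<union> Z. out_nbrs D x) \<inter> W\<^sub>1 = {}" using out by (simp add: Z_def)
  next
    fix x assume "x \<in> dverts H"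
    then consider i where "i < r" "x \<in> dverts (T i)" | j where "j < s" "x \<in> dverts (B j)"
      using dv by auto
    then show "(\<exists>z\<in>Z. (z, x) \<in> arcs D) \<or> (\<exists>u\<in>W\<^sub>1. u \<in> nbrs D x) \<or> (\<exists>u\<in>W\<^sub>2. (u, x) \<in> arcs D)"
    proof cases
      case (1 i)
      show ?thesis
      proof (cases "x = v i")
        case True
        have "w i \<in> W\<^sub>1 \<union> W\<^sub>2" using W 1 by blast
        then show ?thesis using True w W2(2) 1 by blast
      next
        case False
        then obtain y where y: "(y, x) \<in> arcs (T i)"
          "2 \<le> graph_deg (T i) y \<or> (y = v i \<and> 1 \<le> graph_deg (T i) y)"
          using ROT_in_arc[of D "T i" "v i" x] T 1 by blast
        have yT: "y \<in> dverts (T i)" using y arcsT[OF 1(1)] by blast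
        have "2 \<le> graph_deg H y \<or> (y = v i \<and> graph_deg H y = 1)"
          using y degT[OF 1(1) yT] by linarith
        then have "y \<in> Z" using yT 1 dv by (auto simp: Z_def)
        moreover have "(y, x) \<in> arcs D" using y ar arcsD 1 by blast
        ultimately show ?thesis by blast
      qed
    next
      case (2 j)
      then obtain y where y: "(y, x) \<in> arcs (B j)" "2 \<le> graph_deg (B j) y"
        using unicycle_in_arc[of D "B j" x] B by blast
      have yB: "y \<in> dverts (B j)" using y arcsB[OF 2(1)] by blast
      then have "y \<in> Z" using y degB[OF 2(1) yB] 2 dv by (auto simp: Z_def)
      moreover have "(y, x) \<in> arcs D" using y ar arcsD 2 by blast
      ultimately show ?thesis by blast
    qed
  qed
qed

section \<open>From strong vertex covers to semi-forests\<close>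

text \<open>The points visited infinitely often by the iterates of \<open>f\<close> from
  \<open>x\<close>. On a finite type this is the cycle that the orbit runs into, a fixed point being
  a cycle of length one; it names the component of \<open>x\<close> in the functional graph.\<close>

definition terminal :: "('v \<Rightarrow> 'v) \<Rightarrow> 'v \<Rightarrow> 'v set" where
  "terminal f x = {y. \<forall>n. \<exists>k\<ge>n. (f ^^ k) x = y}"

text \<open>The distance to the cycle, which drives the construction of paths and the location of
  cycles.\<close>

definition depth :: "('v \<Rightarrow> 'v) \<Rightarrow> 'v \<Rightarrow> nat" where
  "depth f x = (LEAST k. (f ^^ k) x \<in> terminal f x)"

text \<open>Arcs run from \<open>f y\<close> to \<open>y\<close> because \<open>f\<close> will
  choose in-neighbours. Fixed points encode roots and give no arc, so that a component with a
  singleton terminal set is a tree.\<close>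

definition component_graph :: "('v \<Rightarrow> 'v) \<Rightarrow> 'v set \<Rightarrow> 'v digraph" where
  "component_graph f Q = \<lparr>dverts = {y. terminal f y = Q},
     arcs = {(f y, y) | y. terminal f y = Q \<and> f y \<noteq> y}\<rparr>"

lemma terminal_step [simp]: "terminal f (f x) = terminal f x"
proof -
  have "(\<forall>n. \<exists>k\<ge>n. (f ^^ k) (f x) = y) \<longleftrightarrow> (\<forall>n. \<exists>k\<ge>n. (f ^^ k) x = y)" for y
  proof
    assume L: "\<forall>n. \<exists>k\<ge>n. (f ^^ k) (f x) = y"
    show "\<forall>n. \<exists>k\<ge>n. (f ^^ k) x = y"
    proof
      fix n
      obtain k where "k \<ge> n" "(f ^^ k) (f x) = y" using L by blast
      then have "Suc k \<ge> n" "(f ^^ Suc k) x = y" by (simp_all add: funpow_swap1)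
      then show "\<exists>k\<ge>n. (f ^^ k) x = y" by blast
    qed
  next
    assume R: "\<forall>n. \<exists>k\<ge>n. (f ^^ k) x = y"
    show "\<forall>n. \<exists>k\<ge>n. (f ^^ k) (f x) = y"
    proof
      fix n
      obtain k where k: "k \<ge> Suc n" "(f ^^ k) x = y" using R by blast
      then obtain l where "k = Suc l" by (cases k) auto
      then have "l \<ge> n" "(f ^^ l) (f x) = y" using k by (simp_all add: funpow_swap1)
      then show "\<exists>k\<ge>n. (f ^^ k) (f x) = y" by blast
    qed
  qed
  then show ?thesis by (simp add: terminal_def)
qed

lemma terminal_funpow [simp]: "terminal f ((f ^^ k) x) = terminal f x"
  by (induction k) simp_all

lemma terminal_orbit: "y \<in> terminal f x \<Longrightarrow> \<exists>k. (f ^^ k) x = y"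
  unfolding terminal_def by blast

lemma terminal_eq: "y \<in> terminal f x \<Longrightarrow> terminal f y = terminal f x"
  using terminal_orbit terminal_funpow by metis

lemma terminal_closed: "y \<in> terminal f x \<Longrightarrow> f y \<in> terminal f x"
proof -
  assume y: "y \<in> terminal f x"
  show ?thesis
    unfolding terminal_def
  proof (intro CollectI allI)
    fix n
    obtain k where "k \<ge> n" "(f ^^ k) x = y" using y unfolding terminal_def by blast
    then have "Suc k \<ge> n" "(f ^^ Suc k) x = f y" by simp_all
    then show "\<exists>k\<ge>n. (f ^^ k) x = f y" by blast
  qed
qed

lemma terminal_closed_funpow: "y \<in> terminal f x \<Longrightarrow> (f ^^ k) y \<in> terminal f x"
  by (induction k) (simp_all add: terminal_closed)

lemma terminal_nonempty: "terminal f (x::'v::finite) \<noteq> {}"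
proof -
  have "\<exists>k\<in>UNIV. infinite {l \<in> UNIV. (f ^^ l) x = (f ^^ k) x}"
    by (rule pigeonhole_infinite) auto
  then obtain y where y: "infinite {l. (f ^^ l) x = y}" by auto
  have "y \<in> terminal f x"
    unfolding terminal_def using y by (auto simp: infinite_nat_iff_unbounded_le)
  then show ?thesis by blast
qed

lemma terminal_periodic:
  assumes "y \<in> terminal f x"
  shows "\<exists>k>0. (f ^^ k) y = y"
proof -
  have "y \<in> terminal f y" using assms terminal_eq by metis
  then obtain k where "k \<ge> 1" "(f ^^ k) y = y" unfolding terminal_def by blast
  then show ?thesis by (intro exI[of _ k]) simp
qed

lemma funpow_period_mult: "(f ^^ p) x = x \<Longrightarrow> (f ^^ (p * q)) x = x"
  by (induction q) (simp_all add: funpow_add)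

text \<open>Two recurrent points with the same image are both returned to themselves by the product
  of their periods, an iterate that starts with \<open>f\<close>.\<close>

lemma inj_on_terminal: "inj_on f (terminal f x)"
proof (rule inj_onI)
  fix u v assume u: "u \<in> terminal f x" and v: "v \<in> terminal f x" and eq: "f u = f v"
  obtain p where p: "p > 0" "(f ^^ p) u = u" using terminal_periodic[OF u] by blast
  obtain q where q: "q > 0" "(f ^^ q) v = v" using terminal_periodic[OF v] by blast
  obtain r where r: "p * q = Suc r" using p q by (cases "p * q") auto
  have "u = (f ^^ Suc r) u" using funpow_period_mult[OF p(2), of q] r by simp
  also have "\<dots> = (f ^^ Suc r) v" using eq by (simp add: funpow_swap1)
  also have "\<dots> = v" using funpow_period_mult[OF q(2), of p] r by (simp add: mult.commute)
  finally show "u = v" .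
qed

lemma terminal_fixpoint: "f x = x \<Longrightarrow> terminal f x = {x}"
proof -
  assume "f x = x"
  then have "(f ^^ k) x = x" for k by (induction k) simp_all
  then show ?thesis unfolding terminal_def by auto
qed

lemma terminal_singleton_fixpoint: "terminal f x = {v} \<Longrightarrow> f v = v \<and> terminal f v = {v}"
  using terminal_closed[of v f x] terminal_eq[of v f x] by auto

lemma depth_terminal: "(f ^^ depth f (x::'v::finite)) x \<in> terminal f x"
proof -
  obtain y where "y \<in> terminal f x" using terminal_nonempty[of f x] by blast
  then obtain k where "(f ^^ k) x \<in> terminal f x" using terminal_orbit by metis
  then show ?thesis unfolding depth_def by (rule LeastI)
qed

lemma depth_eq_0_iff: "depth f (x::'v::finite) = 0 \<longleftrightarrow> x \<in> terminal f x"
proof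
  assume "depth f x = 0"
  then show "x \<in> terminal f x" using depth_terminal[of f x] by simp
next
  assume "x \<in> terminal f x"
  then have "depth f x \<le> 0" unfolding depth_def by (intro Least_le) simp
  then show "depth f x = 0" by simp
qed

lemma depth_step: "depth f (x::'v::finite) > 0 \<Longrightarrow> depth f (f x) < depth f x"
proof -
  assume "depth f x > 0"
  then obtain k where k: "depth f x = Suc k" by (cases "depth f x") auto
  then have "(f ^^ k) (f x) \<in> terminal f (f x)"
    using depth_terminal[of f x] by (simp add: funpow_swap1)
  then have "depth f (f x) \<le> k" unfolding depth_def by (rule Least_le)
  then show ?thesis using k by simp
qed

section \<open>Cycles and paths in component graphs\<close>

lemma cycle_graph_nbrs:
  assumes "3 \<le> length ys" "distinct ys" "x \<in> set ys"
  shows "\<exists>a b. a \<in> set ys \<and> b \<in> set ys \<and> a \<noteq> b \<and>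
    {x, a} \<in> edges (cycle_graph ys) \<and> {x, b} \<in> edges (cycle_graph ys)"
proof -
  \<comment> \<open>Orienting the cycle along its list reduces the claim to
    \<open>oriented_cycle_nbrs\<close>.\<close>
  let ?H = "\<lparr>dverts = set ys, arcs = {(ys ! i, ys ! (Suc i mod length ys)) | i. i < length ys}\<rparr>"
  have succ: "successively (\<lambda>x y. (x, y) \<in> arcs ?H) ys"
    unfolding successively_conv_nth
  proof (intro allI impI)
    fix i assume i: "Suc i < length ys"
    then have "Suc i mod length ys = Suc i" by simp
    then show "(ys ! i, ys ! Suc i) \<in> arcs ?H"
      using i by (auto intro!: exI[of _ i])
  qed
  have ne: "ys \<noteq> []" using assms(3) by auto
  have "(ys ! (length ys - 1), ys ! (Suc (length ys - 1) mod length ys)) \<in> arcs ?H"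
    using ne by auto
  then have "(last ys, hd ys) \<in> arcs ?H"
    using ne by (simp add: last_conv_nth hd_conv_nth)
  then have "oriented_cycle ?H ys"
    using succ ne assms(2) by (simp add: oriented_cycle_def oriented_path_def)
  then obtain u v where uv: "u \<in> set ys" "v \<in> set ys" "(u, x) \<in> arcs ?H" "(x, v) \<in> arcs ?H" "u \<noteq> v"
    using oriented_cycle_nbrs[OF _ assms(1,3)] by blast
  have "{a, b} \<in> edges (cycle_graph ys)" if "(a, b) \<in> arcs ?H" for a b
    using that by (auto simp: cycle_graph_def)
  then have "{u, x} \<in> edges (cycle_graph ys)" "{x, v} \<in> edges (cycle_graph ys)"
    using uv by blast+
  then show ?thesis using uv by (metis insert_commute)
qed

lemma edges_component_graph:
  "edges (underlying_graph (component_graph f Q)) = {{f y, y} | y. terminal f y = Q \<and> f y \<noteq> y}"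
  by (auto simp: underlying_graph_def component_graph_def)

text \<open>At a vertex of maximal depth of a cycle, both cycle edges would lead to its image unless
  the depth is zero. So a cycle lies in the terminal set, where \<open>f\<close> is injective.\<close>

lemma cycle_component_graph:
  fixes f :: "'v::finite \<Rightarrow> 'v"
  assumes "C \<in> cycles (underlying_graph (component_graph f Q))"
  shows "C = \<lparr>verts = Q, edges = {{f x, x} | x. x \<in> Q}\<rparr>" and "\<nexists>v. Q = {v}"
proof -
  obtain ys where C: "C = cycle_graph ys" and ys: "3 \<le> length ys" "distinct ys"
    and V: "set ys \<subseteq> {y. terminal f y = Q}"
    and E: "edges C \<subseteq> {{f y, y} | y. terminal f y = Q \<and> f y \<noteq> y}"
    using assms unfolding cycles_def edges_component_graph verts_underlying_graph
    by (auto simp: component_graph_def cycle_graph_def)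
  have VC: "verts C = set ys" using C by (simp add: cycle_graph_def)
  have edge_dest: "a = f x \<or> f a = x" if xa: "{x, a} \<in> edges C" for x a
  proof -
    obtain y where "{x, a} = {f y, y}" using E xa by blast
    then show ?thesis by (auto simp: doubleton_eq_iff)
  qed
  have ne: "set ys \<noteq> {}" using ys by auto
  define m where "m = Max (depth f ` set ys)"
  have le_m: "depth f y \<le> m" if "y \<in> set ys" for y using that by (simp add: m_def)
  have "m \<in> depth f ` set ys" unfolding m_def using ne by (intro Max_in) auto
  then obtain x where x: "x \<in> set ys" "depth f x = m" by auto
  have "m = 0"
  proof (rule ccontr)
    assume m: "m \<noteq> 0"
    have "a = f x" if a: "{x, a} \<in> edges C" "a \<in> set ys" for a
    proof (rule ccontr)
      assume "a \<noteq> f x"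
      then have fa: "f a = x" using edge_dest a by blast
      show False
      proof (cases "depth f a = 0")
        case True
        then have "x \<in> terminal f x"
          using fa terminal_closed[of a f a] by (auto simp: depth_eq_0_iff)
        then show False using x m by (simp add: depth_eq_0_iff[symmetric])
      next
        case False
        then have "depth f x < depth f a" using depth_step[of f a] fa by simp
        then show False using le_m[OF a(2)] x by simp
      qed
    qed
    then show False using cycle_graph_nbrs[OF ys x(1)] C by metis
  qed
  then have Q: "set ys \<subseteq> Q" using le_m V by (auto simp: depth_eq_0_iff)
  obtain x0 where x0: "x0 \<in> set ys" using x(1) by (rule that)
  have tx0: "terminal f x0 = Q" using V x0 by blast
  have inj: "inj_on f Q" using inj_on_terminal[of f x0] tx0 by simp
  \<comment> \<open>One of the two neighbours of \<open>x\<close> on the cycle is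
    \<open>f x\<close>: otherwise \<open>f\<close> would map both to \<open>x\<close>, against
    injectivity on \<open>Q\<close>.\<close>
  have fwd: "{f x, x} \<in> edges C \<and> f x \<in> set ys" if x: "x \<in> set ys" for x
  proof -
    obtain a b where ab: "a \<in> set ys" "b \<in> set ys" "a \<noteq> b" "{x, a} \<in> edges C" "{x, b} \<in> edges C"
      using cycle_graph_nbrs[OF ys x] C by blast
    have "a = f x \<or> b = f x"
    proof (rule ccontr)
      assume "\<not> ?thesis"
      then have "f a = f b" using edge_dest ab by metis
      then show False using inj ab Q by (auto dest: inj_onD)
    qed
    then show ?thesis using ab by (auto simp: insert_commute)
  qed
  \<comment> \<open>The cycle is closed under \<open>f\<close>, so it contains the orbit of
    \<open>x0\<close>, and this orbit exhausts \<open>Q\<close>.\<close>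
  have orbit: "(f ^^ k) x0 \<in> set ys" for k by (induction k) (use x0 fwd in auto)
  have "Q \<subseteq> set ys"
  proof
    fix y assume "y \<in> Q"
    then obtain k where "(f ^^ k) x0 = y" using terminal_orbit[of y f x0] tx0 by blast
    then show "y \<in> set ys" using orbit by blast
  qed
  then have QV: "set ys = Q" using Q by blast
  have sub: "e \<subseteq> set ys" if e: "e \<in> edges C" for e
  proof -
    obtain i where i: "i < length ys" "e = {ys ! i, ys ! (Suc i mod length ys)}"
      using e C by (auto simp: cycle_graph_def)
    moreover have "Suc i mod length ys < length ys" using i(1) by (intro mod_less_divisor) linarith
    ultimately show ?thesis by simp
  qed
  have "edges C = {{f x, x} | x. x \<in> Q}"
  proof
    show "edges C \<subseteq> {{f x, x} | x. x \<in> Q}"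
    proof
      fix e assume e: "e \<in> edges C"
      then obtain y where y: "e = {f y, y}" using E by blast
      then have "y \<in> Q" using sub[OF e] QV by blast
      with y show "e \<in> {{f x, x} | x. x \<in> Q}" by blast
    qed
    show "{{f x, x} | x. x \<in> Q} \<subseteq> edges C" using fwd QV by auto
  qed
  then show "C = \<lparr>verts = Q, edges = {{f x, x} | x. x \<in> Q}\<rparr>" using VC QV by simp
  show "\<nexists>v. Q = {v}"
  proof
    assume "\<exists>v. Q = {v}"
    then have "card (set ys) = 1" using QV by auto
    then show False using ys by (simp add: distinct_card)
  qed
qed

text \<open>The bound on depths keeps the path distinct: the appended vertex is strictly deeper than
  every vertex on the path to its image.\<close>

lemma component_graph_path:
  fixes f :: "'v::finite \<Rightarrow> 'v"
  assumes "terminal f x = Q"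
  shows "\<exists>p. oriented_path (component_graph f Q) p \<and> hd p \<in> Q \<and> last p = x \<and>
    (\<forall>y\<in>set p. depth f y \<le> depth f x)"
  using assms
proof (induction "depth f x" arbitrary: x rule: less_induct)
  case less
  show ?case
  proof (cases "depth f x = 0")
    case True
    then have "x \<in> Q" using less.prems by (simp add: depth_eq_0_iff)
    then show ?thesis using less.prems
      by (intro exI[of _ "[x]"]) (simp add: oriented_path_def component_graph_def)
  next
    case False
    then have lt: "depth f (f x) < depth f x" by (simp add: depth_step)
    then obtain p where p: "oriented_path (component_graph f Q) p" "hd p \<in> Q" "last p = f x"
      "\<forall>y\<in>set p. depth f y \<le> depth f (f x)"
      using less.hyps[OF lt] less.prems by auto
    have "f x \<noteq> x" using lt by auto
    then have arc: "(f x, x) \<in> arcs (component_graph f Q)"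
      using less.prems by (auto simp: component_graph_def)
    have "x \<notin> set p" using p(4) lt by auto
    moreover have "x \<in> dverts (component_graph f Q)" using less.prems by (simp add: component_graph_def)
    ultimately have "oriented_path (component_graph f Q) (p @ [x])"
      using p arc by (auto simp: oriented_path_def successively_append_iff)
    moreover have "hd (p @ [x]) = hd p" using p(1) by (simp add: oriented_path_def)
    moreover have "\<forall>y\<in>set (p @ [x]). depth f y \<le> depth f x" using p(4) lt by auto
    ultimately show ?thesis using p(2) by (intro exI[of _ "p @ [x]"]) simp
  qed
qed

lemma component_graph_oriented_cycle:
  fixes f :: "'v::finite \<Rightarrow> 'v"
  assumes z: "terminal f x = Q" and nosing: "\<nexists>v. Q = {v}"
  shows "\<exists>ys. oriented_cycle (component_graph f Q) ys \<and> set ys = Q"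
proof -
  obtain z where zx: "z \<in> terminal f x" using terminal_nonempty[of f x] by blast
  then have tz: "terminal f z = Q" and zQ: "z \<in> Q" using z terminal_eq[OF zx] by simp_all
  \<comment> \<open>The least period of \<open>z\<close>: two equal iterates
    \<open>i < j < m\<close> would give the shorter period \<open>m - j + i\<close>, so the list
    \<open>zs\<close> is distinct.\<close>
  define m where "m = (LEAST m. m > 0 \<and> (f ^^ m) z = z)"
  have m: "m > 0 \<and> (f ^^ m) z = z"
    unfolding m_def using terminal_periodic[OF zx] by (rule LeastI_ex)
  have least: "\<not> (k > 0 \<and> (f ^^ k) z = z)" if "k < m" for k
    using that unfolding m_def by (rule not_less_Least)
  define zs where "zs = map (\<lambda>k. (f ^^ k) z) [0..<m]"
  have inj': "i = j" if "i < m" "j < m" "(f ^^ i) z = (f ^^ j) z" "i \<le> j" for i j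
  proof (rule ccontr)
    assume "i \<noteq> j"
    have "(f ^^ (m - j + i)) z = (f ^^ (m - j)) ((f ^^ i) z)" by (simp add: funpow_add)
    also have "\<dots> = (f ^^ (m - j + j)) z" by (simp only: funpow_add o_apply that(3))
    also have "\<dots> = z" using m that by simp
    finally have "(f ^^ (m - j + i)) z = z" .
    moreover have "m - j + i < m" "0 < m - j + i" using that \<open>i \<noteq> j\<close> by linarith+
    ultimately show False using least by blast
  qed
  have dist: "distinct zs"
    unfolding zs_def distinct_map
  proof (intro conjI inj_onI)
    fix i j assume "i \<in> set [0..<m]" "j \<in> set [0..<m]" "(f ^^ i) z = (f ^^ j) z"
    then show "i = j" using inj'[of i j] inj'[of j i] by (cases "i \<le> j") auto
  qed simp
  have "set zs = Q"
  proof
    show "set zs \<subseteq> Q" using terminal_closed_funpow[of z f z] zQ tz by (auto simp: zs_def)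
    show "Q \<subseteq> set zs"
    proof
      fix y assume "y \<in> Q"
      then obtain k where "(f ^^ k) z = y" using terminal_orbit[of y f z] tz by blast
      then have "y = (f ^^ (k mod m)) z" using funpow_mod_eq[of m f z k] m by simp
      then show "y \<in> set zs" using m by (simp add: zs_def)
    qed
  qed
  have nofix: "f y \<noteq> y" if "terminal f y = Q" for y
    using nosing terminal_fixpoint[of f y] that by metis
  have arc: "(f y, y) \<in> arcs (component_graph f Q)" if "y \<in> Q" for y
  proof -
    have "terminal f y = Q" using that terminal_eq[of y f z] tz by simp
    then show ?thesis using nofix by (auto simp: component_graph_def)
  qed
  \<comment> \<open>The list is reversed because arcs point from \<open>f y\<close> to
    \<open>y\<close>.\<close>
  have "successively (\<lambda>x y. (x, y) \<in> arcs (component_graph f Q)) (rev zs)"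
    unfolding successively_rev unfolding successively_conv_nth
  proof (intro allI impI)
    fix i assume i: "Suc i < length zs"
    then have "zs ! i \<in> Q" using \<open>set zs = Q\<close> by (metis Suc_lessD nth_mem)
    moreover have "zs ! Suc i = f (zs ! i)" using i by (simp add: zs_def)
    ultimately show "(zs ! Suc i, zs ! i) \<in> arcs (component_graph f Q)" using arc by simp
  qed
  moreover have "zs \<noteq> []" using m by (simp add: zs_def)
  moreover have "Q \<subseteq> dverts (component_graph f Q)"
    using terminal_eq[of _ f z] tz by (auto simp: component_graph_def)
  ultimately have path: "oriented_path (component_graph f Q) (rev zs)"
    using dist \<open>set zs = Q\<close> by (simp add: oriented_path_def)
  have hd: "hd zs = z" using m by (simp add: zs_def hd_map)
  have "last zs = (f ^^ (m - 1)) z" using m by (simp add: zs_def last_map)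
  moreover have "f ((f ^^ (m - 1)) z) = (f ^^ Suc (m - 1)) z" by simp
  ultimately have "f (last zs) = z" using m by simp
  moreover have "last zs \<in> Q" using \<open>zs \<noteq> []\<close> \<open>set zs = Q\<close> by auto
  ultimately have "(z, last zs) \<in> arcs (component_graph f Q)" using arc by force
  then have "oriented_cycle (component_graph f Q) (rev zs)"
    using path hd \<open>zs \<noteq> []\<close> by (simp add: oriented_cycle_def last_rev hd_rev)
  then show ?thesis using \<open>set zs = Q\<close> by (metis set_rev)
qed

section \<open>Component graphs as ROTs and unicycle subgraphs\<close>

lemma component_graph_arcs_iff:
  "(a, b) \<in> arcs (component_graph f Q) \<longleftrightarrow> a = f b \<and> terminal f b = Q \<and> f b \<noteq> b"
  by (auto simp: component_graph_def)

lemma oriented_subgraph_component_graph: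
  assumes "dverts D = UNIV" "\<And>x. f x \<noteq> x \<Longrightarrow> (f x, x) \<in> arcs D"
  shows "oriented_subgraph (component_graph f Q) D"
  using assms unfolding oriented_subgraph_def component_graph_def by auto

text \<open>A neighbour other than \<open>f x\<close> would be mapped to \<open>x\<close>, which
  forces the weight of \<open>x\<close> above 1; so a vertex of weight 1 is a leaf.\<close>

lemma component_graph_deg_weight_1:
  assumes heavy: "\<And>y. f y \<noteq> y \<Longrightarrow> 1 < weight D (f y)"
    and x: "terminal f x = Q" "f x \<noteq> x" "weight D x = 1"
  shows "graph_deg (component_graph f Q) x = 1"
proof -
  have "nbrs (component_graph f Q) x = {f x}"
  proof
    show "nbrs (component_graph f Q) x \<subseteq> {f x}"
    proof
      fix y assume "y \<in> nbrs (component_graph f Q) x"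
      then have "(x = f y \<and> f y \<noteq> y) \<or> y = f x" unfolding nbrs_iff component_graph_arcs_iff by blast
      then show "y \<in> {f x}" using heavy[of y] x(3) by auto
    qed
    show "{f x} \<subseteq> nbrs (component_graph f Q) x"
      using x unfolding nbrs_iff component_graph_arcs_iff by (simp add: nbrs_iff component_graph_arcs_iff)
  qed
  then show ?thesis by (simp add: graph_deg_def)
qed

lemma ROT_component_graph:
  fixes D :: "'v::finite wograph"
  assumes V: "dverts D = UNIV" and arcs: "\<And>x. f x \<noteq> x \<Longrightarrow> (f x, x) \<in> arcs D"
    and heavy: "\<And>x. f x \<noteq> x \<Longrightarrow> 1 < weight D (f x)" and v: "f v = v"
  shows "ROT D (component_graph f {v}) v"
  unfolding ROT_def
proof (intro conjI ballI impI)
  let ?T = "component_graph f {v}"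
  show "oriented_subgraph ?T D" by (rule oriented_subgraph_component_graph[OF V arcs])
  show "cycles (underlying_graph ?T) = {}" using cycle_component_graph(2)[of _ f "{v}"] by blast
  show "v \<in> dverts ?T" using terminal_fixpoint[of f v] v by (simp add: component_graph_def)
  show "\<exists>p. oriented_path ?T p \<and> hd p = v \<and> last p = x" if "x \<in> dverts ?T - {v}" for x
  proof -
    have "terminal f x = {v}" using that by (simp add: component_graph_def)
    from component_graph_path[OF this] show ?thesis by auto
  qed
  fix x assume x: "x \<in> dverts ?T" and w: "weight D x = 1"
  then have tx: "terminal f x = {v}" by (simp add: component_graph_def)
  show "graph_deg ?T x = 1 \<and> x \<noteq> v \<or> dverts ?T = {v} \<and> x = v"
  proof (cases "x = v")
    case False
    then have "f x \<noteq> x" using terminal_fixpoint[of f x] tx by auto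
    then show ?thesis using component_graph_deg_weight_1[OF heavy tx _ w] False by blast
  next
    case True
    \<comment> \<open>If the root has weight 1, no other vertex maps to it. Tracing an orbit back
      from \<open>v\<close> never leaves \<open>v\<close>, and the component is the single vertex
      \<open>v\<close>.\<close>
    have pull: "y = v" if "(f ^^ k) y = v" for k y
      using that
    proof (induction k)
      case (Suc k)
      have "(f ^^ k) y = v"
      proof (rule ccontr)
        assume "(f ^^ k) y \<noteq> v"
        then have "1 < weight D v" using heavy[of "(f ^^ k) y"] Suc.prems by simp
        then show False using w True by simp
      qed
      then show ?case by (rule Suc.IH)
    qed simp
    have "y = v" if "terminal f y = {v}" for y
      using terminal_orbit[of v f y] that pull by blast
    then have "dverts ?T = {v}" using x True by (auto simp: component_graph_def)
    then show ?thesis using True by blast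
  qed
qed

lemma unicycle_component_graph:
  fixes D :: "'v::finite wograph"
  assumes V: "dverts D = UNIV" and asym: "asym (arcs D)"
    and arcs: "\<And>x. f x \<noteq> x \<Longrightarrow> (f x, x) \<in> arcs D"
    and heavy: "\<And>x. f x \<noteq> x \<Longrightarrow> 1 < weight D (f x)"
    and x: "terminal f x = Q" and nosing: "\<nexists>v. Q = {v}"
  shows "unicycle_oriented_subgraph D (component_graph f Q)"
proof -
  let ?B = "component_graph f Q"
  have sub: "oriented_subgraph ?B D" by (rule oriented_subgraph_component_graph[OF V arcs])
  obtain ys where ys: "oriented_cycle ?B ys" "set ys = Q"
    using component_graph_oriented_cycle[OF x nosing] by blast
  have ne: "ys \<noteq> []" and dist: "distinct ys" and dv: "set ys \<subseteq> dverts ?B"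
    using ys(1) by (auto simp: oriented_cycle_def oriented_path_def)
  have arcD: "(ys ! i, ys ! (Suc i mod length ys)) \<in> arcs D" if "i < length ys" for i
    using oriented_cycle_arc[OF ys(1) that] sub unfolding oriented_subgraph_def by blast
  \<comment> \<open>One or two vertices would give a loop or a pair of opposite arcs, both excluded
    by asymmetry.\<close>
  have "3 \<le> length ys"
  proof (rule ccontr)
    assume "\<not> 3 \<le> length ys"
    moreover have "length ys \<noteq> 0" using ne by simp
    ultimately consider "length ys = 1" | "length ys = 2" by linarith
    then show False
    proof cases
      case 1
      then have "(ys ! 0, ys ! 0) \<in> arcs D" using arcD[of 0] by simp
      then show False using asym by (meson asymD)
    next
      case 2
      then have "(ys ! 0, ys ! 1) \<in> arcs D" "(ys ! 1, ys ! 0) \<in> arcs D"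
        using arcD[of 0] arcD[of 1] by simp_all
      then show False using asym by (meson asymD)
    qed
  qed
  moreover have "edges (cycle_graph ys) \<subseteq> edges (underlying_graph ?B)"
  proof
    fix e assume "e \<in> edges (cycle_graph ys)"
    then obtain i where "i < length ys" "e = {ys ! i, ys ! (Suc i mod length ys)}"
      by (auto simp: cycle_graph_def)
    then show "e \<in> edges (underlying_graph ?B)"
      using oriented_cycle_arc[OF ys(1)] by (simp add: edge_underlying_graph_iff)
  qed
  moreover have "verts (cycle_graph ys) \<subseteq> verts (underlying_graph ?B)"
    using dv by (simp add: cycle_graph_def)
  ultimately have mem: "cycle_graph ys \<in> cycles (underlying_graph ?B)"
    unfolding cycles_def using dist by blast
  then have "cycles (underlying_graph ?B) = {cycle_graph ys}"
    using cycle_component_graph(1)[of _ f Q] by (metis (no_types, lifting) is_singletonI' is_singleton_def empty_iff singletonD)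
  moreover have "\<exists>p. oriented_path ?B p \<and> hd p \<in> verts (cycle_graph ys) \<and> last p = y"
    if "y \<in> dverts ?B - verts (cycle_graph ys)" for y
  proof -
    have "terminal f y = Q" using that by (simp add: component_graph_def)
    from component_graph_path[OF this] show ?thesis using ys(2) by (auto simp: cycle_graph_def)
  qed
  moreover have "graph_deg ?B y = 1" if "y \<in> dverts ?B" "weight D y = 1" for y
  proof (rule component_graph_deg_weight_1[OF heavy])
    show "terminal f y = Q" using that by (simp add: component_graph_def)
    then show "f y \<noteq> y" using nosing terminal_fixpoint[of f y] by metis
  qed (use that in auto)
  ultimately show ?thesis
    unfolding unicycle_oriented_subgraph_def using sub ys(1) by blast
qed

theorem star_semi_forest_of_strong_vertex_cover:
  fixes D :: "'v::finite wograph"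
  assumes D: "weighted_oriented_graph D" and C: "strong_vertex_cover D C" and S: "S \<subseteq> C"
  shows "\<exists>H. star_semi_forest D H \<and> dverts H = S"
proof -
  have V: "dverts D = UNIV" and asym: "asym (arcs D)"
    using D by (auto simp: weighted_oriented_graph_def)
  have loopless: "(x, x) \<notin> arcs D" for x using asym by (meson asymD)
  define good where "good y \<longleftrightarrow> y \<in> C \<and> 1 < weight D y \<and> out_nbrs D y \<subseteq> C" for y
  \<comment> \<open>Witnesses are taken inside \<open>S\<close> whenever possible. The vertices of
    \<open>S\<close> without one there become fixed points, that is roots, and draw their
    \<open>w i\<close> from outside \<open>S\<close>.\<close>
  define f where "f x = (if x \<in> S \<and> (\<exists>y\<in>S. good y \<and> (y, x) \<in> arcs D)
    then SOME y. y \<in> S \<and> good y \<and> (y, x) \<in> arcs D else x)" for x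
  have f: "x \<in> S \<and> f x \<in> S \<and> good (f x) \<and> (f x, x) \<in> arcs D" if "f x \<noteq> x" for x
  proof -
    have ex: "x \<in> S \<and> (\<exists>y\<in>S. good y \<and> (y, x) \<in> arcs D)"
      using that unfolding f_def by meson
    then have "\<exists>y. y \<in> S \<and> good y \<and> (y, x) \<in> arcs D" by blast
    from someI_ex[OF this] ex show ?thesis unfolding f_def by simp
  qed
  have arcs: "(f x, x) \<in> arcs D" if "f x \<noteq> x" for x using f[OF that] by blast
  have heavy: "1 < weight D (f x)" if "f x \<noteq> x" for x using f[OF that] by (simp add: good_def)
  have root: "(\<exists>u. u \<in> nbrs D x \<and> u \<notin> C) \<or> (\<exists>u. u \<notin> S \<and> good u \<and> (u, x) \<in> arcs D)"
    if x: "x \<in> S" "f x = x" for x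
  proof -
    have "\<not> (\<exists>y\<in>S. good y \<and> (y, x) \<in> arcs D)"
    proof
      assume ex: "\<exists>y\<in>S. good y \<and> (y, x) \<in> arcs D"
      then have "\<exists>y. y \<in> S \<and> good y \<and> (y, x) \<in> arcs D" by blast
      from someI_ex[OF this] have "(f x, x) \<in> arcs D" using ex x(1) unfolding f_def by simp
      then show False using x(2) loopless by simp
    qed
    then show ?thesis using C S x unfolding strong_vertex_cover_def good_def by blast
  qed
  \<comment> \<open>The implication merges two cases: a neighbour outside \<open>C\<close>, destined
    for \<open>W\<^sub>1\<close>, and a witness in \<open>C - S\<close>, destined for
    \<open>W\<^sub>2\<close>.\<close>
  have "\<exists>u. u \<in> nbrs D x \<and> (u \<in> C \<longrightarrow> u \<notin> S \<and> good u \<and> (u, x) \<in> arcs D)"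
    if "x \<in> S" "f x = x" for x
    using root[OF that] unfolding nbrs_iff by blast
  then obtain h where h: "\<And>x. x \<in> S \<Longrightarrow> f x = x \<Longrightarrow>
      h x \<in> nbrs D x \<and> (h x \<in> C \<longrightarrow> h x \<notin> S \<and> good (h x) \<and> (h x, x) \<in> arcs D)"
    by metis
  define R where "R = {x \<in> S. f x = x}"
  define \<Q> where "\<Q> = {Q \<in> terminal f ` S. \<nexists>v. Q = {v}}"
  obtain v where v: "bij_betw v {..<card R} R"
    using ex_bij_betw_nat_finite[of R] by (auto simp: atLeast0LessThan)
  obtain q where q: "bij_betw q {..<card \<Q>} \<Q>"
    using ex_bij_betw_nat_finite[of \<Q>] by (auto simp: atLeast0LessThan \<Q>_def)
  define T where "T i = component_graph f {v i}" for i
  define B where "B j = component_graph f (q j)" for j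
  define w where "w i = h (v i)" for i
  define H where "H = \<lparr>dverts = S, arcs = {(f y, y) | y. f y \<noteq> y}\<rparr>"
  have vR: "v i \<in> S" "f (v i) = v i" if "i < card R" for i
    using bij_betwE[OF v] that by (auto simp: R_def)
  have qQ: "q j \<in> \<Q>" if "j < card \<Q>" for j
    using bij_betwE[OF q] that by auto
  have surjv: "\<exists>i<card R. v i = x" if "x \<in> R" for x
    using that v unfolding bij_betw_def by (metis imageE lessThan_iff)
  have surjq: "\<exists>j<card \<Q>. q j = Q" if "Q \<in> \<Q>" for Q
    using that q unfolding bij_betw_def by (metis imageE lessThan_iff)
  have fS: "f x \<in> S \<longleftrightarrow> x \<in> S" for x using f[of x] by (cases "f x = x") auto
  have fkS: "(f ^^ k) x \<in> S \<longleftrightarrow> x \<in> S" for k x by (induction k) (simp_all add: fS)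
  have tS: "y \<in> S \<longleftrightarrow> x \<in> S" if "y \<in> terminal f x" for x y
    using terminal_orbit[OF that] fkS by blast
  have sameS: "y \<in> S" if "terminal f y = terminal f x" "x \<in> S" for x y
    using terminal_nonempty[of f x] tS that by blast
  have dvT: "dverts (T i) = {y. terminal f y = {v i}}" for i by (simp add: T_def component_graph_def)
  have dvB: "dverts (B j) = {y. terminal f y = q j}" for j by (simp add: B_def component_graph_def)
  have arT: "arcs (T i) = {(f y, y) | y. y \<in> dverts (T i) \<and> f y \<noteq> y}" for i
    by (simp add: T_def component_graph_def)
  have arB: "arcs (B j) = {(f y, y) | y. y \<in> dverts (B j) \<and> f y \<noteq> y}" for j
    by (simp add: B_def component_graph_def)
  have dvH: "dverts H = (\<Union>i<card R. dverts (T i)) \<union> (\<Union>j<card \<Q>. dverts (B j))"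
  proof
    show "dverts H \<subseteq> (\<Union>i<card R. dverts (T i)) \<union> (\<Union>j<card \<Q>. dverts (B j))"
    proof
      fix x assume "x \<in> dverts H"
      then have x: "x \<in> S" by (simp add: H_def)
      show "x \<in> (\<Union>i<card R. dverts (T i)) \<union> (\<Union>j<card \<Q>. dverts (B j))"
      proof (cases "\<exists>u. terminal f x = {u}")
        case True
        then obtain u where u: "terminal f x = {u}" by blast
        then have "u \<in> R" using terminal_singleton_fixpoint[OF u] tS[of u x] x by (simp add: R_def)
        then show ?thesis using surjv u by (auto simp: dvT)
      next
        case False
        then have "terminal f x \<in> \<Q>" using x by (simp add: \<Q>_def)
        then obtain j where "j < card \<Q>" "q j = terminal f x" using surjq by blast
        then show ?thesis by (auto simp: dvB)
      qed
    qed
    have "dverts (T i) \<subseteq> S" if "i < card R" for i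
      using sameS[of _ "v i"] vR[OF that] terminal_fixpoint[of f "v i"] by (auto simp: dvT)
    moreover have "dverts (B j) \<subseteq> S" if "j < card \<Q>" for j
      using qQ[OF that] sameS by (auto simp: dvB \<Q>_def)
    ultimately show "(\<Union>i<card R. dverts (T i)) \<union> (\<Union>j<card \<Q>. dverts (B j)) \<subseteq> dverts H"
      by (auto simp: H_def)
  qed
  have arH: "arcs H = (\<Union>i<card R. arcs (T i)) \<union> (\<Union>j<card \<Q>. arcs (B j))"
  proof -
    have "arcs H = {(f y, y) | y. y \<in> dverts H \<and> f y \<noteq> y}" using f by (auto simp: H_def)
    also have "\<dots> = (\<Union>i<card R. {(f y, y) | y. y \<in> dverts (T i) \<and> f y \<noteq> y}) \<union>
        (\<Union>j<card \<Q>. {(f y, y) | y. y \<in> dverts (B j) \<and> f y \<noteq> y})"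
      unfolding dvH by (rule equalityI; rule subsetI) (elim CollectE exE conjE UnE UN_E; blast)+
    finally show ?thesis unfolding arT arB .
  qed
  have subH: "oriented_subgraph H D"
    using V f by (auto simp: oriented_subgraph_def H_def)
  have nbrsH: "y \<in> nbrs H x \<longleftrightarrow> (x = f y \<or> y = f x) \<and> x \<noteq> y" for x y
    unfolding nbrs_iff by (auto simp: H_def)
  \<comment> \<open>A neighbour in \<open>H\<close> other than \<open>f x\<close> is a vertex that
    chose \<open>x\<close>, so \<open>x\<close> is a witness of strength.\<close>
  have child: "good x" if "y \<in> nbrs H x" "y \<noteq> f x" for x y
    using that f[of y] unfolding nbrsH by auto
  define H' where "H' = {x \<in> dverts H. 2 \<le> graph_deg H x} \<union>
    {v i | i. i < card R \<and> graph_deg H (v i) = 1}"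
  have goodH': "good x" if x: "x \<in> H'" for x
  proof -
    \<comment> \<open>Degree two leaves a neighbour besides \<open>f x\<close>; a parent is fixed by
      \<open>f\<close>, so any neighbour of it will do.\<close>
    have "\<exists>y. y \<in> nbrs H x \<and> y \<noteq> f x"
    proof (rule ccontr)
      assume no: "\<not> ?thesis"
      from x consider "2 \<le> graph_deg H x" | i where "x = v i" "i < card R" "graph_deg H x = 1"
        unfolding H'_def by blast
      then show False
      proof cases
        case 1
        have "nbrs H x \<subseteq> {f x}" using no by blast
        then have "card (nbrs H x) \<le> 1" using card_mono[of "{f x}" "nbrs H x"] by simp
        then show False using 1 by (simp add: graph_deg_def)
      next
        case (2 i)
        then have "f x = x" using vR by simp
        then have "nbrs H x = {}" using no unfolding nbrsH by (auto simp: nbrsH)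
        then show False using 2 by (simp add: graph_deg_def)
      qed
    qed
    then show ?thesis using child by blast
  qed
  \<comment> \<open>Splitting by membership in \<open>C\<close> makes \<open>W\<^sub>1\<close>
    stable, being outside a cover, and keeps it away from the out-neighbours of all good
    vertices.\<close>
  define W\<^sub>1 where "W\<^sub>1 = w ` {..<card R} - C"
  define W\<^sub>2 where "W\<^sub>2 = w ` {..<card R} \<inter> C"
  have hw: "w i \<in> nbrs D (v i) \<and> (w i \<in> C \<longrightarrow> w i \<notin> S \<and> good (w i) \<and> (w i, v i) \<in> arcs D)"
    if "i < card R" for i
    using h[OF vR[OF that]] by (simp add: w_def)
  have goodW2: "good x" if "x \<in> W\<^sub>2" for x using that hw by (auto simp: W\<^sub>2_def)
  have "star_semi_forest D H"
    unfolding star_semi_forest_def Let_def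
  proof (rule conjI[OF subH], rule exI[of _ "card R"], rule exI[of _ "card \<Q>"], rule exI[of _ T],
      rule exI[of _ v], rule exI[of _ B], rule exI[of _ w], rule exI[of _ W\<^sub>1],
      rule exI[of _ W\<^sub>2], intro conjI)
    show "\<forall>i<card R. ROT D (T i) (v i)"
      using ROT_component_graph[OF V arcs heavy] vR by (simp add: T_def)
    show "\<forall>j<card \<Q>. unicycle_oriented_subgraph D (B j)"
    proof (intro allI impI)
      fix j assume "j < card \<Q>"
      then obtain x where "terminal f x = q j" "\<nexists>v. q j = {v}"
        using qQ[of j] by (auto simp: \<Q>_def)
      then show "unicycle_oriented_subgraph D (B j)"
        unfolding B_def by (intro unicycle_component_graph[OF V asym arcs heavy])
    qed
    show "dverts H = (\<Union>i<card R. dverts (T i)) \<union> (\<Union>j<card \<Q>. dverts (B j))" by (rule dvH)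
    show "arcs H = (\<Union>i<card R. arcs (T i)) \<union> (\<Union>j<card \<Q>. arcs (B j))" by (rule arH)
    show "disjoint_family_on (\<lambda>i. dverts (T i)) {..<card R}"
      unfolding disjoint_family_on_def dvT using v by (auto simp: bij_betw_def dest: inj_onD)
    show "disjoint_family_on (\<lambda>j. dverts (B j)) {..<card \<Q>}"
    proof -
      have "m = n" if "m < card \<Q>" "n < card \<Q>" "q m = q n" for m n
        using q that unfolding bij_betw_def inj_on_def by blast
      then show ?thesis unfolding disjoint_family_on_def dvB by (simp add: disjoint_iff) blast
    qed
    show "\<forall>i<card R. \<forall>j<card \<Q>. dverts (T i) \<inter> dverts (B j) = {}"
      unfolding dvT dvB using qQ by (force simp: \<Q>_def)
    show "\<forall>i<card R. w i \<in> dverts D - dverts H \<and> w i \<in> nbrs D (v i)"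
    proof (intro allI impI)
      fix i assume "i < card R"
      then show "w i \<in> dverts D - dverts H \<and> w i \<in> nbrs D (v i)"
        using hw[of i] V S by (auto simp: H_def)
    qed
    show "W\<^sub>1 \<union> W\<^sub>2 = w ` {..<card R}" "W\<^sub>1 \<inter> W\<^sub>2 = {}"
      by (auto simp: W\<^sub>1_def W\<^sub>2_def)
    show "stable_set (underlying_graph D) W\<^sub>1"
      using C V unfolding strong_vertex_cover_def vertex_cover_underlying_graph_iff
        stable_set_underlying_graph_iff by (auto simp: W\<^sub>1_def)
    show "W\<^sub>2 \<subseteq> Vplus D" using goodW2 V by (auto simp: Vplus_def good_def)
    show "\<forall>i<card R. w i \<in> W\<^sub>2 \<longrightarrow> (w i, v i) \<in> arcs D"
      using hw by (auto simp: W\<^sub>2_def)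
    have "out_nbrs D x \<subseteq> C" if "x \<in> W\<^sub>2 \<union> H'" for x
      using that goodH' goodW2 by (auto simp: good_def)
    then have "(\<Union>x \<in> W\<^sub>2 \<union> H'. out_nbrs D x) \<inter> W\<^sub>1 = {}" by (auto simp: W\<^sub>1_def)
    then show "(\<Union>x \<in> W\<^sub>2 \<union> ({x \<in> dverts H. 2 \<le> graph_deg H x} \<union>
        {v i | i. i < card R \<and> graph_deg H (v i) = 1}). out_nbrs D x) \<inter> W\<^sub>1 = {}"
      unfolding H'_def .
  qed
  moreover have "dverts H = S" by (simp add: H_def)
  ultimately show ?thesis by blast
qed

section \<open>Monomial ideals\<close>

abbreviation keys :: "('a \<Rightarrow>\<^sub>0 'b::zero) \<Rightarrow> 'a set" where
  "keys \<equiv> Poly_Mapping.keys"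

abbreviation lookup :: "('a \<Rightarrow>\<^sub>0 'b::zero) \<Rightarrow> 'a \<Rightarrow> 'b" where
  "lookup \<equiv> Poly_Mapping.lookup"

section \<open>Ideals and supports in the polynomial ring\<close>

lemma carrier_mpoly_ring [simp]: "carrier mpoly_ring = UNIV"
  and mult_mpoly_ring [simp]: "a \<otimes>\<^bsub>mpoly_ring\<^esub> b = a * b"
  and add_mpoly_ring [simp]: "a \<oplus>\<^bsub>mpoly_ring\<^esub> b = a + b"
  and zero_mpoly_ring [simp]: "\<zero>\<^bsub>mpoly_ring\<^esub> = 0"
  and one_mpoly_ring [simp]: "\<one>\<^bsub>mpoly_ring\<^esub> = 1"
  by (simp_all add: mpoly_ring_def ring_of_type_algebra_def)

lemma cring_mpoly_ring: "cring mpoly_ring"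
  unfolding mpoly_ring_def by (rule cring_from_type_algebra)

lemma ring_mpoly_ring: "ring mpoly_ring"
  unfolding mpoly_ring_def by (rule ring_from_type_algebra)

lemma a_inv_mpoly_ring [simp]: "\<ominus>\<^bsub>mpoly_ring\<^esub> a = - a"
proof -
  interpret cring mpoly_ring by (rule cring_mpoly_ring)
  show ?thesis using minus_equality[of "- a" a] by simp
qed

lemma ideal_mpoly_ring_iff:
  "ideal I mpoly_ring \<longleftrightarrow> 0 \<in> I \<and> (\<forall>a\<in>I. \<forall>b\<in>I. a + b \<in> I) \<and> (\<forall>a\<in>I. \<forall>x. x * a \<in> I)"
proof
  assume "ideal I mpoly_ring"
  then interpret ideal I mpoly_ring .
  show "0 \<in> I \<and> (\<forall>a\<in>I. \<forall>b\<in>I. a + b \<in> I) \<and> (\<forall>a\<in>I. \<forall>x. x * a \<in> I)"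
    using additive_subgroup.zero_closed[OF additive_subgroup_axioms]
      additive_subgroup.a_closed[OF additive_subgroup_axioms] I_l_closed by simp
next
  assume I: "0 \<in> I \<and> (\<forall>a\<in>I. \<forall>b\<in>I. a + b \<in> I) \<and> (\<forall>a\<in>I. \<forall>x. x * a \<in> I)"
  interpret ring mpoly_ring by (rule ring_mpoly_ring)
  show "ideal I mpoly_ring"
  proof (rule idealI[OF ring_mpoly_ring])
    have neg: "- a \<in> I" if "a \<in> I" for a
    proof -
      have "- 1 * a \<in> I" using I that by blast
      then show ?thesis by simp
    qed
    show "subgroup I (add_monoid mpoly_ring)"
    proof (rule add.subgroupI)
      show "I \<noteq> {}" using I by blast
      show "\<ominus>\<^bsub>mpoly_ring\<^esub> a \<in> I" if "a \<in> I" for a using neg that by simp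
    qed (use I in auto)
  qed (use I in \<open>auto simp: mult.commute\<close>)
qed

lemma primeideal_mpoly_ring_iff:
  "primeideal P mpoly_ring \<longleftrightarrow> ideal P mpoly_ring \<and> 1 \<notin> P \<and> (\<forall>a b. a * b \<in> P \<longrightarrow> a \<in> P \<or> b \<in> P)"
proof
  assume "primeideal P mpoly_ring"
  then interpret primeideal P mpoly_ring .
  show "ideal P mpoly_ring \<and> 1 \<notin> P \<and> (\<forall>a b. a * b \<in> P \<longrightarrow> a \<in> P \<or> b \<in> P)"
    using ideal_axioms I_prime I_notcarr one_imp_carrier by auto
next
  assume "ideal P mpoly_ring \<and> 1 \<notin> P \<and> (\<forall>a b. a * b \<in> P \<longrightarrow> a \<in> P \<or> b \<in> P)"
  then show "primeideal P mpoly_ring"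
    by (intro primeidealI[OF _ cring_mpoly_ring]) auto
qed

lemma ideal_add_mem: "ideal I mpoly_ring \<Longrightarrow> a \<in> I \<Longrightarrow> b \<in> I \<Longrightarrow> a + b \<in> I"
  unfolding ideal_mpoly_ring_iff by blast

lemma ideal_mult_mem: "ideal I mpoly_ring \<Longrightarrow> a \<in> I \<Longrightarrow> x * a \<in> I"
  unfolding ideal_mpoly_ring_iff by blast

lemma prime_mult_mem: "primeideal P mpoly_ring \<Longrightarrow> a * b \<in> P \<Longrightarrow> a \<in> P \<or> b \<in> P"
  unfolding primeideal_mpoly_ring_iff by blast

lemma ideal_sum_closed:
  assumes "ideal I mpoly_ring" "\<And>a. a \<in> A \<Longrightarrow> g a \<in> I"
  shows "sum g A \<in> I"
  using assms(2)
  by (induction A rule: infinite_finite_induct) (use assms(1) in \<open>auto simp: ideal_mpoly_ring_iff\<close>)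

lemma prime_power_mem:
  assumes "primeideal P mpoly_ring" "a ^ k \<in> P"
  shows "a \<in> P"
  using assms(2) by (induction k) (use assms(1) in \<open>auto simp: primeideal_mpoly_ring_iff\<close>)

lemma prime_prod_mem:
  assumes "primeideal P mpoly_ring" "finite A" "prod g A \<in> P"
  shows "\<exists>a\<in>A. g a \<in> P"
  using assms(2,3)
  by (induction A rule: finite_induct) (use assms(1) in \<open>auto simp: primeideal_mpoly_ring_iff\<close>)

lemma sum_monomials: "(\<Sum>\<alpha>\<in>keys f. Poly_Mapping.single \<alpha> (lookup f \<alpha>)) = f"
proof (rule poly_mapping_eqI)
  fix k
  show "lookup (\<Sum>\<alpha>\<in>keys f. Poly_Mapping.single \<alpha> (lookup f \<alpha>)) k = lookup f k"
    by (simp add: lookup_sum lookup_single when_def sum.delta' in_keys_iff)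
qed

definition restrict_keys :: "('a \<Rightarrow>\<^sub>0 'b::comm_monoid_add) \<Rightarrow> 'a set \<Rightarrow> ('a \<Rightarrow>\<^sub>0 'b)" where
  "restrict_keys f M = (\<Sum>\<alpha>\<in>keys f \<inter> M. Poly_Mapping.single \<alpha> (lookup f \<alpha>))"

lemma lookup_restrict_keys: "lookup (restrict_keys f M) k = (if k \<in> M then lookup f k else 0)"
  by (simp add: restrict_keys_def lookup_sum lookup_single when_def sum.delta' in_keys_iff)

lemma keys_restrict_keys: "keys (restrict_keys f M) = keys f \<inter> M"
  by (auto simp: in_keys_iff lookup_restrict_keys split: if_splits)

lemma restrict_keys_split: "f = restrict_keys f M + restrict_keys f (- M)"
  by (rule poly_mapping_eqI) (simp add: lookup_add lookup_restrict_keys)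

text \<open>Adding \<open>u\<close> is injective on exponents, so once the \<beta>-term of
  \<open>h\<close> is removed nothing can land on \<open>u + \<beta>\<close>.\<close>

lemma lookup_single_mult:
  fixes h :: "('v, 'k::field) mpoly"
  shows "lookup (Poly_Mapping.single u c * h) (u + \<beta>) = c * lookup h \<beta>"
proof -
  let ?b = "Poly_Mapping.single \<beta> (lookup h \<beta>)"
  have "\<beta> \<notin> keys (h - ?b)" by (simp add: in_keys_iff lookup_minus)
  then have "u + \<beta> \<notin> keys (Poly_Mapping.single u c * (h - ?b))"
    using keys_mult[of "Poly_Mapping.single u c" "h - ?b"] by (auto split: if_splits)
  then have "lookup (Poly_Mapping.single u c * (h - ?b)) (u + \<beta>) = 0"
    by (simp add: in_keys_iff)
  moreover have "Poly_Mapping.single u c * h =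
      Poly_Mapping.single u c * (h - ?b) + Poly_Mapping.single (u + \<beta>) (c * lookup h \<beta>)"
    by (simp add: algebra_simps mult_single)
  ultimately show ?thesis by (simp add: lookup_add)
qed

lemma keys_single_mult:
  fixes h :: "('v, 'k::field) mpoly"
  assumes "c \<noteq> 0"
  shows "keys (Poly_Mapping.single u c * h) = (+) u ` keys h"
proof
  show "keys (Poly_Mapping.single u c * h) \<subseteq> (+) u ` keys h"
    using keys_mult[of "Poly_Mapping.single u c" h] by (auto split: if_splits)
  show "(+) u ` keys h \<subseteq> keys (Poly_Mapping.single u c * h)"
    using assms by (auto simp: in_keys_iff lookup_single_mult)
qed

text \<open>Monomial ideals are given by the exponents of all their monomials instead of by
  generators, so that membership is read off from the support.\<close>

definition monomial_ideal :: "('v \<Rightarrow>\<^sub>0 nat) set \<Rightarrow> ('v, 'k::field) mpoly set" where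
  "monomial_ideal M = {f. keys f \<subseteq> M}"

definition monomial_upset :: "('v \<Rightarrow>\<^sub>0 nat) set \<Rightarrow> bool" where
  "monomial_upset M \<longleftrightarrow> (\<forall>\<alpha>\<in>M. \<forall>\<beta>. \<beta> + \<alpha> \<in> M)"

lemma monomial_upsetD: "monomial_upset M \<Longrightarrow> \<alpha> \<in> M \<Longrightarrow> \<beta> + \<alpha> \<in> M"
  by (simp add: monomial_upset_def)

lemma ideal_monomial_ideal:
  assumes "monomial_upset M"
  shows "ideal (monomial_ideal M) mpoly_ring"
  unfolding ideal_mpoly_ring_iff monomial_ideal_def mem_Collect_eq
proof (intro conjI ballI allI)
  fix a b :: "('a, 'b) mpoly" assume "a \<in> {f. keys f \<subseteq> M}" "b \<in> {f. keys f \<subseteq> M}"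
  then show "keys (a + b) \<subseteq> M" using keys_add[of a b] by blast
next
  fix a x :: "('a, 'b) mpoly" assume "a \<in> {f. keys f \<subseteq> M}"
  then show "keys (x * a) \<subseteq> M"
    using keys_mult[of x a] monomial_upsetD[OF assms] by blast
qed simp

text \<open>Mixed radix: the exponent of \<open>a\<close> is the last digit in a base
  \<open>b\<close> above all its values on \<open>F\<close>, and the weights of the other variables
  are multiplied by \<open>b\<close>.\<close>

lemma separating_weights_on:
  fixes F :: "('v \<Rightarrow>\<^sub>0 nat) set"
  assumes "finite F" "finite A"
  shows "\<exists>c. \<forall>\<alpha>\<in>F. \<forall>\<beta>\<in>F. (\<Sum>v\<in>A. c v * lookup \<alpha> v) = (\<Sum>v\<in>A. c v * lookup \<beta> v) \<longrightarrow>
    (\<forall>v\<in>A. lookup \<alpha> v = lookup \<beta> v)"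
  using assms(2)
proof (induction A rule: finite_induct)
  case (insert a A)
  then obtain c where c: "\<forall>\<alpha>\<in>F. \<forall>\<beta>\<in>F. (\<Sum>v\<in>A. c v * lookup \<alpha> v) = (\<Sum>v\<in>A. c v * lookup \<beta> v) \<longrightarrow>
    (\<forall>v\<in>A. lookup \<alpha> v = lookup \<beta> v)" by blast
  obtain b where b: "\<forall>\<alpha>\<in>F. lookup \<alpha> a < b"
  proof -
    have "finite ((\<lambda>\<alpha>. lookup \<alpha> a) ` F)" using assms(1) by simp
    then show ?thesis using that finite_nat_set_iff_bounded by auto
  qed
  define c' where "c' v = (if v = a then 1 else b * c v)" for v
  have sum: "(\<Sum>v\<in>insert a A. c' v * lookup \<alpha> v) = lookup \<alpha> a + b * (\<Sum>v\<in>A. c v * lookup \<alpha> v)" for \<alpha>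
  proof -
    have "(\<Sum>v\<in>A. c' v * lookup \<alpha> v) = (\<Sum>v\<in>A. b * (c v * lookup \<alpha> v))"
      using insert.hyps by (intro sum.cong) (auto simp: c'_def)
    then show ?thesis using insert.hyps by (simp add: c'_def sum_distrib_left)
  qed
  show ?case
  proof (rule exI[of _ c'], intro ballI impI)
    fix \<alpha> \<beta> v assume F: "\<alpha> \<in> F" "\<beta> \<in> F" and v: "v \<in> insert a A"
      and "(\<Sum>v\<in>insert a A. c' v * lookup \<alpha> v) = (\<Sum>v\<in>insert a A. c' v * lookup \<beta> v)"
    then have eq: "lookup \<alpha> a + b * (\<Sum>v\<in>A. c v * lookup \<alpha> v) =
        lookup \<beta> a + b * (\<Sum>v\<in>A. c v * lookup \<beta> v)" by (simp only: sum)
    have lt: "lookup \<alpha> a < b" "lookup \<beta> a < b" using b F by auto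
    have "lookup \<alpha> a = lookup \<beta> a" using arg_cong[OF eq, of "\<lambda>n. n mod b"] lt by simp
    moreover from this have "(\<Sum>v\<in>A. c v * lookup \<alpha> v) = (\<Sum>v\<in>A. c v * lookup \<beta> v)"
      using eq lt by simp
    ultimately show "lookup \<alpha> v = lookup \<beta> v" using c F v by blast
  qed
qed simp

definition additive_weight :: "(('v \<Rightarrow>\<^sub>0 nat) \<Rightarrow> nat) \<Rightarrow> bool" where
  "additive_weight \<phi> \<longleftrightarrow> (\<forall>\<alpha> \<beta>. \<phi> (\<alpha> + \<beta>) = \<phi> \<alpha> + \<phi> \<beta>)"

text \<open>Such a weight stands in for a monomial order: injectivity on one finite support is
  enough for a unique leading monomial.\<close>

lemma separating_weight_exists:
  fixes F :: "('v::finite \<Rightarrow>\<^sub>0 nat) set"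
  assumes "finite F"
  shows "\<exists>\<phi>. additive_weight \<phi> \<and> inj_on \<phi> F"
proof -
  obtain c where c: "\<forall>\<alpha>\<in>F. \<forall>\<beta>\<in>F.
    (\<Sum>v\<in>UNIV. c v * lookup \<alpha> v) = (\<Sum>v\<in>UNIV. c v * lookup \<beta> v) \<longrightarrow>
    (\<forall>v\<in>UNIV. lookup \<alpha> v = lookup \<beta> v)"
    using separating_weights_on[OF assms, of UNIV] by auto
  have "additive_weight (\<lambda>\<alpha>. \<Sum>v\<in>UNIV. c v * lookup \<alpha> v)"
    by (simp add: additive_weight_def lookup_add algebra_simps sum.distrib)
  moreover have "inj_on (\<lambda>\<alpha>. \<Sum>v\<in>UNIV. c v * lookup \<alpha> v) F"
    using c by (intro inj_onI poly_mapping_eqI) blast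
  ultimately show ?thesis by blast
qed

lemma max_weight_key_exists:
  assumes "f \<noteq> 0"
  shows "\<exists>\<alpha>\<in>keys f. \<forall>\<beta>\<in>keys f. \<phi> \<beta> \<le> (\<phi> \<alpha> :: nat)"
proof -
  have "Max (\<phi> ` keys f) \<in> \<phi> ` keys f" using assms by (intro Max_in) auto
  then obtain \<alpha> where "\<alpha> \<in> keys f" "\<phi> \<alpha> = Max (\<phi> ` keys f)" by auto
  then show ?thesis by (intro bexI[of _ \<alpha>]) auto
qed

text \<open>Any other way of obtaining the exponent \<open>u + \<beta>\<close> would use a key of
  \<open>g\<close> of strictly smaller weight than \<open>u\<close>, so nothing cancels. For
  \<open>h\<close> a key of maximal weight suffices, unique or not.\<close>

lemma max_weight_key_mult:
  fixes g h :: "('v, 'k::field) mpoly"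
  assumes \<phi>: "additive_weight \<phi>" "inj_on \<phi> (keys g)"
    and u: "u \<in> keys g" "\<And>\<alpha>. \<alpha> \<in> keys g \<Longrightarrow> \<phi> \<alpha> \<le> \<phi> u"
    and b: "\<beta> \<in> keys h" "\<And>\<alpha>. \<alpha> \<in> keys h \<Longrightarrow> \<phi> \<alpha> \<le> \<phi> \<beta>"
  shows "u + \<beta> \<in> keys (g * h)"
proof -
  let ?s = "Poly_Mapping.single u (lookup g u)"
  have "u + \<beta> \<notin> keys ((g - ?s) * h)"
  proof
    assume "u + \<beta> \<in> keys ((g - ?s) * h)"
    then obtain \<alpha> \<gamma> where \<alpha>: "\<alpha> \<in> keys (g - ?s)" and \<gamma>: "\<gamma> \<in> keys h" and eq: "u + \<beta> = \<alpha> + \<gamma>"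
      using keys_mult[of "g - ?s" h] by blast
    have "\<alpha> \<noteq> u" "\<alpha> \<in> keys g"
      using \<alpha> by (auto simp: in_keys_iff lookup_minus lookup_single when_def split: if_splits)
    then have "\<phi> \<alpha> < \<phi> u" using u \<phi>(2) by (metis inj_onD nat_less_le)
    moreover have "\<phi> \<gamma> \<le> \<phi> \<beta>" using b \<gamma> by blast
    moreover have "\<phi> u + \<phi> \<beta> = \<phi> \<alpha> + \<phi> \<gamma>" using eq \<phi>(1) unfolding additive_weight_def by metis
    ultimately show False by linarith
  qed
  then have "lookup ((g - ?s) * h) (u + \<beta>) = 0" by (simp add: in_keys_iff)
  moreover have "g * h = (g - ?s) * h + ?s * h" by (simp add: algebra_simps)
  ultimately have "lookup (g * h) (u + \<beta>) = lookup g u * lookup h \<beta>"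
    by (simp only: lookup_add lookup_single_mult add_0)
  then show ?thesis using u(1) b(1) by (simp add: in_keys_iff)
qed

text \<open>Exponents of the monomials in the ideal generated by the variables in \<open>C\<close>;
  \<open>var_ideal C\<close> is that ideal.\<close>

definition var_monomials :: "'v set \<Rightarrow> ('v \<Rightarrow>\<^sub>0 nat) set" where
  "var_monomials C = {\<alpha>. \<exists>x\<in>C. 0 < lookup \<alpha> x}"

abbreviation var_ideal :: "'v set \<Rightarrow> ('v, 'k::field) mpoly set" where
  "var_ideal C \<equiv> monomial_ideal (var_monomials C)"

lemma var_monomials_add_iff: "\<alpha> + \<beta> \<in> var_monomials C \<longleftrightarrow> \<alpha> \<in> var_monomials C \<or> \<beta> \<in> var_monomials C"
  by (auto simp: var_monomials_def lookup_add)

lemma monomial_upset_var_monomials: "monomial_upset (var_monomials C)"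
  by (simp add: monomial_upset_def var_monomials_add_iff)

text \<open>After the terms in the ideal are discarded from both factors, the leading monomials of
  the remainders involve no variable of \<open>C\<close>. Neither does their product, which survives
  in the product of the remainders.\<close>

lemma primeideal_var_ideal:
  "primeideal (var_ideal C :: ('v::finite, 'k::field) mpoly set) mpoly_ring"
proof -
  let ?P = "var_ideal C :: ('v, 'k) mpoly set"
  let ?M = "var_monomials C"
  have id: "ideal ?P mpoly_ring" by (rule ideal_monomial_ideal[OF monomial_upset_var_monomials])
  have one: "1 \<notin> ?P" by (simp add: monomial_ideal_def var_monomials_def)
  have prime: "a \<in> ?P \<or> b \<in> ?P" if ab: "a * b \<in> ?P" for a b
  proof (rule ccontr)
    assume "\<not> ?thesis"
    then have ne: "\<not> keys a \<subseteq> ?M" "\<not> keys b \<subseteq> ?M" by (auto simp: monomial_ideal_def)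
    define a0 a1 b0 b1 where "a0 = restrict_keys a (- ?M)" "a1 = restrict_keys a ?M"
      and "b0 = restrict_keys b (- ?M)" "b1 = restrict_keys b ?M"
    note defs = this
    have "keys a0 \<noteq> {}" "keys b0 \<noteq> {}" using ne unfolding defs keys_restrict_keys by blast+
    then have nz: "a0 \<noteq> 0" "b0 \<noteq> 0" by auto
    have in1: "a1 \<in> ?P" "b1 \<in> ?P"
      unfolding monomial_ideal_def defs mem_Collect_eq keys_restrict_keys by blast+
    have "a = a1 + a0" "b = b1 + b0" unfolding defs by (rule restrict_keys_split)+
    then have "a0 * b0 = a * b + ((- a0) * b1 + (- b) * a1)" by (simp add: algebra_simps)
    moreover have "(- a0) * b1 \<in> ?P" "(- b) * a1 \<in> ?P"
      using id in1 unfolding ideal_mpoly_ring_iff by blast+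
    then have "(- a0) * b1 + (- b) * a1 \<in> ?P" using id unfolding ideal_mpoly_ring_iff by blast
    ultimately have mem: "a0 * b0 \<in> ?P" using id ab unfolding ideal_mpoly_ring_iff by metis
    obtain \<phi> where \<phi>: "additive_weight \<phi>" "inj_on \<phi> (keys a0)"
      using separating_weight_exists[of "keys a0"] by auto
    obtain \<alpha> where \<alpha>: "\<alpha> \<in> keys a0" "\<forall>\<gamma>\<in>keys a0. \<phi> \<gamma> \<le> \<phi> \<alpha>"
      using max_weight_key_exists[OF nz(1), of \<phi>] by blast
    obtain \<beta> where \<beta>: "\<beta> \<in> keys b0" "\<forall>\<gamma>\<in>keys b0. \<phi> \<gamma> \<le> \<phi> \<beta>"
      using max_weight_key_exists[OF nz(2), of \<phi>] by blast
    have "\<alpha> + \<beta> \<in> keys (a0 * b0)" using max_weight_key_mult[OF \<phi>] \<alpha> \<beta> by blast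
    then have "\<alpha> + \<beta> \<in> ?M" using mem by (auto simp: monomial_ideal_def)
    moreover have "\<alpha> \<notin> ?M" "\<beta> \<notin> ?M" using \<alpha>(1) \<beta>(1) unfolding defs keys_restrict_keys by blast+
    ultimately show False by (simp add: var_monomials_add_iff)
  qed
  show ?thesis unfolding primeideal_mpoly_ring_iff using id one prime by blast
qed

section \<open>Associated primes of the edge ideal\<close>

lemma mvar_power: "mvar x ^ n = (Poly_Mapping.single (Poly_Mapping.single x n) 1 :: ('v, 'k::field) mpoly)"
  by (induction n) (simp_all add: mvar_def mult_single single_add[symmetric])

lemma single_monomial_eq_prod_mvar:
  fixes \<alpha> :: "'v::finite \<Rightarrow>\<^sub>0 nat"
  shows "Poly_Mapping.single \<alpha> (1::'k::field) = (\<Prod>x\<in>UNIV. mvar x ^ lookup \<alpha> x)"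
proof -
  have "(\<Prod>x\<in>A. mvar x ^ n x) =
      (Poly_Mapping.single (\<Sum>x\<in>A. Poly_Mapping.single x (n x)) 1 :: ('v, 'k) mpoly)"
    if "finite A" for A n
    using that by (induction A rule: finite_induct) (simp_all add: mvar_power mult_single)
  from this[of UNIV "lookup \<alpha>"]
  have "(\<Prod>x\<in>UNIV. mvar x ^ lookup \<alpha> x) =
      (Poly_Mapping.single (\<Sum>x\<in>UNIV. Poly_Mapping.single x (lookup \<alpha> x)) 1 :: ('v, 'k) mpoly)"
    by simp
  moreover have "(\<Sum>x\<in>UNIV. Poly_Mapping.single x (lookup \<alpha> x)) = \<alpha>"
    by (rule poly_mapping_eqI) (simp add: lookup_sum lookup_single when_def)
  ultimately show ?thesis by simp
qed

lemma single_eq_scaled_monomial: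
  "Poly_Mapping.single \<alpha> c = Poly_Mapping.single 0 c * (Poly_Mapping.single \<alpha> 1 :: ('v, 'k::field) mpoly)"
  by (simp add: mult_single)

lemma ideal_mem_if_monomials_mem:
  fixes g :: "('v, 'k::field) mpoly"
  assumes "ideal I mpoly_ring" "\<And>\<alpha>. \<alpha> \<in> keys g \<Longrightarrow> Poly_Mapping.single \<alpha> 1 \<in> I"
  shows "g \<in> I"
proof -
  have "(\<Sum>\<alpha>\<in>keys g. Poly_Mapping.single \<alpha> (lookup g \<alpha>)) \<in> I"
  proof (rule ideal_sum_closed[OF assms(1)])
    fix \<alpha> assume "\<alpha> \<in> keys g"
    then show "Poly_Mapping.single \<alpha> (lookup g \<alpha>) \<in> I"
      using assms unfolding ideal_mpoly_ring_iff single_eq_scaled_monomial[of \<alpha> "lookup g \<alpha>"] by blast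
  qed
  then show ?thesis by (simp only: sum_monomials)
qed

text \<open>If \<open>g h\<close> lies in a monomial ideal then so does the product of the leading monomials, so
  multiplying \<open>h\<close> by the leading monomial of \<open>g\<close> kills a term of \<open>h\<close>.\<close>

lemma leading_monomial_power_annihilates:
  fixes g h :: "('v, 'k::field) mpoly"
  assumes M: "monomial_upset M"
    and \<phi>: "additive_weight \<phi>" "inj_on \<phi> (keys g)"
    and u: "u \<in> keys g" "\<And>\<alpha>. \<alpha> \<in> keys g \<Longrightarrow> \<phi> \<alpha> \<le> \<phi> u"
    and "g * h \<in> monomial_ideal M"
  shows "\<exists>k. Poly_Mapping.single u 1 ^ k * h \<in> monomial_ideal M"
  using assms(6)
proof (induction "card (keys h - M)" arbitrary: h rule: less_induct)
  case less
  let ?I = "monomial_ideal M :: ('v, 'k) mpoly set"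
  let ?u = "Poly_Mapping.single u 1 :: ('v, 'k) mpoly"
  have id: "ideal ?I mpoly_ring" by (rule ideal_monomial_ideal[OF M])
  define h0 h1 where "h0 = restrict_keys h (- M)" and "h1 = restrict_keys h M"
  have split: "h = h1 + h0" unfolding h0_def h1_def by (rule restrict_keys_split)
  have keys0: "keys h0 = keys h - M" unfolding h0_def keys_restrict_keys by blast
  have h1: "h1 \<in> ?I" unfolding h1_def monomial_ideal_def mem_Collect_eq keys_restrict_keys by blast
  have mult1: "x * h1 \<in> ?I" for x using id h1 unfolding ideal_mpoly_ring_iff by blast
  have "g * h0 = g * h + (- g) * h1" using split by (simp add: algebra_simps)
  then have gh0: "g * h0 \<in> ?I" using id less.prems mult1[of "- g"] unfolding ideal_mpoly_ring_iff by metis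
  show ?case
  proof (cases "h0 = 0")
    case True
    then have "?u ^ 0 * h \<in> ?I" using split h1 by simp
    then show ?thesis by blast
  next
    case False
    obtain \<beta> where \<beta>: "\<beta> \<in> keys h0" "\<forall>\<gamma>\<in>keys h0. \<phi> \<gamma> \<le> \<phi> \<beta>"
      using max_weight_key_exists[OF False, of \<phi>] by blast
    have "u + \<beta> \<in> keys (g * h0)" using max_weight_key_mult[OF \<phi> u \<beta>(1)] \<beta>(2) by blast
    then have ub: "u + \<beta> \<in> M" using gh0 by (auto simp: monomial_ideal_def)
    have "keys (?u * h0) - M \<subseteq> (+) u ` (keys h0 - {\<beta>})"
      using ub by (auto simp: keys_single_mult)
    then have "card (keys (?u * h0) - M) \<le> card ((+) u ` (keys h0 - {\<beta>}))"
      by (intro card_mono) auto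
    also have "\<dots> \<le> card (keys h0 - {\<beta>})" by (intro card_image_le) auto
    also have "\<dots> < card (keys h0)" using \<beta>(1) by (intro psubset_card_mono) auto
    finally have "card (keys (?u * h0) - M) < card (keys h - M)" by (simp only: keys0)
    moreover have "g * (?u * h0) \<in> ?I"
    proof -
      have "?u * (g * h0) \<in> ?I" using id gh0 unfolding ideal_mpoly_ring_iff by blast
      then show ?thesis by (simp only: mult.left_commute)
    qed
    ultimately obtain k where "?u ^ k * (?u * h0) \<in> ?I" using less.hyps by blast
    then have "?u ^ Suc k * h0 \<in> ?I" by (simp only: power_Suc2 mult.assoc)
    moreover have "?u ^ Suc k * h = ?u ^ Suc k * h1 + ?u ^ Suc k * h0"
      using split by (simp only: distrib_left)
    ultimately have "?u ^ Suc k * h \<in> ?I"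
      using id mult1[of "?u ^ Suc k"] unfolding ideal_mpoly_ring_iff by metis
    then show ?thesis by blast
  qed
qed

text \<open>A power of the leading monomial of \<open>g\<close> multiplies \<open>f\<close> into the
  monomial ideal, so by primeness that monomial lies in \<open>P\<close>; subtracting the leading
  term leaves a shorter polynomial in \<open>P\<close>.\<close>

lemma associated_prime_monomials_mem:
  fixes f g :: "('v::finite, 'k::field) mpoly"
  assumes M: "monomial_upset M" and P: "primeideal P mpoly_ring"
    and Pf: "P = {g. g * f \<in> monomial_ideal M}" and "g \<in> P" "\<alpha> \<in> keys g"
  shows "Poly_Mapping.single \<alpha> 1 \<in> P"
  using assms(4,5)
proof (induction "card (keys g)" arbitrary: g rule: less_induct)
  case less
  have id: "ideal P mpoly_ring" using P unfolding primeideal_mpoly_ring_iff by blast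
  have "g \<noteq> 0" using less.prems by auto
  obtain \<phi> where \<phi>: "additive_weight \<phi>" "inj_on \<phi> (keys g)"
    using separating_weight_exists[of "keys g"] by auto
  obtain u where u: "u \<in> keys g" "\<forall>\<gamma>\<in>keys g. \<phi> \<gamma> \<le> \<phi> u"
    using max_weight_key_exists[OF \<open>g \<noteq> 0\<close>, of \<phi>] by blast
  have "g * f \<in> monomial_ideal M" using less.prems Pf by blast
  then obtain k where "Poly_Mapping.single u 1 ^ k * f \<in> monomial_ideal M"
    using leading_monomial_power_annihilates[OF M \<phi> u(1)] u(2) by blast
  then have "Poly_Mapping.single u 1 ^ k \<in> P" using Pf by blast
  then have uP: "Poly_Mapping.single u 1 \<in> P" by (rule prime_power_mem[OF P])
  show ?case
  proof (cases "\<alpha> = u")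
    case True
    then show ?thesis using uP by simp
  next
    case False
    define g' where "g' = g - Poly_Mapping.single u (lookup g u)"
    have look: "lookup g' k = (if k = u then 0 else lookup g k)" for k
      by (simp add: g'_def lookup_minus lookup_single when_def)
    then have keys': "keys g' = keys g - {u}" by (auto simp: in_keys_iff split: if_splits)
    have "Poly_Mapping.single 0 (- lookup g u) * Poly_Mapping.single u 1 \<in> P"
      using id uP unfolding ideal_mpoly_ring_iff by blast
    moreover have "g' = g + Poly_Mapping.single 0 (- lookup g u) * Poly_Mapping.single u 1"
      by (simp add: g'_def mult_single single_uminus)
    ultimately have "g' \<in> P" using id less.prems(1) unfolding ideal_mpoly_ring_iff by metis
    moreover have "card (keys g') < card (keys g)"
      unfolding keys' using u(1) by (intro psubset_card_mono) auto
    moreover have "\<alpha> \<in> keys g'" using keys' less.prems(2) False by blast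
    ultimately show ?thesis using less.hyps by blast
  qed
qed

text \<open>A monomial is a product of variables, so a prime contains it exactly if it contains a
  variable dividing it.\<close>

lemma associated_prime_var_ideal:
  fixes f :: "('v::finite, 'k::field) mpoly"
  assumes M: "monomial_upset M" and P: "primeideal P mpoly_ring"
    and Pf: "P = {g. g * f \<in> monomial_ideal M}"
  shows "P = var_ideal {x. mvar x \<in> P}"
proof -
  let ?C = "{x. mvar x \<in> P}"
  have id: "ideal P mpoly_ring" using P unfolding primeideal_mpoly_ring_iff by blast
  have mon: "Poly_Mapping.single \<alpha> 1 \<in> P \<longleftrightarrow> \<alpha> \<in> var_monomials ?C" for \<alpha>
  proof
    assume "Poly_Mapping.single \<alpha> 1 \<in> P"
    then have "(\<Prod>x\<in>UNIV. mvar x ^ lookup \<alpha> x) \<in> P" by (simp only: single_monomial_eq_prod_mvar)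
    then obtain x where x: "mvar x ^ lookup \<alpha> x \<in> P" using prime_prod_mem[OF P finite_class.finite_UNIV] by blast
    then have "lookup \<alpha> x \<noteq> 0" using P unfolding primeideal_mpoly_ring_iff by (metis power_0)
    moreover have "mvar x \<in> P" using prime_power_mem[OF P x] .
    ultimately show "\<alpha> \<in> var_monomials ?C" by (auto simp: var_monomials_def)
  next
    assume "\<alpha> \<in> var_monomials ?C"
    then obtain x where x: "mvar x \<in> P" "0 < lookup \<alpha> x" by (auto simp: var_monomials_def)
    have "\<alpha> = (\<alpha> - Poly_Mapping.single x 1) + Poly_Mapping.single x 1"
      using x(2) by (intro poly_mapping_eqI) (auto simp: lookup_add lookup_minus lookup_single when_def)
    then have "Poly_Mapping.single \<alpha> 1 =
        Poly_Mapping.single (\<alpha> - Poly_Mapping.single x 1) 1 * (mvar x :: ('v, 'k) mpoly)"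
      by (simp add: mvar_def mult_single)
    then show "Poly_Mapping.single \<alpha> 1 \<in> P"
      using id x(1) unfolding ideal_mpoly_ring_iff by metis
  qed
  show ?thesis
  proof
    show "P \<subseteq> var_ideal ?C"
      using associated_prime_monomials_mem[OF M P Pf] mon by (auto simp: monomial_ideal_def)
    show "var_ideal ?C \<subseteq> P"
      using ideal_mem_if_monomials_mem[OF id] mon by (auto simp: monomial_ideal_def)
  qed
qed

text \<open>The polynomial \<open>f\<close> can be replaced by one of its monomials:
  \<open>P\<close> is the intersection of the colon ideals of the monomials of \<open>f\<close>, and
  a prime that is a finite intersection of ideals equals one of them.\<close>

lemma associated_primes_monomial_ideal:
  assumes M: "monomial_upset M"
  shows "associated_primes mpoly_ring (monomial_ideal M :: ('v::finite, 'k::field) mpoly set) =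
    {var_ideal C | C. \<exists>\<alpha>. \<forall>\<beta>. \<alpha> + \<beta> \<in> M \<longleftrightarrow> \<beta> \<in> var_monomials C}"
proof
  show "associated_primes mpoly_ring (monomial_ideal M :: ('v, 'k) mpoly set) \<subseteq>
    {var_ideal C | C. \<exists>\<alpha>. \<forall>\<beta>. \<alpha> + \<beta> \<in> M \<longleftrightarrow> \<beta> \<in> var_monomials C}"
  proof
    fix P assume "P \<in> associated_primes mpoly_ring (monomial_ideal M :: ('v, 'k) mpoly set)"
    then obtain f where P: "primeideal P mpoly_ring" and Pf: "P = {g. g * f \<in> monomial_ideal M}"
      by (auto simp: associated_primes_def)
    define C where "C = {x. mvar x \<in> P}"
    have PC: "P = var_ideal C" unfolding C_def by (rule associated_prime_var_ideal[OF M P Pf])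
    have keysf: "keys (Poly_Mapping.single \<beta> 1 * f) = (+) \<beta> ` keys f" for \<beta>
      by (rule keys_single_mult) simp
    have mem: "\<beta> \<in> var_monomials C \<longleftrightarrow> (\<forall>\<alpha>\<in>keys f. \<beta> + \<alpha> \<in> M)" for \<beta>
    proof -
      have "\<beta> \<in> var_monomials C \<longleftrightarrow> Poly_Mapping.single \<beta> 1 \<in> P"
        unfolding PC by (simp add: monomial_ideal_def)
      also have "\<dots> \<longleftrightarrow> Poly_Mapping.single \<beta> 1 * f \<in> monomial_ideal M" using Pf by blast
      finally show ?thesis by (auto simp: monomial_ideal_def keysf)
    qed
    \<comment> \<open>Otherwise each key \<alpha> has a multiplier \<open>b \<alpha>\<close> outside
      the prime. Their product moves every key into \<open>M\<close>, so it lies in the prime, and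
      one of the factors must involve a variable of \<open>C\<close>.\<close>
    have "\<exists>\<alpha>\<in>keys f. \<forall>\<beta>. \<beta> + \<alpha> \<in> M \<longrightarrow> \<beta> \<in> var_monomials C"
    proof (rule ccontr)
      assume "\<not> ?thesis"
      then obtain b where b: "\<And>\<alpha>. \<alpha> \<in> keys f \<Longrightarrow> b \<alpha> + \<alpha> \<in> M"
        and nb: "\<And>\<alpha>. \<alpha> \<in> keys f \<Longrightarrow> b \<alpha> \<notin> var_monomials C"
        by metis
      have "(\<Sum>\<gamma>\<in>keys f. b \<gamma>) + \<alpha> \<in> M" if "\<alpha> \<in> keys f" for \<alpha>
      proof -
        have "(\<Sum>\<gamma>\<in>keys f. b \<gamma>) + \<alpha> = (\<Sum>\<gamma>\<in>keys f - {\<alpha>}. b \<gamma>) + (b \<alpha> + \<alpha>)"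
          using that by (simp add: sum.remove[of "keys f" \<alpha>] ac_simps)
        then show ?thesis using monomial_upsetD[OF M b[OF that]] by simp
      qed
      then have "(\<Sum>\<gamma>\<in>keys f. b \<gamma>) \<in> var_monomials C" unfolding mem by blast
      then obtain x where x: "x \<in> C" "0 < (\<Sum>\<gamma>\<in>keys f. lookup (b \<gamma>) x)"
        by (auto simp: var_monomials_def lookup_sum)
      then obtain \<gamma> where "\<gamma> \<in> keys f" "0 < lookup (b \<gamma>) x"
        by (metis less_numeral_extra(3) not_gr_zero sum.neutral)
      then show False using nb x(1) by (auto simp: var_monomials_def)
    qed
    then obtain \<alpha> where "\<alpha> \<in> keys f" "\<forall>\<beta>. \<beta> + \<alpha> \<in> M \<longrightarrow> \<beta> \<in> var_monomials C" by blast
    then have "\<forall>\<beta>. \<alpha> + \<beta> \<in> M \<longleftrightarrow> \<beta> \<in> var_monomials C" using mem by (metis add.commute)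
    then show "P \<in> {var_ideal C | C. \<exists>\<alpha>. \<forall>\<beta>. \<alpha> + \<beta> \<in> M \<longleftrightarrow> \<beta> \<in> var_monomials C}"
      using PC by blast
  qed
  show "{var_ideal C | C. \<exists>\<alpha>. \<forall>\<beta>. \<alpha> + \<beta> \<in> M \<longleftrightarrow> \<beta> \<in> var_monomials C} \<subseteq>
    associated_primes mpoly_ring (monomial_ideal M :: ('v, 'k) mpoly set)"
  proof
    fix P :: "('v, 'k) mpoly set"
    assume "P \<in> {var_ideal C | C. \<exists>\<alpha>. \<forall>\<beta>. \<alpha> + \<beta> \<in> M \<longleftrightarrow> \<beta> \<in> var_monomials C}"
    then obtain C \<alpha> where P: "P = var_ideal C" and \<alpha>: "\<And>\<beta>. \<alpha> + \<beta> \<in> M \<longleftrightarrow> \<beta> \<in> var_monomials C"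
      by blast
    have "g * Poly_Mapping.single \<alpha> 1 \<in> monomial_ideal M \<longleftrightarrow> g \<in> P" for g :: "('v, 'k) mpoly"
    proof -
      have "keys (g * Poly_Mapping.single \<alpha> 1) = (+) \<alpha> ` keys g"
        using keys_single_mult[of "1::'k" \<alpha> g] by (simp add: mult.commute)
      then show ?thesis unfolding P monomial_ideal_def using \<alpha> by auto
    qed
    then have "P = {g \<in> carrier mpoly_ring. g \<otimes>\<^bsub>mpoly_ring\<^esub> Poly_Mapping.single \<alpha> 1 \<in> monomial_ideal M}"
      by auto
    moreover have "primeideal P mpoly_ring" unfolding P by (rule primeideal_var_ideal)
    ultimately show "P \<in> associated_primes mpoly_ring (monomial_ideal M :: ('v, 'k) mpoly set)"
      unfolding associated_primes_def mem_Collect_eq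
      by (intro conjI bexI[of _ "Poly_Mapping.single \<alpha> 1"]) simp_all
  qed
qed

definition edge_monomials :: "'v wograph \<Rightarrow> ('v \<Rightarrow>\<^sub>0 nat) set" where
  "edge_monomials D = {\<alpha>. \<exists>x y. (x, y) \<in> arcs D \<and> 1 \<le> lookup \<alpha> x \<and> weight D y \<le> lookup \<alpha> y}"

lemma monomial_upset_edge_monomials: "monomial_upset (edge_monomials D)"
  unfolding monomial_upset_def edge_monomials_def by (fastforce simp: lookup_add)

lemma edge_ideal_eq_monomial_ideal:
  assumes loopless: "\<And>x. (x, x) \<notin> arcs D"
  shows "edge_ideal D = (monomial_ideal (edge_monomials D) :: ('v, 'k::field) mpoly set)"
proof -
  interpret ring "mpoly_ring :: ('v, 'k) mpoly ring" by (rule ring_mpoly_ring)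
  let ?G = "{mvar x * mvar y ^ weight D y | x y. (x, y) \<in> arcs D} :: ('v, 'k) mpoly set"
  have gen: "mvar x * mvar y ^ weight D y =
      (Poly_Mapping.single (Poly_Mapping.single x 1 + Poly_Mapping.single y (weight D y)) 1 :: ('v, 'k) mpoly)"
    for x y
    unfolding mvar_power by (simp add: mvar_def mult_single)
  have id: "ideal (edge_ideal D :: ('v, 'k) mpoly set) mpoly_ring"
    unfolding edge_ideal_def by (rule genideal_ideal) simp
  show ?thesis
  proof
    have "?G \<subseteq> monomial_ideal (edge_monomials D)"
    proof
      fix g assume "g \<in> ?G"
      then obtain x y where xy: "(x, y) \<in> arcs D" and g: "g = mvar x * mvar y ^ weight D y" by blast
      have "Poly_Mapping.single x 1 + Poly_Mapping.single y (weight D y) \<in> edge_monomials D"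
        unfolding edge_monomials_def mem_Collect_eq using xy
        by (rule_tac x = x in exI, rule_tac x = y in exI) (simp add: lookup_add)
      then show "g \<in> monomial_ideal (edge_monomials D)" unfolding g gen by (simp add: monomial_ideal_def)
    qed
    then show "edge_ideal D \<subseteq> (monomial_ideal (edge_monomials D) :: ('v, 'k) mpoly set)"
      unfolding edge_ideal_def
      by (rule genideal_minimal[OF ideal_monomial_ideal[OF monomial_upset_edge_monomials]])
    show "(monomial_ideal (edge_monomials D) :: ('v, 'k) mpoly set) \<subseteq> edge_ideal D"
    proof
      fix g :: "('v, 'k) mpoly" assume g: "g \<in> monomial_ideal (edge_monomials D)"
      show "g \<in> edge_ideal D"
      proof (rule ideal_mem_if_monomials_mem[OF id])
        fix \<alpha> assume "\<alpha> \<in> keys g"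
        then have "\<alpha> \<in> edge_monomials D" using g by (auto simp: monomial_ideal_def)
        then obtain x y where xy: "(x, y) \<in> arcs D" and le: "1 \<le> lookup \<alpha> x" "weight D y \<le> lookup \<alpha> y"
          by (auto simp: edge_monomials_def)
        let ?\<gamma> = "Poly_Mapping.single x 1 + Poly_Mapping.single y (weight D y)"
        \<comment> \<open>For distinct \<open>x\<close> and \<open>y\<close> the two exponent
          conditions concern different coordinates, so together they say that the generator divides
          the monomial.\<close>
        have "x \<noteq> y" using xy loopless by blast
        then have "\<alpha> = (\<alpha> - ?\<gamma>) + ?\<gamma>"
          using le by (intro poly_mapping_eqI) (auto simp: lookup_add lookup_minus lookup_single when_def)
        then have "Poly_Mapping.single \<alpha> 1 =
            Poly_Mapping.single (\<alpha> - ?\<gamma>) 1 * (mvar x * mvar y ^ weight D y :: ('v, 'k) mpoly)"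
          unfolding gen by (simp add: mult_single)
        moreover have "mvar x * mvar y ^ weight D y \<in> (edge_ideal D :: ('v, 'k) mpoly set)"
          using genideal_self[of ?G] xy unfolding edge_ideal_def by auto
        ultimately show "Poly_Mapping.single \<alpha> 1 \<in> (edge_ideal D :: ('v, 'k) mpoly set)"
          using id unfolding ideal_mpoly_ring_iff by metis
      qed
    qed
  qed
qed

text \<open>For a strong cover \<open>C\<close> the witness has exponent \<open>0\<close> at the vertices of \<open>C\<close> with an
  out-neighbour outside \<open>C\<close>, exponent \<open>w(x) - 1\<close> at the other vertices \<open>x\<close> of \<open>C\<close>, and \<open>w(x)\<close>
  outside \<open>C\<close>.\<close>

lemma strong_vertex_cover_iff_colon_witness:
  fixes D :: "'v::finite wograph"
  assumes D: "weighted_oriented_graph D"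
  shows "(\<exists>\<alpha>. \<forall>\<beta>. \<alpha> + \<beta> \<in> edge_monomials D \<longleftrightarrow> \<beta> \<in> var_monomials C) \<longleftrightarrow> strong_vertex_cover D C"
proof
  have V: "dverts D = UNIV" and asym: "asym (arcs D)" and pos: "\<And>x. 1 \<le> weight D x"
    using D by (auto simp: weighted_oriented_graph_def)
  {
    assume "\<exists>\<alpha>. \<forall>\<beta>. \<alpha> + \<beta> \<in> edge_monomials D \<longleftrightarrow> \<beta> \<in> var_monomials C"
    then obtain \<alpha> where \<alpha>: "\<And>\<beta>. \<alpha> + \<beta> \<in> edge_monomials D \<longleftrightarrow> \<beta> \<in> var_monomials C" by blast
    \<comment> \<open>Multiplying by \<beta> fills the exponents outside \<open>C\<close> up to the
      weights without entering the prime, so the generator of each arc must fail to divide at an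
      endpoint in \<open>C\<close>.\<close>
    define \<beta> where "\<beta> = Abs_poly_mapping (\<lambda>v. if v \<in> C then 0 else weight D v)"
    have \<beta>: "lookup \<beta> v = (if v \<in> C then 0 else weight D v)" for v by (simp add: \<beta>_def)
    have "\<beta> \<notin> var_monomials C" by (simp add: var_monomials_def \<beta>)
    then have no: "\<alpha> + \<beta> \<notin> edge_monomials D" using \<alpha> by blast
    have arc: "(x \<in> C \<and> lookup \<alpha> x = 0) \<or> (y \<in> C \<and> lookup \<alpha> y < weight D y)"
      if "(x, y) \<in> arcs D" for x y
    proof -
      have "\<not> (1 \<le> lookup (\<alpha> + \<beta>) x \<and> weight D y \<le> lookup (\<alpha> + \<beta>) y)"
        using no that unfolding edge_monomials_def by blast
      then show ?thesis using pos[of x] by (auto simp: lookup_add \<beta> split: if_splits)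
    qed
    \<comment> \<open>Multiplying by \<open>x\<close> alone makes some generator a divisor, so the
      arc concerned has \<open>x\<close> as its tail or as its head; these are the two
      alternatives.\<close>
    have step: "(\<exists>y. (x, y) \<in> arcs D \<and> weight D y \<le> lookup \<alpha> y) \<or>
        (\<exists>y. (y, x) \<in> arcs D \<and> 1 \<le> lookup \<alpha> y \<and> lookup \<alpha> x < weight D x)" if "x \<in> C" for x
    proof -
      have "0 \<notin> var_monomials C" by (simp add: var_monomials_def)
      then have no\<alpha>: "\<alpha> \<notin> edge_monomials D" using \<alpha>[of 0] by simp
      have "Poly_Mapping.single x 1 \<in> var_monomials C"
        using that unfolding var_monomials_def mem_Collect_eq by (intro bexI[of _ x]) simp_all
      then have "\<alpha> + Poly_Mapping.single x 1 \<in> edge_monomials D" using \<alpha> by blast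
      then obtain a b where ab: "(a, b) \<in> arcs D" "1 \<le> lookup (\<alpha> + Poly_Mapping.single x 1) a"
        "weight D b \<le> lookup (\<alpha> + Poly_Mapping.single x 1) b"
        unfolding edge_monomials_def by blast
      have "a \<noteq> b" using ab(1) asym by (metis asymD)
      moreover have "\<not> (1 \<le> lookup \<alpha> a \<and> weight D b \<le> lookup \<alpha> b)"
        using no\<alpha> ab(1) unfolding edge_monomials_def by blast
      ultimately show ?thesis
        using ab by (cases "a = x"; cases "b = x") (auto simp: lookup_add lookup_single when_def)
    qed
    \<comment> \<open>A full exponent at \<open>y\<close> rules out the second alternative of
      \<open>step\<close>, and the first yields an arc that contradicts \<open>arc\<close>.\<close>
    have small: "lookup \<alpha> y < weight D y" if y: "y \<in> C" for y
    proof (rule ccontr)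
      assume ge: "\<not> ?thesis"
      then obtain z where z: "(y, z) \<in> arcs D" "weight D z \<le> lookup \<alpha> z" using step[OF y] by auto
      then show False using arc[OF z(1)] ge pos[of y] by auto
    qed
    show "strong_vertex_cover D C"
      unfolding strong_vertex_cover_def vertex_cover_underlying_graph_iff
    proof (intro conjI ballI)
      show "C \<subseteq> dverts D" using V by simp
      show "case e of (x, y) \<Rightarrow> x \<in> C \<or> y \<in> C" if "e \<in> arcs D" for e
        using arc that by (cases e) blast
      fix x assume x: "x \<in> C"
      show "(\<exists>y. y \<in> nbrs D x \<and> y \<notin> C) \<or>
        (\<exists>y\<in>C. (y, x) \<in> arcs D \<and> 1 < weight D y \<and> out_nbrs D y \<subseteq> C)"
        using step[OF x]
      proof
        assume "\<exists>y. (x, y) \<in> arcs D \<and> weight D y \<le> lookup \<alpha> y"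
        then obtain y where y: "(x, y) \<in> arcs D" "weight D y \<le> lookup \<alpha> y" by blast
        then have "y \<notin> C" using small[of y] by auto
        then show ?thesis using y(1) unfolding nbrs_iff by blast
      next
        assume "\<exists>y. (y, x) \<in> arcs D \<and> 1 \<le> lookup \<alpha> y \<and> lookup \<alpha> x < weight D x"
        then obtain y where y: "(y, x) \<in> arcs D" "1 \<le> lookup \<alpha> y" by blast
        show ?thesis
        proof (cases "y \<in> C")
          case True
          have "1 < weight D y" using small[OF True] y(2) by simp
          moreover have "out_nbrs D y \<subseteq> C"
            using arc[of y] y(2) unfolding out_nbrs_def by fastforce
          ultimately show ?thesis using True y(1) by blast
        next
          case False
          then show ?thesis using y(1) unfolding nbrs_iff by blast
        qed
      qed
    qed
  }
  assume C: "strong_vertex_cover D C"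
  define \<alpha> where "\<alpha> = Abs_poly_mapping (\<lambda>v. if v \<notin> C then weight D v
    else if out_nbrs D v \<subseteq> C then weight D v - 1 else 0)"
  have \<alpha>: "lookup \<alpha> v = (if v \<notin> C then weight D v
    else if out_nbrs D v \<subseteq> C then weight D v - 1 else 0)" for v by (simp add: \<alpha>_def)
  have cover: "x \<in> C \<or> y \<in> C" if "(x, y) \<in> arcs D" for x y
    using C that unfolding strong_vertex_cover_def vertex_cover_underlying_graph_iff by blast
  have no: "\<alpha> + \<beta> \<notin> edge_monomials D" if "\<beta> \<notin> var_monomials C" for \<beta>
  proof
    assume "\<alpha> + \<beta> \<in> edge_monomials D"
    then obtain x y where xy: "(x, y) \<in> arcs D" "1 \<le> lookup \<alpha> x + lookup \<beta> x"
      "weight D y \<le> lookup \<alpha> y + lookup \<beta> y"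
      unfolding edge_monomials_def mem_Collect_eq lookup_add by blast
    have zero: "lookup \<beta> v = 0" if "v \<in> C" for v
      using that \<open>\<beta> \<notin> var_monomials C\<close> by (auto simp: var_monomials_def)
    show False
    proof (cases "y \<in> C")
      case True
      then have "lookup \<alpha> y < weight D y" using pos[of y] by (auto simp: \<alpha>)
      then show False using xy(3) zero[OF True] by simp
    next
      case False
      then have x: "x \<in> C" using cover[OF xy(1)] by blast
      moreover have "\<not> out_nbrs D x \<subseteq> C" using xy(1) False by (auto simp: out_nbrs_def)
      ultimately have "lookup \<alpha> x = 0" by (simp add: \<alpha>)
      then show False using xy(2) zero[OF x] by simp
    qed
  qed
  \<comment> \<open>Single variables of \<open>C\<close> suffice, because the edge monomials are
    closed under further multiplication.\<close>
  have yes: "\<alpha> + Poly_Mapping.single x 1 \<in> edge_monomials D" if x: "x \<in> C" for x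
  proof -
    have wit: ?thesis if "(a, b) \<in> arcs D" "1 \<le> lookup \<alpha> a + (if a = x then 1 else 0)"
      "weight D b \<le> lookup \<alpha> b + (if b = x then 1 else 0)" for a b
      using that unfolding edge_monomials_def mem_Collect_eq
      by (rule_tac x = a in exI, rule_tac x = b in exI)
        (auto simp: lookup_add lookup_single when_def split: if_splits)
    show ?thesis
    proof (cases "out_nbrs D x \<subseteq> C")
      case False
      then obtain y where y: "(x, y) \<in> arcs D" "y \<notin> C" by (auto simp: out_nbrs_def)
      show ?thesis by (rule wit[OF y(1)]) (use y in \<open>simp_all add: \<alpha>\<close>)
    next
      case True
      then have wx: "weight D x \<le> lookup \<alpha> x + (if x = x then 1 else 0)"
        using x by (simp add: \<alpha>)
      have "\<exists>y. (y, x) \<in> arcs D \<and> 1 \<le> lookup \<alpha> y"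
      proof (cases "\<exists>y. y \<in> nbrs D x \<and> y \<notin> C")
        case out: True
        then obtain y where y: "y \<in> nbrs D x" "y \<notin> C" by blast
        then have "(y, x) \<in> arcs D" using True by (auto simp: nbrs_iff out_nbrs_def)
        then show ?thesis using y(2) pos[of y] by (intro exI[of _ y]) (simp add: \<alpha>)
      next
        case False
        then obtain y where "y \<in> C" "(y, x) \<in> arcs D" "1 < weight D y" "out_nbrs D y \<subseteq> C"
          using C x unfolding strong_vertex_cover_def by blast
        then show ?thesis by (intro exI[of _ y]) (simp add: \<alpha>)
      qed
      then obtain y where y: "(y, x) \<in> arcs D" "1 \<le> lookup \<alpha> y" by blast
      show ?thesis by (rule wit[OF y(1) _ wx]) (use y(2) in simp)
    qed
  qed
  have "\<alpha> + \<beta> \<in> edge_monomials D" if \<beta>: "\<beta> \<in> var_monomials C" for \<beta>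
  proof -
    obtain x where x: "x \<in> C" "0 < lookup \<beta> x" using \<beta> by (auto simp: var_monomials_def)
    have "\<beta> = (\<beta> - Poly_Mapping.single x 1) + Poly_Mapping.single x 1"
      using x(2) by (intro poly_mapping_eqI) (auto simp: lookup_add lookup_minus lookup_single when_def)
    then have "\<alpha> + \<beta> = (\<beta> - Poly_Mapping.single x 1) + (\<alpha> + Poly_Mapping.single x 1)"
      by (metis add.left_commute)
    then show ?thesis using monomial_upsetD[OF monomial_upset_edge_monomials yes[OF x(1)]] by metis
  qed
  then show "\<exists>\<alpha>. \<forall>\<beta>. \<alpha> + \<beta> \<in> edge_monomials D \<longleftrightarrow> \<beta> \<in> var_monomials C"
    using no by blast
qed

theorem associated_primes_edge_ideal:
  fixes D :: "'v::finite wograph"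
  assumes D: "weighted_oriented_graph D"
  shows "associated_primes mpoly_ring (edge_ideal D :: ('v, 'k::field) mpoly set) =
    {var_ideal C | C. strong_vertex_cover D C}"
proof -
  have loopless: "(x, x) \<notin> arcs D" for x
    using D unfolding weighted_oriented_graph_def by (metis asymD)
  show ?thesis
    by (simp only: edge_ideal_eq_monomial_ideal[OF loopless]
        associated_primes_monomial_ideal[OF monomial_upset_edge_monomials]
        strong_vertex_cover_iff_colon_witness[OF D])
qed

section \<open>Heights of monomial primes\<close>

lemma exponents_mult_le:
  fixes p q :: "('v, 'k::field) mpoly"
  assumes "\<And>\<alpha>. \<alpha> \<in> keys p \<Longrightarrow> lookup \<alpha> v \<le> m" "\<And>\<alpha>. \<alpha> \<in> keys q \<Longrightarrow> lookup \<alpha> v \<le> n"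
    and "\<alpha> \<in> keys (p * q)"
  shows "lookup \<alpha> v \<le> m + n"
proof -
  obtain \<beta> \<gamma> where "\<alpha> = \<beta> + \<gamma>" "\<beta> \<in> keys p" "\<gamma> \<in> keys q"
    using keys_mult[of p q] assms(3) by blast
  then show ?thesis using assms(1,2) by (simp add: lookup_add add_mono)
qed

lemma exponents_power_le:
  fixes p :: "('v, 'k::field) mpoly"
  assumes "\<And>\<alpha>. \<alpha> \<in> keys p \<Longrightarrow> lookup \<alpha> v \<le> m"
  shows "\<alpha> \<in> keys (p ^ n) \<Longrightarrow> lookup \<alpha> v \<le> n * m"
proof (induction n arbitrary: \<alpha>)
  case (Suc n)
  have "\<alpha> \<in> keys (p * p ^ n)" using Suc.prems by simp
  from exponents_mult_le[OF assms Suc.IH this] show ?case by simp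
qed (auto simp: keys_one)

lemma exponents_prod_le:
  fixes p :: "'i \<Rightarrow> ('v, 'k::field) mpoly"
  assumes "finite A" "\<And>i \<alpha>. i \<in> A \<Longrightarrow> \<alpha> \<in> keys (p i) \<Longrightarrow> lookup \<alpha> v \<le> m"
  shows "\<alpha> \<in> keys (prod p A) \<Longrightarrow> lookup \<alpha> v \<le> card A * m"
  using assms
proof (induction A arbitrary: \<alpha> rule: finite_induct)
  case (insert a A)
  have IH: "lookup \<beta> v \<le> card A * m" if "\<beta> \<in> keys (prod p A)" for \<beta>
    using insert.IH[OF that] insert.prems(2) by blast
  have "lookup \<beta> v \<le> m" if "\<beta> \<in> keys (p a)" for \<beta> using insert.prems(2)[of a \<beta>] that by simp
  moreover have "\<alpha> \<in> keys (p a * prod p A)" using insert by simp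
  ultimately have "lookup \<alpha> v \<le> m + card A * m" using exponents_mult_le[OF _ IH] by blast
  then show ?case using insert.hyps by simp
qed (auto simp: keys_one)

lemma card_bounded_exponents_le:
  "finite {\<alpha> :: 'v::finite \<Rightarrow>\<^sub>0 nat. \<forall>v. lookup \<alpha> v \<le> L}"
  "card {\<alpha> :: 'v::finite \<Rightarrow>\<^sub>0 nat. \<forall>v. lookup \<alpha> v \<le> L} \<le> Suc L ^ CARD('v)"
proof -
  let ?E = "{\<alpha> :: 'v \<Rightarrow>\<^sub>0 nat. \<forall>v. lookup \<alpha> v \<le> L}"
  have inj: "inj_on lookup ?E" by (rule inj_onI) (simp only: poly_mapping_eq_iff)
  have sub: "lookup ` ?E \<subseteq> (UNIV :: 'v set) \<rightarrow>\<^sub>E {..L}" by (auto simp: PiE_def)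
  have fin: "finite ((UNIV :: 'v set) \<rightarrow>\<^sub>E {..L})" by (intro finite_PiE) auto
  show "finite ?E" using inj_on_finite[OF inj sub fin] .
  show "card ?E \<le> Suc L ^ CARD('v)"
    using card_inj_on_le[OF inj sub fin] by (simp add: card_PiE)
qed

definition mpoly_scale :: "'k::field \<Rightarrow> ('v, 'k) mpoly \<Rightarrow> ('v, 'k) mpoly" where
  "mpoly_scale c p = Poly_Mapping.single 0 c * p"

lemma vector_space_mpoly_scale: "vector_space mpoly_scale"
  by unfold_locales
    (simp_all add: mpoly_scale_def algebra_simps single_add mult_single mult.assoc[symmetric])

text \<open>The products of powers with exponents at most \<open>N\<close> of \<open>m\<close> polynomials are more
  numerous, for large \<open>N\<close>, than the monomials occurring in them if \<open>m\<close> exceeds the number of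
  variables.\<close>

lemma algebraic_dependence:
  fixes a :: "nat \<Rightarrow> ('v::finite, 'k::field) mpoly"
  assumes m: "CARD('v) < m"
  shows "\<exists>A c. finite A \<and> A \<noteq> {} \<and> A \<subseteq> {..<m} \<rightarrow>\<^sub>E UNIV \<and> (\<forall>e\<in>A. c e \<noteq> 0) \<and>
    (\<Sum>e\<in>A. mpoly_scale (c e) (\<Prod>i<m. a i ^ e i)) = 0"
proof -
  interpret vs: vector_space "mpoly_scale :: 'k \<Rightarrow> ('v, 'k) mpoly \<Rightarrow> ('v, 'k) mpoly"
    by (rule vector_space_mpoly_scale)
  \<comment> \<open>The successor keeps \<open>d\<close>, and with it \<open>K\<close>, positive
    even if all the polynomials are constant.\<close>
  define d where "d = Suc (Max (insert 0 (\<Union>i<m. \<Union>\<alpha>\<in>keys (a i). range (lookup \<alpha>))))"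
  have bound: "lookup \<alpha> v \<le> d" if "i < m" "\<alpha> \<in> keys (a i)" for i \<alpha> v
  proof -
    have "finite (insert 0 (\<Union>i<m. \<Union>\<alpha>\<in>keys (a i). range (lookup \<alpha>)))" by simp
    moreover have "lookup \<alpha> v \<in> insert 0 (\<Union>i<m. \<Union>\<alpha>\<in>keys (a i). range (lookup \<alpha>))"
      using that by blast
    ultimately have "lookup \<alpha> v \<le> Max (insert 0 (\<Union>i<m. \<Union>\<alpha>\<in>keys (a i). range (lookup \<alpha>)))"
      by (rule Max_ge)
    then show ?thesis by (simp add: d_def)
  qed
  \<comment> \<open>With \<open>n\<close> variables, exponents up to \<open>N\<close> give products
    with exponents up to \<open>L = K * N\<close>. The choice \<open>N = K ^ n\<close> makes
    \<open>(L + 1) ^ n \<le> N * (N + 1) ^ n < (N + 1) ^ (n + 1)\<close>, while there are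
    \<open>(N + 1) ^ m\<close> exponent vectors.\<close>
  define K where "K = m * d"
  define N where "N = K ^ CARD('v)"
  define L where "L = m * (N * d)"
  define Ex where "Ex = {..<m} \<rightarrow>\<^sub>E {..N}"
  define mon where "mon e = (\<Prod>i<m. a i ^ e i)" for e
  define T where "T = (\<lambda>\<alpha>. Poly_Mapping.single \<alpha> (1::'k)) ` {\<alpha> :: 'v \<Rightarrow>\<^sub>0 nat. \<forall>v. lookup \<alpha> v \<le> L}"
  have "0 < K" using m by (simp add: K_def d_def)
  have finEx: "finite Ex" unfolding Ex_def by (intro finite_PiE) auto
  have finT: "finite T" unfolding T_def using card_bounded_exponents_le(1) by (rule finite_imageI)
  have "card T \<le> Suc L ^ CARD('v)"
    unfolding T_def using card_image_le[OF card_bounded_exponents_le(1)] card_bounded_exponents_le(2)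
    by (rule order_trans)
  also have "\<dots> \<le> (K * Suc N) ^ CARD('v)"
    using \<open>0 < K\<close> by (intro power_mono) (simp_all add: K_def L_def algebra_simps)
  also have "\<dots> = N * Suc N ^ CARD('v)" by (simp only: power_mult_distrib N_def)
  also have "\<dots> < Suc N ^ Suc (CARD('v))" by simp
  also have "\<dots> \<le> Suc N ^ m" using m by (intro power_increasing) auto
  also have "\<dots> = card Ex" by (simp add: Ex_def card_PiE)
  finally have less: "card T < card Ex" .
  have span: "p \<in> vs.span T" if "\<And>\<alpha> v. \<alpha> \<in> keys p \<Longrightarrow> lookup \<alpha> v \<le> L" for p
  proof -
    have "(\<Sum>\<alpha>\<in>keys p. mpoly_scale (lookup p \<alpha>) (Poly_Mapping.single \<alpha> 1)) \<in> vs.span T"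
      by (intro vs.span_sum vs.span_scale vs.span_base) (use that in \<open>auto simp: T_def\<close>)
    moreover have "(\<Sum>\<alpha>\<in>keys p. mpoly_scale (lookup p \<alpha>) (Poly_Mapping.single \<alpha> 1)) = p"
      unfolding mpoly_scale_def single_eq_scaled_monomial[symmetric] by (rule sum_monomials)
    ultimately show ?thesis by simp
  qed
  have mon_span: "mon e \<in> vs.span T" if e: "e \<in> Ex" for e
  proof (rule span)
    fix \<alpha> v assume "\<alpha> \<in> keys (mon e)"
    then have "lookup \<alpha> v \<le> card {..<m} * (N * d)"
      unfolding mon_def
    proof (rule exponents_prod_le[rotated 2])
      fix i \<beta> assume i: "i \<in> {..<m}" and "\<beta> \<in> keys (a i ^ e i)"
      then have "lookup \<beta> v \<le> e i * d" using exponents_power_le[of "a i" v d \<beta> "e i"] bound by auto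
      moreover have "e i \<le> N" using e i by (auto simp: Ex_def)
      ultimately show "lookup \<beta> v \<le> N * d" by (meson le_trans mult_le_mono1)
    qed simp
    then show "lookup \<alpha> v \<le> L" by (simp add: L_def)
  qed
  have ExU: "Ex \<subseteq> {..<m} \<rightarrow>\<^sub>E UNIV" unfolding Ex_def by (intro PiE_mono) auto
  show ?thesis
  \<comment> \<open>Linear dependence speaks of sets of vectors, so two exponent vectors with the
    same product are treated apart: their difference is already a relation.\<close>
  proof (cases "inj_on mon Ex")
    case True
    have "vs.dependent (mon ` Ex)"
    proof (rule ccontr)
      assume "\<not> ?thesis"
      then have "card (mon ` Ex) \<le> card T"
        using vs.independent_span_bound[OF finT, of "mon ` Ex"] mon_span by blast
      then show False using less True by (simp add: card_image)
    qed
    then obtain t u where t: "finite t" "t \<subseteq> mon ` Ex" "(\<Sum>p\<in>t. mpoly_scale (u p) p) = 0"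
      and nz: "\<exists>p\<in>t. u p \<noteq> 0"
      unfolding vs.dependent_explicit by blast
    define A where "A = {e \<in> Ex. mon e \<in> t \<and> u (mon e) \<noteq> 0}"
    have img: "mon ` A = {p \<in> t. u p \<noteq> 0}" unfolding A_def using t(2) by blast
    have "(\<Sum>e\<in>A. mpoly_scale (u (mon e)) (mon e)) = (\<Sum>p\<in>mon ` A. mpoly_scale (u p) p)"
      using inj_on_subset[OF True, of A] by (simp add: sum.reindex A_def)
    also have "\<dots> = (\<Sum>p\<in>t. mpoly_scale (u p) p)"
      unfolding img using t(1) by (intro sum.mono_neutral_left) auto
    finally have "(\<Sum>e\<in>A. mpoly_scale (u (mon e)) (mon e)) = 0" using t(3) by simp
    moreover have "A \<noteq> {}" using nz img by blast
    moreover have "finite A" "A \<subseteq> {..<m} \<rightarrow>\<^sub>E UNIV" using finEx ExU by (auto simp: A_def)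
    moreover have "\<forall>e\<in>A. u (mon e) \<noteq> 0" by (simp add: A_def)
    ultimately show ?thesis
      unfolding mon_def by (intro exI[of _ A] exI[of _ "\<lambda>e. u (\<Prod>i<m. a i ^ e i)"] conjI)
  next
    case False
    then obtain e e' where e: "e \<in> Ex" "e' \<in> Ex" "e \<noteq> e'" "mon e = mon e'"
      by (auto simp: inj_on_def)
    define c :: "(nat \<Rightarrow> nat) \<Rightarrow> 'k" where "c x = (if x = e then 1 else - 1)" for x
    have "(\<Sum>x\<in>{e, e'}. mpoly_scale (c x) (mon x)) = mpoly_scale (c e) (mon e) + mpoly_scale (c e') (mon e)"
      using e by simp
    also have "\<dots> = 0" using e(3) vs.scale_left_distrib[of "c e" "c e'" "mon e"] by (simp add: c_def)
    finally have "(\<Sum>x\<in>{e, e'}. mpoly_scale (c x) (mon x)) = 0" .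
    moreover have "{e, e'} \<subseteq> {..<m} \<rightarrow>\<^sub>E UNIV" using e ExU by blast
    moreover have "\<forall>x\<in>{e, e'}. c x \<noteq> 0" by (simp add: c_def)
    ultimately show ?thesis
      unfolding mon_def by (intro exI[of _ "{e, e'}"] exI[of _ c] conjI) auto
  qed
qed

text \<open>Reading the chain upwards, the terms with the least exponent of \<open>a j\<close> survive modulo
  \<open>Q (j + 1)\<close> after division by a power of \<open>a j\<close>, which is not in \<open>Q j\<close>.\<close>

lemma prime_chain_no_relation:
  fixes a :: "nat \<Rightarrow> ('v, 'k::field) mpoly"
  assumes prime: "\<And>i. i \<le> m \<Longrightarrow> primeideal (Q i) mpoly_ring"
    and sub: "\<And>i. i < m \<Longrightarrow> Q i \<subseteq> Q (Suc i)"
    and a: "\<And>i. i < m \<Longrightarrow> a i \<in> Q (Suc i)" "\<And>i. i < m \<Longrightarrow> a i \<notin> Q i"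
  shows "j + d = m \<Longrightarrow> finite A \<Longrightarrow> A \<noteq> {} \<Longrightarrow> (\<And>e. e \<in> A \<Longrightarrow> c e \<noteq> 0) \<Longrightarrow>
    (\<And>e e'. e \<in> A \<Longrightarrow> e' \<in> A \<Longrightarrow> (\<forall>i\<in>{j..<m}. e i = e' i) \<Longrightarrow> e = e') \<Longrightarrow>
    (\<Sum>e\<in>A. mpoly_scale (c e) (\<Prod>i\<in>{j..<m}. a i ^ e i)) \<notin> Q j"
proof (induction d arbitrary: j A)
  case 0
  then obtain e where e: "e \<in> A" by blast
  \<comment> \<open>With no indices left to tell exponents apart, \<open>A\<close> is a singleton
    and the sum is a nonzero constant, hence a unit.\<close>
  then have A: "A = {e}" using 0(1,5) by force
  show ?case
  proof
    assume "(\<Sum>e\<in>A. mpoly_scale (c e) (\<Prod>i\<in>{j..<m}. a i ^ e i)) \<in> Q j"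
    then have mem: "Poly_Mapping.single 0 (c e) \<in> Q m" using 0(1) A by (simp add: mpoly_scale_def)
    have P: "primeideal (Q m) mpoly_ring" by (rule prime) simp
    then have "Poly_Mapping.single 0 (inverse (c e)) * Poly_Mapping.single 0 (c e) \<in> Q m"
      using mem unfolding primeideal_mpoly_ring_iff ideal_mpoly_ring_iff by blast
    moreover have "Poly_Mapping.single 0 (inverse (c e)) * Poly_Mapping.single 0 (c e) = (1 :: ('v, 'k) mpoly)"
      using 0(4)[OF e] by (simp add: mult_single)
    ultimately show False using P unfolding primeideal_mpoly_ring_iff by simp
  qed
next
  case (Suc d)
  have j: "j < m" using Suc.prems(1) by simp
  have Pj: "primeideal (Q j) mpoly_ring" and Pj1: "primeideal (Q (Suc j)) mpoly_ring"
    using prime j by simp_all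
  then have id: "ideal (Q (Suc j)) mpoly_ring" unfolding primeideal_mpoly_ring_iff by blast
  define \<mu> where "\<mu> = Min ((\<lambda>e. e j) ` A)"
  have \<mu>_le: "\<mu> \<le> e j" if "e \<in> A" for e using that Suc.prems(2) by (simp add: \<mu>_def)
  have "\<mu> \<in> (\<lambda>e. e j) ` A" unfolding \<mu>_def using Suc.prems(2,3) by (intro Min_in) auto
  then obtain e0 where e0: "e0 \<in> A" "e0 j = \<mu>" by auto
  define A' where "A' = {e \<in> A. e j = \<mu>}"
  define r where "r e = mpoly_scale (c e) (\<Prod>i\<in>{Suc j..<m}. a i ^ e i)" for e
  have fac: "mpoly_scale (c e) (\<Prod>i\<in>{j..<m}. a i ^ e i) = a j ^ \<mu> * (a j ^ (e j - \<mu>) * r e)"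
    if "e \<in> A" for e
  proof -
    have "(\<Prod>i\<in>{j..<m}. a i ^ e i) = a j ^ e j * (\<Prod>i\<in>{Suc j..<m}. a i ^ e i)"
      using j by (simp add: prod.atLeast_Suc_lessThan)
    moreover have "a j ^ e j = a j ^ \<mu> * a j ^ (e j - \<mu>)"
      using \<mu>_le[OF that] by (simp add: power_add[symmetric])
    ultimately show ?thesis by (simp add: r_def mpoly_scale_def ac_simps)
  qed
  show ?case
  proof
    assume "(\<Sum>e\<in>A. mpoly_scale (c e) (\<Prod>i\<in>{j..<m}. a i ^ e i)) \<in> Q j"
    moreover have "(\<Sum>e\<in>A. mpoly_scale (c e) (\<Prod>i\<in>{j..<m}. a i ^ e i)) =
        a j ^ \<mu> * (\<Sum>e\<in>A. a j ^ (e j - \<mu>) * r e)"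
      unfolding sum_distrib_left by (intro sum.cong fac) simp_all
    ultimately have "a j ^ \<mu> \<in> Q j \<or> (\<Sum>e\<in>A. a j ^ (e j - \<mu>) * r e) \<in> Q j"
      by (intro prime_mult_mem[OF Pj]) simp
    moreover have "a j ^ \<mu> \<notin> Q j" using prime_power_mem[OF Pj] a(2)[OF j] by blast
    ultimately have S: "(\<Sum>e\<in>A. a j ^ (e j - \<mu>) * r e) \<in> Q (Suc j)" using sub[OF j] by blast
    have hi: "(\<Sum>e\<in>A - A'. (- (a j ^ (e j - \<mu>))) * r e) \<in> Q (Suc j)"
    proof (rule ideal_sum_closed[OF id])
      fix e assume e: "e \<in> A - A'"
      then have "e j - \<mu> \<noteq> 0" using \<mu>_le[of e] by (auto simp: A'_def)
      then obtain k where "e j - \<mu> = Suc k" by (cases "e j - \<mu>") auto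
      then have "(- (a j ^ (e j - \<mu>))) * r e = (- (a j ^ k) * r e) * a j" by (simp add: ac_simps)
      then show "(- (a j ^ (e j - \<mu>))) * r e \<in> Q (Suc j)"
        by (simp only: ideal_mult_mem[OF id a(1)[OF j]])
    qed
    have "(\<Sum>e\<in>A. a j ^ (e j - \<mu>) * r e) =
        (\<Sum>e\<in>A - A'. a j ^ (e j - \<mu>) * r e) + (\<Sum>e\<in>A'. a j ^ (e j - \<mu>) * r e)"
      by (rule sum.subset_diff) (use Suc.prems(2) in \<open>auto simp: A'_def\<close>)
    moreover have "(\<Sum>e\<in>A'. a j ^ (e j - \<mu>) * r e) = (\<Sum>e\<in>A'. r e)"
      by (intro sum.cong) (auto simp: A'_def)
    ultimately have "(\<Sum>e\<in>A'. r e) = (\<Sum>e\<in>A. a j ^ (e j - \<mu>) * r e) +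
        (\<Sum>e\<in>A - A'. (- (a j ^ (e j - \<mu>))) * r e)"
      by (simp add: sum_negf)
    then have "(\<Sum>e\<in>A'. r e) \<in> Q (Suc j)"
      by (simp only: ideal_add_mem[OF id S hi])
    moreover have "(\<Sum>e\<in>A'. mpoly_scale (c e) (\<Prod>i\<in>{Suc j..<m}. a i ^ e i)) \<notin> Q (Suc j)"
    proof (rule Suc.IH)
      show "Suc j + d = m" using Suc.prems(1) by simp
      show "finite A'" using Suc.prems(2) by (simp add: A'_def)
      show "A' \<noteq> {}" using e0 by (auto simp: A'_def)
      show "c e \<noteq> 0" if "e \<in> A'" for e using that Suc.prems(4) by (simp add: A'_def)
      fix e e' assume e: "e \<in> A'" "e' \<in> A'" "\<forall>i\<in>{Suc j..<m}. e i = e' i"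
      have "\<forall>i\<in>{j..<m}. e i = e' i"
      proof
        fix i assume "i \<in> {j..<m}"
        then show "e i = e' i" using e by (cases "i = j") (auto simp: A'_def)
      qed
      then show "e = e'" using e Suc.prems(5) by (simp add: A'_def)
    qed
    ultimately show False by (simp add: r_def)
  qed
qed

text \<open>Elements \<open>a i\<close> taken from the successive differences of too long a chain
  satisfy an algebraic relation. Its value 0 lies in \<open>Q 0\<close>, whereas
  \<open>prime_chain_no_relation\<close> keeps every such sum out of \<open>Q 0\<close>.\<close>

theorem prime_chain_length_le:
  fixes Q :: "nat \<Rightarrow> ('v::finite, 'k::field) mpoly set"
  assumes prime: "\<And>i. i \<le> m \<Longrightarrow> primeideal (Q i) mpoly_ring"
    and chain: "\<And>i. i < m \<Longrightarrow> Q i \<subset> Q (Suc i)"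
  shows "m \<le> CARD('v)"
proof (rule ccontr)
  assume "\<not> m \<le> CARD('v)"
  then have m: "CARD('v) < m" by simp
  have "\<forall>i. \<exists>x. i < m \<longrightarrow> x \<in> Q (Suc i) \<and> x \<notin> Q i" using chain by blast
  then obtain a where a: "\<And>i. i < m \<Longrightarrow> a i \<in> Q (Suc i) \<and> a i \<notin> Q i" by metis
  obtain A c where A: "finite A" "A \<noteq> {}" "A \<subseteq> {..<m} \<rightarrow>\<^sub>E UNIV" "\<forall>e\<in>A. c e \<noteq> 0"
    and rel: "(\<Sum>e\<in>A. mpoly_scale (c e) (\<Prod>i<m. a i ^ e i)) = 0"
    using algebraic_dependence[OF m, of a] by blast
  have "(\<Sum>e\<in>A. mpoly_scale (c e) (\<Prod>i\<in>{0..<m}. a i ^ e i)) \<notin> Q 0"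
  proof (rule prime_chain_no_relation[OF prime _ _ _ _ A(1,2)])
    show "0 + m = m" by simp
    show "e = e'" if "e \<in> A" "e' \<in> A" "\<forall>i\<in>{0..<m}. e i = e' i" for e e'
    proof (rule PiE_ext[of e "{..<m}" "\<lambda>_. UNIV"])
      show "e i = e' i" if "i \<in> {..<m}" for i
        using that \<open>\<forall>i\<in>{0..<m}. e i = e' i\<close> by simp
    qed (use that A(3) in blast)+
  qed (use a chain A(4) in blast)+
  then have "0 \<notin> Q 0" using rel by (simp add: atLeast0LessThan)
  moreover have "0 \<in> Q 0" using prime[of 0] unfolding primeideal_mpoly_ring_iff ideal_mpoly_ring_iff by blast
  ultimately show False by blast
qed

section \<open>Chains of ideals generated by variables, and unmixedness\<close>

lemma var_ideal_strict_mono: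
  assumes "C \<subset> C'"
  shows "(var_ideal C :: ('v, 'k::field) mpoly set) \<subset> var_ideal C'"
proof
  show "(var_ideal C :: ('v, 'k) mpoly set) \<subseteq> var_ideal C'"
    using assms unfolding monomial_ideal_def var_monomials_def by blast
  obtain x where x: "x \<in> C'" "x \<notin> C" using assms by blast
  have "Poly_Mapping.single x 1 \<in> var_monomials C'"
    unfolding var_monomials_def mem_Collect_eq using x(1) by (intro bexI[of _ x]) simp_all
  moreover have "Poly_Mapping.single x 1 \<notin> var_monomials C"
    using x(2) by (auto simp: var_monomials_def lookup_single when_def)
  ultimately have "mvar x \<in> (var_ideal C' :: ('v, 'k) mpoly set)" "mvar x \<notin> (var_ideal C :: ('v, 'k) mpoly set)"
    by (simp_all add: monomial_ideal_def mvar_def)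
  then show "(var_ideal C :: ('v, 'k) mpoly set) \<noteq> var_ideal C'" by blast
qed

lemma enumeration_strict_chain:
  assumes b: "bij_betw b {..<n} B" and "i < n"
  shows "b ` {..<i} \<subset> b ` {..<Suc i}"
proof -
  have "b i \<notin> b ` {..<i}" using b \<open>i < n\<close> by (auto simp: bij_betw_def dest: inj_onD)
  then show ?thesis by (auto simp: lessThan_Suc)
qed

text \<open>A chain of primes below the ideal generated by the variables in \<open>C\<close> is prolonged by
  adding the remaining variables one by one, so the dimension bound gives the height.\<close>

theorem prime_height_var_ideal:
  "prime_height mpoly_ring (var_ideal C :: ('v::finite, 'k::field) mpoly set) = enat (card C)"
proof -
  let ?P = "var_ideal :: 'v set \<Rightarrow> ('v, 'k) mpoly set"
  let ?chain = "\<lambda>n. \<exists>Q. (\<forall>i\<le>n. primeideal (Q i) mpoly_ring) \<and> (\<forall>i<n. Q i \<subset> Q (Suc i)) \<and> Q n = ?P C"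
  have exists: "?chain (card C)"
  proof -
    obtain b where b: "bij_betw b {..<card C} C"
      using ex_bij_betw_nat_finite[of C] by (auto simp: atLeast0LessThan)
    show ?thesis
    proof (intro exI[of _ "\<lambda>i. ?P (b ` {..<i})"] conjI allI impI)
      fix i
      show "primeideal (?P (b ` {..<i})) mpoly_ring" by (rule primeideal_var_ideal)
      assume "i < card C"
      then show "?P (b ` {..<i}) \<subset> ?P (b ` {..<Suc i})"
        by (intro var_ideal_strict_mono enumeration_strict_chain[OF b])
    next
      show "?P (b ` {..<card C}) = ?P C" using b by (simp add: bij_betw_def)
    qed
  qed
  have upper: "n \<le> card C" if chain: "?chain n" for n
  proof -
    obtain Q where Q: "\<forall>i\<le>n. primeideal (Q i) mpoly_ring" "\<forall>i<n. Q i \<subset> Q (Suc i)" "Q n = ?P C"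
      using chain by blast
    let ?k = "card (- C)"
    obtain b where b: "bij_betw b {..<?k} (- C)"
      using ex_bij_betw_nat_finite[of "- C"] by (auto simp: atLeast0LessThan)
    define Q' where "Q' i = (if i \<le> n then Q i else ?P (C \<union> b ` {..<i - n}))" for i
    have "n + ?k \<le> CARD('v)"
    proof (rule prime_chain_length_le)
      fix i assume "i \<le> n + ?k"
      show "primeideal (Q' i) mpoly_ring"
        unfolding Q'_def using Q(1) primeideal_var_ideal by auto
    next
      fix i assume i: "i < n + ?k"
      show "Q' i \<subset> Q' (Suc i)"
      proof (cases "i < n")
        case True
        then show ?thesis using Q(2) by (simp add: Q'_def)
      next
        case False
        \<comment> \<open>At \<open>i = n\<close> both descriptions of \<open>Q'\<close> agree,
          since no variable has been added yet.\<close>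
        then have eq: "Q' i = ?P (C \<union> b ` {..<i - n})" using Q(3) by (cases "i = n") (auto simp: Q'_def)
        have less: "i - n < ?k" using i False by simp
        have "b ` {..<Suc (i - n)} \<subseteq> - C" using b less by (auto simp: bij_betw_def)
        then have "C \<union> b ` {..<i - n} \<subset> C \<union> b ` {..<Suc (i - n)}"
          using enumeration_strict_chain[OF b less] by blast
        moreover have "Q' (Suc i) = ?P (C \<union> b ` {..<Suc (i - n)})"
          using False by (simp add: Q'_def Suc_diff_le)
        ultimately show ?thesis unfolding eq using var_ideal_strict_mono by metis
      qed
    qed
    moreover have "card C + ?k = CARD('v)"
      using card_Un_disjoint[of C "- C"] by simp
    ultimately show ?thesis by simp
  qed
  show ?thesis
    unfolding prime_height_def
  proof (rule antisym)
    show "Sup {enat n | n. ?chain n} \<le> enat (card C)"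
    proof (rule Sup_least)
      fix h assume "h \<in> {enat n | n. ?chain n}"
      then obtain n where "h = enat n" "?chain n" by blast
      then show "h \<le> enat (card C)" using upper[of n] by simp
    qed
    show "enat (card C) \<le> Sup {enat n | n. ?chain n}"
      by (rule Sup_upper) (use exists in blast)
  qed
qed

theorem unmixed_edge_ideal_iff:
  fixes D :: "'v::finite wograph"
  assumes "weighted_oriented_graph D"
  shows "unmixed mpoly_ring (edge_ideal D :: ('v, 'k::field) mpoly set) \<longleftrightarrow>
    (\<forall>C C'. strong_vertex_cover D C \<and> strong_vertex_cover D C' \<longrightarrow> card C = card C')"
proof -
  have "unmixed mpoly_ring (edge_ideal D :: ('v, 'k) mpoly set) \<longleftrightarrow>
      (\<forall>C C'. strong_vertex_cover D C \<longrightarrow> strong_vertex_cover D C' \<longrightarrow>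
        prime_height mpoly_ring (var_ideal C :: ('v, 'k) mpoly set) =
        prime_height mpoly_ring (var_ideal C' :: ('v, 'k) mpoly set))"
    unfolding unmixed_def associated_primes_edge_ideal[OF assms] by blast
  then show ?thesis unfolding prime_height_var_ideal enat.inject by blast
qed

section \<open>The characterisation\<close>

text \<open>A vertex with all its neighbours in the cover could be dropped, so in a minimum cover no
  vertex needs a witness.\<close>

lemma minimum_vertex_cover_strong:
  fixes D :: "'v::finite wograph"
  assumes D: "weighted_oriented_graph D"
    and C: "vertex_cover (underlying_graph D) C" "card C = cover_number (underlying_graph D)"
  shows "strong_vertex_cover D C"
proof -
  have "\<exists>y. y \<in> nbrs D x \<and> y \<notin> C" if x: "x \<in> C" for x
  proof (rule ccontr)
    assume no: "\<not> ?thesis"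
    have loopless: "(x, x) \<notin> arcs D"
      using D unfolding weighted_oriented_graph_def by (metis asymD)
    have "vertex_cover (underlying_graph D) (C - {x})"
      unfolding vertex_cover_underlying_graph_iff
    proof (intro conjI ballI)
      show "C - {x} \<subseteq> dverts D" using C(1) unfolding vertex_cover_underlying_graph_iff by blast
      fix e assume e: "e \<in> arcs D"
      obtain a b where ab: "e = (a, b)" by (cases e)
      have "a \<in> C \<or> b \<in> C" using C(1) e ab unfolding vertex_cover_underlying_graph_iff by blast
      moreover have "b \<in> C" "b \<noteq> x" if "a = x"
        using no e ab that loopless unfolding nbrs_iff by blast+
      moreover have "a \<in> C" "a \<noteq> x" if "b = x"
        using no e ab that loopless unfolding nbrs_iff by blast+
      ultimately show "case e of (a, b) \<Rightarrow> a \<in> C - {x} \<or> b \<in> C - {x}" unfolding ab by auto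
    qed
    then have "cover_number (underlying_graph D) \<le> card (C - {x})"
      by (intro cover_number_le) simp_all
    moreover have "card (C - {x}) < card C" using x by (intro psubset_card_mono) auto
    ultimately show False using C(2) by simp
  qed
  then show ?thesis using C(1) unfolding strong_vertex_cover_def by blast
qed

text \<open>Both numbers are sums over the cliques that compare term by term,
  \<open>card S - 1\<close> against \<open>card (C \<inter> S)\<close>, and the terms differ exactly
  when \<open>S\<close> lies in \<open>C\<close>.\<close>

lemma card_cover_eq_cover_number_iff:
  assumes fin: "finite (verts G)" and edges: "\<And>e x. e \<in> edges G \<Longrightarrow> e \<noteq> {} \<and> e \<noteq> {x}"
    and H: "tau_reduction G \<H>" "\<forall>S\<in>\<H>. complete_graph (induced_subgraph G S)"
    and C: "vertex_cover G C"
  shows "card C = cover_number G \<longleftrightarrow> (\<forall>S\<in>\<H>. \<not> S \<subseteq> C)"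
proof -
  have part: "partition_on (verts G) \<H>"
    and \<tau>: "cover_number G = (\<Sum>S\<in>\<H>. cover_number (induced_subgraph G S))"
    using H(1) by (auto simp: tau_reduction_def)
  have fin\<H>: "finite \<H>" by (rule finite_elements[OF fin part])
  have clique: "clique G S" if "S \<in> \<H>" for S
  proof -
    have "S \<subseteq> verts G" using part that unfolding partition_on_def by blast
    then show ?thesis using H(2) that complete_induced_subgraph_iff_clique by blast
  qed
  have ne: "S \<noteq> {}" if "S \<in> \<H>" for S using part that unfolding partition_on_def by blast
  have finS: "finite S" if "S \<in> \<H>" for S using finite_clique[OF fin clique[OF that]] .
  have \<tau>': "cover_number G = (\<Sum>S\<in>\<H>. card S - 1)"
    unfolding \<tau> using cover_number_clique[OF fin edges clique ne] by (intro sum.cong) auto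
  have cardC: "card C = (\<Sum>S\<in>\<H>. card (C \<inter> S))"
    using C by (intro card_partition_inter[OF part fin]) (simp add: vertex_cover_def)
  have ge: "card S - 1 \<le> card (C \<inter> S)" if "S \<in> \<H>" for S
    by (rule card_clique_minus_1_le_card_cover_inter[OF fin clique[OF that] C])
  show ?thesis
  proof
    assume eq: "card C = cover_number G"
    show "\<forall>S\<in>\<H>. \<not> S \<subseteq> C"
    proof (intro ballI notI)
      fix S assume S: "S \<in> \<H>" "S \<subseteq> C"
      have "0 < card S" using finS[OF S(1)] ne[OF S(1)] by (simp add: card_gt_0_iff)
      then have "card S - 1 < card (C \<inter> S)" using S(2) by (simp add: Int_absorb1)
      then have "(\<Sum>S\<in>\<H>. card S - 1) < (\<Sum>S\<in>\<H>. card (C \<inter> S))"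
        using S(1) ge by (intro sum_strict_mono_ex1[OF fin\<H>]) auto
      then show False using eq cardC \<tau>' by simp
    qed
  next
    assume no: "\<forall>S\<in>\<H>. \<not> S \<subseteq> C"
    have "card (C \<inter> S) = card S - 1" if S: "S \<in> \<H>" for S
    proof -
      have "C \<inter> S \<subset> S" using no S by blast
      then have "card (C \<inter> S) < card S" using finS[OF S] by (rule psubset_card_mono[rotated])
      then show ?thesis using ge[OF S] by simp
    qed
    then show "card C = cover_number G" unfolding cardC \<tau>' by (intro sum.cong) auto
  qed
qed

theorem theorem3p11:
  fixes D :: "'v::finite wograph"
  assumes "weighted_oriented_graph D"
    and "\<forall>x. source D x \<longrightarrow> weight D x = 1"
    and "perfect_graph (underlying_graph D)"
  shows "(\<exists>\<H>. tau_reduction (underlying_graph D) \<H> \<and>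
            (\<forall>S\<in>\<H>. complete_graph (induced_subgraph (underlying_graph D) S))) \<and>
         (\<forall>\<H>. tau_reduction (underlying_graph D) \<H> \<and>
            (\<forall>S\<in>\<H>. complete_graph (induced_subgraph (underlying_graph D) S)) \<longrightarrow>
            (unmixed mpoly_ring (edge_ideal D :: ('v, 'k::field) mpoly set) \<longleftrightarrow>
             \<not> (\<exists>S\<in>\<H>. \<exists>H. generating_star_semi_forest D (induced_oriented_subgraph D S) H)))"
proof
  let ?G = "underlying_graph D"
  have V: "dverts D = UNIV" and loopless: "\<And>x. (x, x) \<notin> arcs D"
    using assms(1) unfolding weighted_oriented_graph_def by (blast, metis asymD)
  have fin: "finite (verts ?G)" by simp
  have edge: "\<exists>x y. e = {x, y} \<and> x \<noteq> y" if "e \<in> edges ?G" for e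
    using that loopless by (auto simp: underlying_graph_def) metis
  have edges: "e \<noteq> {} \<and> e \<noteq> {x}" if e: "e \<in> edges ?G" for e x
    using edge[OF e] by (auto simp: doubleton_eq_iff)
  show "\<exists>\<H>. tau_reduction ?G \<H> \<and> (\<forall>S\<in>\<H>. complete_graph (induced_subgraph ?G S))"
  proof (rule perfect_graph_tau_reduction[OF fin _ _ _ assms(3)])
    fix e assume e: "e \<in> edges ?G"
    show "e \<noteq> {} \<and> e \<noteq> {x}" for x by (rule edges[OF e])
    show "e \<subseteq> verts ?G" using V by simp
    show "\<exists>x y. e = {x, y}" using edge[OF e] by blast
  qed
  show "\<forall>\<H>. tau_reduction ?G \<H> \<and> (\<forall>S\<in>\<H>. complete_graph (induced_subgraph ?G S)) \<longrightarrow>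
    (unmixed mpoly_ring (edge_ideal D :: ('v, 'k) mpoly set) \<longleftrightarrow>
     \<not> (\<exists>S\<in>\<H>. \<exists>H. generating_star_semi_forest D (induced_oriented_subgraph D S) H))"
  proof (intro allI impI, elim conjE)
    fix \<H> assume \<H>: "tau_reduction ?G \<H>" "\<forall>S\<in>\<H>. complete_graph (induced_subgraph ?G S)"
    have "\<forall>e\<in>edges ?G. e \<subseteq> verts ?G \<and> e \<noteq> {}" using V edges by auto
    then obtain C\<^sub>0 where C\<^sub>0: "vertex_cover ?G C\<^sub>0" "card C\<^sub>0 = cover_number ?G"
      using minimum_vertex_cover_exists[OF fin] by blast
    have "strong_vertex_cover D C\<^sub>0" by (rule minimum_vertex_cover_strong[OF assms(1) C\<^sub>0])
    then have "unmixed mpoly_ring (edge_ideal D :: ('v, 'k) mpoly set) \<longleftrightarrow>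
        (\<forall>C. strong_vertex_cover D C \<longrightarrow> card C = cover_number ?G)"
      unfolding unmixed_edge_ideal_iff[OF assms(1)] using C\<^sub>0(2) by metis
    also have "\<dots> \<longleftrightarrow> \<not> (\<exists>S\<in>\<H>. \<exists>C. strong_vertex_cover D C \<and> S \<subseteq> C)"
      using card_cover_eq_cover_number_iff[OF fin edges \<H>] unfolding strong_vertex_cover_def by blast
    also have "\<dots> \<longleftrightarrow> \<not> (\<exists>S\<in>\<H>. \<exists>H. star_semi_forest D H \<and> dverts H = S)"
      using star_semi_forest_of_strong_vertex_cover[OF assms(1)]
        strong_vertex_cover_of_star_semi_forest[OF assms(1)] by metis
    finally show "unmixed mpoly_ring (edge_ideal D :: ('v, 'k) mpoly set) \<longleftrightarrow>
        \<not> (\<exists>S\<in>\<H>. \<exists>H. generating_star_semi_forest D (induced_oriented_subgraph D S) H)"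
      by (simp add: generating_star_semi_forest_def induced_oriented_subgraph_def)
  qed
qed

end
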